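(* Let $p$ be a real number with $p\neq -n,0$, let $K$ be a convex body in $\mathcal{K}_{\mathrm{reg}}$ evolving under the $p$-flow, and denote by $K(t)$ the solution to the flow for as long as it exists and remains in the class $\mathcal{K}_{\mathrm{reg}}$. Then $$\mathrm{Vol}(K(t))=\mathrm{Vol}(K)-t\,\Omega_{1,p}(K)+\frac{t^2}{2}\,\Omega_{2,p}(K)-\frac{t^3}{3!}\,\Omega_{3,p}(K)+\cdots,$$ where each of the coefficients $\Omega_{k,p}(K)$, $k=2,3,\dots$, is a centro-affine invariant of $K$ whose integral representation can be determined explicitly by $$\Omega_{k,p}(K)=(-1)^k\,\frac{d^k}{dt^k}\,\mathrm{Vol}(K(t))\Big|_{t=0}=(-1)^k\,\delta^k\,\mathrm{Vol}(K).$$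
   Context: $\mathcal{K}_{\mathrm{reg}}$ is the set of smooth convex bodies (compact convex sets) in $\mathbb{R}^n$ containing the origin in their interior and having positive Gauss curvature at all boundary points. The $p$-flow is the evolution of $K(t)\in\mathcal{K}_{\mathrm{reg}}$, $K(0)=K$, whose support functions $h(u,t)=\max_{x\in K(t)}x\cdot u$, $u\in\mathbb{S}^{n-1}$, satisfy $$\frac{\partial h}{\partial t}(u,t)=-\mathrm{sgn}\Big(\frac{p}{n+p}\Big)\,h(u,t)^{-\frac{n(p-1)}{n+p}}\,\mathcal{K}(u,t)^{\frac{p}{n+p}},\qquad h(u,0)=h_K(u),$$ where $\mathcal{K}(u,t)$ is the Gauss curvature of $\partial K(t)$ at the point with outer unit normal $u$ (so $1/\mathcal{K}=\det(\bar\nabla^2h+h\,\mathrm{Id})$, with $\bar\nabla$ the covariant derivative on $\mathbb{S}^{n-1}$ in an orthonormal frame). $\delta^k\,\mathrm{Vol}(K)$ denotes the $k$-th variation of the volume along the flow at $t=0$. The first coefficient is $\Omega_{1,p}(K)=-\frac{d}{dt}\mathrm{Vol}(K(t))|_{t=0}=\mathrm{sgn}\big(\frac{p}{n+p}\big)\,\Omega_p(K)$, where $\Omega_p(K)=\int_{\mathbb{S}^{n-1}}\big(\mathcal{K}/h_K^{n+1}\big)^{\frac{p}{n+p}}\frac{h_K}{\mathcal{K}}\,d\mu_{\mathbb{S}^{n-1}}$ is the $p$-affine surface area of $K$ (here $\mathcal{K}$ is the Gauss curvature of $\partial K$ as a function of the outer unit normal). A centro-affine invariant of $K$ is a quantity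 that is unchanged when $K$ is replaced by $AK$, $A\in SL(n)$. *)

theory Defs
  imports "HOL-Analysis.Analysis" "HOL-Library.Landau_Symbols"
begin

section \<open>Smooth functions\<close>

text \<open>
  Derivatives are taken within \<open>S\<close>. The definition is meant for open sets and for products of an open
  set with an interval \<open>{0..<T}\<close>, where derivatives within the set are unique; on the latter it
  expresses smoothness up to and including time 0.
\<close>

primrec C_on :: "nat \<Rightarrow> 'a::real_normed_vector set \<Rightarrow> ('a \<Rightarrow> 'b::real_normed_vector) \<Rightarrow> bool" where
  "C_on 0 S f \<longleftrightarrow> continuous_on S f"
| "C_on (Suc k) S f \<longleftrightarrow>
     (\<exists>f'. (\<forall>x\<in>S. (f has_derivative f' x) (at x within S)) \<and> (\<forall>v. C_on k S (\<lambda>x. f' x v)))"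

definition smooth_on :: "'a::real_normed_vector set \<Rightarrow> ('a \<Rightarrow> 'b::real_normed_vector) \<Rightarrow> bool" where
  "smooth_on S f \<longleftrightarrow> (\<forall>k. C_on k S f)"

text \<open>The derivative on \<open>[0, \<infinity>)\<close>: one-sided at 0, two-sided at positive times.\<close>

definition time_deriv :: "(real \<Rightarrow> real) \<Rightarrow> real \<Rightarrow> real" where
  "time_deriv f t = vector_derivative f (at t within {0..})"


section \<open>Convex bodies with smooth boundary\<close>

definition vol :: "(real^'n) set \<Rightarrow> real" where
  "vol K = measure lebesgue K"

definition support_fun :: "(real^'n) set \<Rightarrow> real^'n \<Rightarrow> real" where
  "support_fun K u = (SUP x\<in>K. x \<bullet> u)"

text \<open>The boundary is locally a regular level set of a smooth function.\<close>

definition smooth_boundary :: "(real^'n) set \<Rightarrow> bool" where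
  "smooth_boundary K \<longleftrightarrow>
     (\<forall>x\<in>frontier K. \<exists>U f. open U \<and> x \<in> U \<and> smooth_on U (f :: real^'n \<Rightarrow> real) \<and>
        (\<forall>y\<in>U. \<exists>v. frechet_derivative f (at y) v \<noteq> 0) \<and>
        frontier K \<inter> U = {y \<in> U. f y = 0})"

definition outer_normal :: "(real^'n) set \<Rightarrow> real^'n \<Rightarrow> real^'n" where
  "outer_normal K x = (THE v. norm v = 1 \<and> (\<forall>y\<in>K. (y - x) \<bullet> v \<le> 0))"

text \<open>
  For a unit vector \<open>u\<close>, the determinant of the bilinear form \<open>B\<close> restricted to the hyperplane
  orthogonal to \<open>u\<close>, with respect to any orthonormal frame of that hyperplane. The matrix below
  represents the extension of \<open>B\<close> that makes \<open>u\<close> a unit vector orthogonal to the hyperplane; in a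
  basis consisting of \<open>u\<close> and a frame it is block diagonal with blocks 1 and the matrix of \<open>B\<close>.
\<close>

definition tangent_det :: "real^'n \<Rightarrow> (real^'n \<Rightarrow> real^'n \<Rightarrow> real) \<Rightarrow> real" where
  "tangent_det u B =
     (let P = (\<lambda>v. v - (v \<bullet> u) *\<^sub>R u)
      in det (\<chi> i j. B (P (axis i 1)) (P (axis j 1)) + u $ i * u $ j))"

text \<open>
  The determinant of the shape operator, i.e. of the differential of the Gauss map. The derivative
  within the frontier is uniquely determined only on tangent vectors, and \<open>tangent_det\<close> evaluates it
  only there.
\<close>

definition gauss_curvature :: "(real^'n) set \<Rightarrow> real^'n \<Rightarrow> real" where
  "gauss_curvature K x =
     tangent_det (outer_normal K x)
       (\<lambda>v w. frechet_derivative (outer_normal K) (at x within frontier K) v \<bullet> w)"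

definition K_reg :: "(real^'n) set set" where
  "K_reg = {K. compact K \<and> convex K \<and> 0 \<in> interior K \<and> smooth_boundary K \<and>
               (\<forall>x\<in>frontier K. gauss_curvature K x > 0)}"

text \<open>The Gauss curvature as a function of the outer unit normal.\<close>

definition normal_curvature :: "(real^'n) set \<Rightarrow> real^'n \<Rightarrow> real" where
  "normal_curvature K u = gauss_curvature K (THE x. x \<in> frontier K \<and> outer_normal K x = u)"


section \<open>Affine surface area and the flow\<close>

text \<open>
  The measure of a Borel subset of the sphere is \<open>n\<close> times the volume of the cone over it inside the
  unit ball; note that \<open>sgn x = x /\<^sub>R norm x\<close>.
\<close>

definition sphere_measure :: "(real^'n) measure" where
  "sphere_measure = scale_measure (of_nat CARD('n))
     (distr (restrict_space lborel (ball 0 1 - {0})) (restrict_space borel (sphere 0 1)) sgn)"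

text \<open>
  In the next two definitions \<open>n\<close> is the dimension, and \<open>h\<close>, \<open>\<kappa>\<close> are the values of the support function
  and of the Gauss curvature at a given normal.
\<close>

definition p_integrand :: "nat \<Rightarrow> real \<Rightarrow> real \<Rightarrow> real \<Rightarrow> real" where
  "p_integrand n p h \<kappa> = (\<kappa> / h ^ (n + 1)) powr (p / (n + p)) * (h / \<kappa>)"

definition p_speed :: "nat \<Rightarrow> real \<Rightarrow> real \<Rightarrow> real \<Rightarrow> real" where
  "p_speed n p h \<kappa> =
     - sgn (p / (n + p)) * h powr (- (n * (p - 1) / (n + p))) * \<kappa> powr (p / (n + p))"

definition affine_surface_area :: "real \<Rightarrow> (real^'n) set \<Rightarrow> real" where
  "affine_surface_area p K =
     (LINT u|sphere_measure. p_integrand CARD('n) p (support_fun K u) (normal_curvature K u))"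

text \<open>
  A classical solution of the flow on \<open>[0, T)\<close> that stays in the class; \<open>T\<close> is any positive time up to
  which the solution exists, not necessarily the maximal one. The support functions are smooth on
  sphere times \<open>[0, T)\<close>, expressed through the extension that is constant along rays.
\<close>

definition p_flow :: "real \<Rightarrow> real \<Rightarrow> (real \<Rightarrow> (real^'n) set) \<Rightarrow> bool" where
  "p_flow p T K \<longleftrightarrow>
     0 < T \<and>
     (\<forall>t\<in>{0..<T}. K t \<in> K_reg) \<and>
     smooth_on ((- {0}) \<times> {0..<T}) (\<lambda>(x, t). support_fun (K t) (sgn x)) \<and>
     (\<forall>t\<in>{0..<T}. \<forall>u\<in>sphere 0 1.
        ((\<lambda>s. support_fun (K s) u) has_real_derivative
           p_speed CARD('n) p (support_fun (K t) u) (normal_curvature (K t) u)) (at t within {0..<T}))"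

definition volume_variation :: "real \<Rightarrow> nat \<Rightarrow> (real^'n) set \<Rightarrow> real" where
  "volume_variation p k K =
     (let Kt = (SOME Kt. Kt 0 = K \<and> (\<exists>T. p_flow p T Kt))
      in (time_deriv ^^ k) (\<lambda>t. vol (Kt t)) 0)"

definition Omega :: "nat \<Rightarrow> real \<Rightarrow> (real^'n) set \<Rightarrow> real" where
  "Omega k p K = (-1) ^ k * volume_variation p k K"


section \<open>Explicit integrands\<close>

text \<open>
  Here \<open>h\<close> is an arbitrary function on the unit sphere (its values elsewhere are irrelevant). Its
  covariant Hessian at \<open>u\<close> is the Euclidean Hessian, on vectors orthogonal to \<open>u\<close>, of the extension
  of \<open>h\<close> that is constant along rays: that extension has vanishing normal derivative, so the second
  fundamental form of the sphere does not contribute.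
\<close>

definition sphere_hessian ::
    "(real^'n \<Rightarrow> real) \<Rightarrow> real^'n \<Rightarrow> real^'n \<Rightarrow> real^'n \<Rightarrow> real" where
  "sphere_hessian h u v w =
     frechet_derivative (\<lambda>x. frechet_derivative (h \<circ> sgn) (at x) w) (at u) v"

definition curvature_of_support :: "(real^'n \<Rightarrow> real) \<Rightarrow> real^'n \<Rightarrow> real" where
  "curvature_of_support h u =
     1 / tangent_det u (\<lambda>v w. sphere_hessian h u v w + h u * (v \<bullet> w))"

definition affine_density :: "real \<Rightarrow> (real^'n \<Rightarrow> real) \<Rightarrow> real^'n \<Rightarrow> real" where
  "affine_density p h u =
     sgn (p / (real CARD('n) + p)) * p_integrand CARD('n) p (h u) (curvature_of_support h u)"

text \<open>
  The pointwise variation of an integrand \<open>F\<close> (a differential expression in the support function) in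
  the direction in which the flow moves \<open>h\<close>. Iterating it on \<open>affine_density\<close> is the repeated
  differentiation of the first coefficient under the integral sign.
\<close>

definition flow_variation ::
    "real \<Rightarrow> ((real^'n \<Rightarrow> real) \<Rightarrow> real^'n \<Rightarrow> real) \<Rightarrow> (real^'n \<Rightarrow> real) \<Rightarrow> real^'n \<Rightarrow> real" where
  "flow_variation p F h u =
     deriv (\<lambda>s. F (\<lambda>v. h v + s * p_speed CARD('n) p (h v) (curvature_of_support h v)) u) 0"

end

theory Submission
  imports Defs
begin

text \<open>
  Volume: if \<open>X\<close> is the gradient of the support function \<open>h\<close> of \<open>K\<close>, then \<open>y \<mapsto> |y| X(y)\<close> maps the unit
  ball onto \<open>K\<close> with Jacobian \<open>h / \<kappa>\<close>, which gives the volume; multiplying this map by \<open>h\<^sub>L / h\<close>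
  covers any other body \<open>L\<close>, so \<open>n Vol(L) \<le> \<integral> (h\<^sub>L / h)\<^sup>n h / \<kappa>\<close>. Applying the inequality to two times
  of the flow, in both orders, squeezes the difference quotient of the volume and yields
  \<open>d/dt Vol = \<integral> (dh/dt) / \<kappa>\<close> without integration by parts on the sphere.

  Higher derivatives: the integrand is a nonlinear differential operator \<open>Q\<close> applied to \<open>h\<close>. By
  structural induction on \<open>Q\<close>, using that space and time derivatives commute, the derivative of
  \<open>Q(h)\<close> along any family of functions depends only on \<open>h\<close> and its velocity and is again such an
  operator when the velocity is one. So all derivatives of the volume are integrals of operators
  applied to the support function of the initial body; they are the same for every solution, they
  agree with \<open>flow_variation\<close>, and since the image of a solution under \<open>SL(n)\<close> is a solution, they
  are centro-affine invariants.
\<close>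

section \<open>Smooth functions\<close>

text \<open>Differentiating the volume formula under the integral would also differentiate the
  Hessian determinant in time, and only an integration by parts turns that term back into the speed.
  In the two-body inequality the determinant of the reference body is fixed; after exchanging the
  bodies the moving determinant occurs only with a factor that vanishes at the reference time. Both
  bounds therefore have the same first derivative.

  \<open>K_reg\<close> speaks of boundary charts, the flow of support functions. Smoothness of the
  support function is read off from the flow, at time 0 as well; the charts serve to make the outer
  normal differentiable, so that Gauss curvature and Hessian determinant can be identified as
  reciprocals.

  Time 0 is an endpoint, so derivatives are taken within sets and mixed derivatives have to commute
  up to the boundary. The linear family behind \<open>flow_variation\<close> consists of functions
  that need not be support functions of bodies, hence the operators act on a class of functions
  described by positivity alone. The expansion is asymptotic: at every order the remainder is of
  smaller order, and no convergence of the series is claimed.\<close>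

lemma C_on_SucE:
  assumes "C_on (Suc k) S f"
  obtains f' where "\<forall>x\<in>S. (f has_derivative f' x) (at x within S)" "\<forall>v. C_on k S (\<lambda>x. f' x v)"
  using assms unfolding C_on.simps by (elim exE conjE) (rule that)

lemma C_on_Suc_imp: "C_on (Suc k) S f \<Longrightarrow> C_on k S f"
proof (induction k arbitrary: f)
  case 0
  then show ?case
    by (auto simp: continuous_on_eq_continuous_within intro: has_derivative_continuous)
next
  case (Suc k)
  from Suc.prems obtain f' where "\<forall>x\<in>S. (f has_derivative f' x) (at x within S)"
    and "\<forall>v. C_on (Suc k) S (\<lambda>x. f' x v)"
    by (auto simp del: C_on.simps simp: C_on.simps(2)[of "Suc k"])
  with Suc.IH show ?case by (auto simp: C_on.simps(2)[of k])
qed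

lemma C_on_cong: "(\<And>x. x \<in> S \<Longrightarrow> f x = g x) \<Longrightarrow> C_on k S f \<Longrightarrow> C_on k S g"
proof (cases k)
  case 0
  assume *: "\<And>x. x \<in> S \<Longrightarrow> f x = g x" "C_on k S f"
  then show ?thesis using 0 continuous_on_cong by (metis C_on.simps(1))
next
  case (Suc m)
  assume *: "\<And>x. x \<in> S \<Longrightarrow> f x = g x" "C_on k S f"
  then obtain f' where f': "\<forall>x\<in>S. (f has_derivative f' x) (at x within S)"
     "\<forall>v. C_on m S (\<lambda>x. f' x v)" using Suc by auto
  have "\<forall>x\<in>S. (g has_derivative f' x) (at x within S)"
    using f'(1) * by (metis has_derivative_transform)
  then show ?thesis using f' Suc by auto
qed

lemma C_on_subset: "C_on k S f \<Longrightarrow> T \<subseteq> S \<Longrightarrow> C_on k T f"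
proof (induction k arbitrary: f)
  case 0
  then show ?case by (auto intro: continuous_on_subset)
next
  case (Suc k)
  then obtain f' where f': "\<forall>x\<in>S. (f has_derivative f' x) (at x within S)"
     "\<forall>v. C_on k S (\<lambda>x. f' x v)" by auto
  have "\<forall>x\<in>T. (f has_derivative f' x) (at x within T)"
    using f'(1) Suc.prems(2) by (meson has_derivative_subset subsetD)
  then show ?case using f'(2) Suc.IH Suc.prems(2) by auto
qed

lemma C_on_const [simp]: "C_on k S (\<lambda>x. c)"
  by (induction k arbitrary: c) (auto intro!: exI[of _ "\<lambda>x v. 0"])

lemma C_on_bounded_linear: "bounded_linear f \<Longrightarrow> C_on k S f"
  by (cases k) (auto simp: linear_continuous_on
      intro!: exI[of _ "\<lambda>x. f"] bounded_linear_imp_has_derivative)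

lemma C_on_add:
  "C_on k S f \<Longrightarrow> C_on k S g \<Longrightarrow> C_on k S (\<lambda>x. f x + g x)"
proof (induction k arbitrary: f g)
  case 0
  then show ?case by (auto intro: continuous_intros)
next
  case (Suc k)
  from Suc.prems obtain f' g' where *: "\<forall>x\<in>S. (f has_derivative f' x) (at x within S)"
     "\<forall>v. C_on k S (\<lambda>x. f' x v)" "\<forall>x\<in>S. (g has_derivative g' x) (at x within S)"
     "\<forall>v. C_on k S (\<lambda>x. g' x v)" by auto
  show ?case using * Suc.IH
    by (auto intro!: exI[of _ "\<lambda>x v. f' x v + g' x v"] has_derivative_add)
qed

lemma C_on_bilinear:
  assumes "bounded_bilinear pr"
  shows "C_on k S f \<Longrightarrow> C_on k S g \<Longrightarrow> C_on k S (\<lambda>x. pr (f x) (g x))"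
proof (induction k arbitrary: f g)
  case 0
  then show ?case by (auto intro: bounded_bilinear.continuous_on[OF assms])
next
  case (Suc k)
  from Suc.prems obtain f' g' where *: "\<forall>x\<in>S. (f has_derivative f' x) (at x within S)"
     "\<forall>v. C_on k S (\<lambda>x. f' x v)" "\<forall>x\<in>S. (g has_derivative g' x) (at x within S)"
     "\<forall>v. C_on k S (\<lambda>x. g' x v)" by auto
  show ?case using * Suc.IH Suc.prems[THEN C_on_Suc_imp]
    by (auto intro!: exI[of _ "\<lambda>x v. pr (f x) (g' x v) + pr (f' x v) (g x)"]
        bounded_bilinear.FDERIV[OF assms] C_on_add)
qed

lemma C_on_sum:
  "(\<And>i. i \<in> I \<Longrightarrow> C_on k S (f i)) \<Longrightarrow> C_on k S (\<lambda>x. \<Sum>i\<in>I. f i x)"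
  by (induction I rule: infinite_finite_induct) (auto intro: C_on_add)

text \<open>\<open>C_on\<close> controls the derivative only in fixed directions, whereas the chain
  rule evaluates \<open>f'\<close> in the moving direction \<open>g' x v\<close>. Expanding that
  vector over \<open>Basis\<close> of the intermediate space turns the derivative into a finite sum
  of products to which the induction hypothesis applies.\<close>

lemma C_on_compose:
  fixes f :: "'b::euclidean_space \<Rightarrow> 'c::real_normed_vector"
  assumes "C_on k S g" "C_on k T f" "g ` S \<subseteq> T"
  shows "C_on k S (\<lambda>x. f (g x))"
  using assms
proof (induction k arbitrary: f g)
  case 0
  then show ?case by (auto intro: continuous_on_compose2)
next
  case (Suc k)
  from C_on_SucE[OF Suc.prems(2)] obtain f' where f': "\<forall>x\<in>T. (f has_derivative f' x) (at x within T)"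
     "\<forall>v. C_on k T (\<lambda>x. f' x v)" by blast
  from C_on_SucE[OF Suc.prems(1)] obtain g' where g': "\<forall>x\<in>S. (g has_derivative g' x) (at x within S)"
     "\<forall>v. C_on k S (\<lambda>x. g' x v)" by blast
  have D: "((\<lambda>x. f (g x)) has_derivative (\<lambda>v. f' (g x) (g' x v))) (at x within S)" if "x \<in> S" for x
  proof (rule has_derivative_in_compose[where g=f])
    show "(g has_derivative g' x) (at x within S)" using g' that by blast
    show "(f has_derivative f' (g x)) (at (g x) within g ` S)"
      using f'(1) that Suc.prems(3) by (meson has_derivative_subset imageI subsetD)
  qed
  have E: "f' (g x) (g' x v) = (\<Sum>b\<in>Basis. (g' x v \<bullet> b) *\<^sub>R f' (g x) b)" if "x \<in> S" for x v
  proof -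
    have "linear (f' (g x))" using f'(1) that Suc.prems(3) has_derivative_linear by blast
    then have "f' (g x) (\<Sum>b\<in>Basis. (g' x v \<bullet> b) *\<^sub>R b) = (\<Sum>b\<in>Basis. (g' x v \<bullet> b) *\<^sub>R f' (g x) b)"
      by (simp add: linear_sum linear_cmul)
    then show ?thesis by (simp add: euclidean_representation)
  qed
  have "C_on k S (\<lambda>x. \<Sum>b\<in>Basis. (g' x v \<bullet> b) *\<^sub>R f' (g x) b)" for v
    using f'(2) g'(2) Suc.IH[OF C_on_Suc_imp[OF Suc.prems(1)] _ Suc.prems(3)]
    by (intro C_on_sum C_on_bilinear[OF bounded_bilinear_scaleR] C_on_bilinear[OF bounded_bilinear_inner]
        C_on_const) blast+
  then have "C_on k S (\<lambda>x. f' (g x) (g' x v))" for v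
    by (rule C_on_cong[rotated]) (simp add: E)
  then show ?case using D by (auto intro!: exI[of _ "\<lambda>x v. f' (g x) (g' x v)"])
qed

lemma C_on_powr: "C_on k {0<..} (\<lambda>x::real. x powr a)"
proof (induction k arbitrary: a)
  case 0
  then show ?case by (auto intro!: continuous_intros)
next
  case (Suc k)
  have "((\<lambda>x::real. x powr a) has_derivative (\<lambda>v. v * (a * x powr (a - 1)))) (at x within {0<..})"
    if "x > 0" for x
    using that by (auto intro!: derivative_eq_intros ext simp: field_simps powr_diff)
  moreover have "C_on k {0<..} (\<lambda>x. v * (a * x powr (a - 1)))" for v
    using C_on_bilinear[OF bounded_bilinear_mult C_on_const C_on_bilinear[OF bounded_bilinear_mult C_on_const Suc]]
    by simp
  ultimately show ?case by (auto intro!: exI[of _ "\<lambda>x v. v * (a * x powr (a - 1))"])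
qed

lemma smooth_on_cong: "(\<And>x. x \<in> S \<Longrightarrow> f x = g x) \<Longrightarrow> smooth_on S f \<Longrightarrow> smooth_on S g"
  unfolding smooth_on_def by (meson C_on_cong)

lemma smooth_on_subset: "smooth_on S f \<Longrightarrow> T \<subseteq> S \<Longrightarrow> smooth_on T f"
  unfolding smooth_on_def by (meson C_on_subset)

lemma smooth_on_const [simp, intro]: "smooth_on S (\<lambda>x. c)"
  by (simp add: smooth_on_def)

lemma smooth_on_bounded_linear: "bounded_linear f \<Longrightarrow> smooth_on S f"
  by (simp add: smooth_on_def C_on_bounded_linear)

lemma smooth_on_id [intro]: "smooth_on S (\<lambda>x. x)"
  by (intro smooth_on_bounded_linear bounded_linear_ident)

lemma smooth_on_add [intro]:
  "smooth_on S f \<Longrightarrow> smooth_on S g \<Longrightarrow> smooth_on S (\<lambda>x. f x + g x)"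
  by (simp add: smooth_on_def C_on_add)

lemma smooth_on_bilinear:
  "bounded_bilinear pr \<Longrightarrow> smooth_on S f \<Longrightarrow> smooth_on S g \<Longrightarrow> smooth_on S (\<lambda>x. pr (f x) (g x))"
  by (simp add: smooth_on_def C_on_bilinear)

lemmas smooth_on_scaleR [intro] = smooth_on_bilinear[OF bounded_bilinear_scaleR]
lemmas smooth_on_inner [intro] = smooth_on_bilinear[OF bounded_bilinear_inner]

lemma smooth_on_mult [intro]:
  fixes f g :: "_ \<Rightarrow> real"
  shows "smooth_on S f \<Longrightarrow> smooth_on S g \<Longrightarrow> smooth_on S (\<lambda>x. f x * g x)"
  by (rule smooth_on_bilinear[OF bounded_bilinear_mult])

lemma smooth_on_diff [intro]:
  assumes "smooth_on S f" "smooth_on S g"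
  shows "smooth_on S (\<lambda>x. f x - g x)"
  using smooth_on_add[OF assms(1) smooth_on_scaleR[OF smooth_on_const[of _ "-1"] assms(2)]] by simp

lemma smooth_on_sum [intro]:
  "(\<And>i. i \<in> I \<Longrightarrow> smooth_on S (f i)) \<Longrightarrow> smooth_on S (\<lambda>x. \<Sum>i\<in>I. f i x)"
  by (simp add: smooth_on_def C_on_sum)

lemma smooth_on_prod [intro]:
  fixes f :: "_ \<Rightarrow> _ \<Rightarrow> real"
  shows "(\<And>i. i \<in> I \<Longrightarrow> smooth_on S (f i)) \<Longrightarrow> smooth_on S (\<lambda>x. \<Prod>i\<in>I. f i x)"
  by (induction I rule: infinite_finite_induct) auto

lemma smooth_on_power [intro]:
  fixes f :: "_ \<Rightarrow> real"
  shows "smooth_on S f \<Longrightarrow> smooth_on S (\<lambda>x. f x ^ n)"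
  by (induction n) auto

lemma smooth_on_compose:
  fixes f :: "'b::euclidean_space \<Rightarrow> 'c::real_normed_vector"
  shows "smooth_on T f \<Longrightarrow> smooth_on S g \<Longrightarrow> g ` S \<subseteq> T \<Longrightarrow> smooth_on S (\<lambda>x. f (g x))"
  by (auto simp: smooth_on_def intro: C_on_compose)

lemma smooth_on_compose_linear:
  "bounded_linear f \<Longrightarrow> smooth_on S g \<Longrightarrow> smooth_on S (\<lambda>x. f (g x :: 'b::euclidean_space))"
  by (auto intro: smooth_on_compose[OF smooth_on_bounded_linear[of _ UNIV]])

lemma smooth_on_Pair:
  fixes f :: "_ \<Rightarrow> 'a::euclidean_space" and g :: "_ \<Rightarrow> 'b::euclidean_space"
  assumes "smooth_on S f" "smooth_on S g"
  shows "smooth_on S (\<lambda>x. (f x, g x))"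
proof -
  have "smooth_on S (\<lambda>x. (f x, 0) + (0, g x))"
    using assms by (intro smooth_on_add smooth_on_compose_linear[of "\<lambda>x. (x, 0)"]
      smooth_on_compose_linear[of "\<lambda>x. (0, x)"] bounded_linear_intros)
      (auto intro: bounded_linear_intros)
  then show ?thesis by simp
qed

lemma smooth_on_powr:
  fixes f :: "_ \<Rightarrow> real"
  assumes "smooth_on S f" "\<And>x. x \<in> S \<Longrightarrow> f x > 0"
  shows "smooth_on S (\<lambda>x. f x powr a)"
proof (rule smooth_on_compose[OF _ assms(1)])
  show "smooth_on {0<..} (\<lambda>x::real. x powr a)" by (simp add: smooth_on_def C_on_powr)
qed (use assms(2) in auto)

lemma smooth_on_divide:
  fixes f g :: "_ \<Rightarrow> real"
  assumes "smooth_on S f" "smooth_on S g" "\<And>x. x \<in> S \<Longrightarrow> g x > 0"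
  shows "smooth_on S (\<lambda>x. f x / g x)"
proof (rule smooth_on_cong)
  show "smooth_on S (\<lambda>x. f x * g x powr -1)"
    using assms by (intro smooth_on_mult smooth_on_powr)
qed (use assms in \<open>auto simp: powr_minus_divide order_less_imp_le\<close>)

lemma smooth_on_norm: "smooth_on (-{0}) (norm :: 'a::euclidean_space \<Rightarrow> real)"
proof (rule smooth_on_cong)
  show "smooth_on (-{0}) (\<lambda>x::'a. (x \<bullet> x) powr (1/2))"
    by (intro smooth_on_powr smooth_on_inner smooth_on_id) auto
qed (auto simp: norm_eq_sqrt_inner powr_half_sqrt)

lemma smooth_on_sgn: "smooth_on (-{0}) (sgn :: 'a::euclidean_space \<Rightarrow> 'a)"
proof (rule smooth_on_cong)
  show "smooth_on (-{0}) (\<lambda>x::'a. (1 / norm x) *\<^sub>R x)"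
    by (intro smooth_on_scaleR smooth_on_divide smooth_on_norm smooth_on_const smooth_on_id) auto
qed (auto simp: sgn_div_norm divide_inverse)

lemma smooth_on_continuous: "smooth_on S f \<Longrightarrow> continuous_on S f"
  by (metis C_on.simps(1) smooth_on_def)

text \<open>The condition of \<open>frechet_derivative_unique_within\<close>: derivatives within such a set are unique.\<close>

definition thick :: "'a::euclidean_space set \<Rightarrow> bool" where
  "thick S \<longleftrightarrow> (\<forall>x\<in>S. \<forall>i\<in>Basis. \<forall>e>0. \<exists>d. 0 < \<bar>d\<bar> \<and> \<bar>d\<bar> < e \<and> x + d *\<^sub>R i \<in> S)"

lemma thick_open: "open S \<Longrightarrow> thick S"
  unfolding thick_def
proof (intro ballI allI impI)
  fix x i :: 'a and e :: real assume "open S" "x \<in> S" "i \<in> Basis" "e > 0"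
  then obtain r where r: "r > 0" "ball x r \<subseteq> S" by (meson open_contains_ball)
  have "x + (min r e / 2) *\<^sub>R i \<in> ball x r"
    using r \<open>i \<in> Basis\<close> \<open>e > 0\<close> by (auto simp: dist_norm)
  then show "\<exists>d. 0 < \<bar>d\<bar> \<and> \<bar>d\<bar> < e \<and> x + d *\<^sub>R i \<in> S"
    using r \<open>e > 0\<close> by (intro exI[of _ "min r e / 2"]) auto
qed

lemma thick_Times: "thick A \<Longrightarrow> thick B \<Longrightarrow> thick (A \<times> B)"
  unfolding thick_def Basis_prod_def by fastforce

lemma thick_atLeastLessThan: "thick {a..<b::real}"
  unfolding thick_def
proof (intro ballI allI impI)
  fix x i e :: real assume *: "x \<in> {a..<b}" "i \<in> Basis" "e > 0"
  then show "\<exists>d. 0 < \<bar>d\<bar> \<and> \<bar>d\<bar> < e \<and> x + d *\<^sub>R i \<in> {a..<b}"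
    by (intro exI[of _ "min e (b - x) / 2"]) (auto simp: min_def field_simps)
qed

lemma smooth_on_has_derivative:
  assumes "smooth_on S f" "x \<in> S"
  shows "(f has_derivative frechet_derivative f (at x within S)) (at x within S)"
proof -
  have "C_on 1 S f" using assms by (simp add: smooth_on_def del: C_on.simps)
  with assms(2) have "f differentiable (at x within S)"
    by (auto simp: One_nat_def differentiable_def)
  then show ?thesis by (simp add: frechet_derivative_works)
qed

text \<open>Thickness makes the derivative witness hidden in \<open>C_on\<close> equal to the chosen
  \<open>frechet_derivative\<close>, for every order with the same function.\<close>

lemma smooth_on_frechet_derivative:
  assumes "smooth_on S f" "thick S"
  shows "smooth_on S (\<lambda>x. frechet_derivative f (at x within S) v)"
  unfolding smooth_on_def
proof
  fix k
  have "C_on (Suc k) S f" using assms by (simp add: smooth_on_def del: C_on.simps)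
  then obtain f' where f': "\<forall>x\<in>S. (f has_derivative f' x) (at x within S)"
     "\<forall>v. C_on k S (\<lambda>x. f' x v)" by auto
  have eq: "f' x = frechet_derivative f (at x within S)" if "x \<in> S" for x
    using f'(1) smooth_on_has_derivative[OF assms(1) that] assms(2) that
    by (intro frechet_derivative_unique_within[of f _ x S]) (auto simp: thick_def)
  have "C_on k S (\<lambda>x. f' x v)" using f'(2) by blast
  then show "C_on k S (\<lambda>x. frechet_derivative f (at x within S) v)"
    by (rule C_on_cong[rotated]) (simp add: eq)
qed

text \<open>Meant for the volume along the flow, whose derivatives of all orders are known as an
  explicit sequence of functions.\<close>

lemma smooth_on_of_derivative_sequence:
  fixes f :: "nat \<Rightarrow> real \<Rightarrow> real"
  assumes "\<And>k t. t \<in> S \<Longrightarrow> (f k has_real_derivative f (Suc k) t) (at t within S)"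
  shows "smooth_on S (f k)"
proof -
  have "C_on m S (f k)" for m k
  proof (induction m arbitrary: k)
    case 0
    show ?case using assms by (auto intro: DERIV_continuous_on)
  next
    case (Suc m)
    have "C_on m S (\<lambda>t. f (Suc k) t * v)" for v
      using C_on_bilinear[OF bounded_bilinear_mult Suc C_on_const] .
    then show ?case using assms
      by (auto simp: has_field_derivative_def intro!: exI[of _ "\<lambda>t v. f (Suc k) t * v"])
  qed
  then show ?thesis by (simp add: smooth_on_def)
qed

section \<open>Mean values and mixed second derivatives up to the ends of an interval\<close>

lemma mvt_within:
  fixes f f' :: "real \<Rightarrow> real"
  assumes "convex J" "a \<in> J" "b \<in> J"
    and "\<And>t. t \<in> J \<Longrightarrow> (f has_real_derivative f' t) (at t within J)"
  obtains c where "c \<in> J" "c \<in> closed_segment a b" "f b - f a = (b - a) * f' c"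
proof -
  have *: thesis if ab: "a < b" "a \<in> J" "b \<in> J" and c: "\<And>c. c \<in> J \<Longrightarrow> c \<in> {a..b} \<Longrightarrow> f b - f a = (b - a) * f' c \<Longrightarrow> thesis" for a b
  proof -
    have sub: "{a..b} \<subseteq> J"
      using \<open>convex J\<close> ab by (metis closed_segment_eq_real_ivl closed_segment_subset less_imp_le)
    have "(f has_real_derivative f' t) (at t within {a..b})" if "t \<in> {a..b}" for t
      using assms(4) sub that by (blast intro: DERIV_subset)
    then have "\<exists>c\<in>{a..b}. f b - f a = (\<lambda>v. f' c * v) (b - a)"
      using ab by (intro mvt_very_simple) (auto simp: has_field_derivative_def)
    then show thesis using c sub by (auto simp: mult.commute)
  qed
  consider "a < b" | "b < a" | "a = b" by linarith
  then show thesis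
  proof cases
    case 1 then show thesis using *[of a b] that assms by (auto simp: closed_segment_eq_real_ivl)
  next
    case 2 then show thesis using *[of b a] that assms
      by (auto simp: closed_segment_eq_real_ivl algebra_simps)
  next
    case 3 then show thesis using that assms by auto
  qed
qed

text \<open>The second difference over a small rectangle is computed by two mean values, taken in
  either order; each computation gives the rectangle's signed area times one of the mixed
  derivatives at a nearby point. Limit points of convex sets replace open neighbourhoods, so that
  \<open>t0\<close> may be the initial time.\<close>

lemma mixed_partials_commute:
  fixes G :: "real \<Rightarrow> real \<Rightarrow> real"
  assumes I: "convex I" "s0 \<in> I" "s0 islimpt I" and J: "convex J" "t0 \<in> J" "t0 islimpt J"
    and Gs: "\<And>s t. s \<in> I \<Longrightarrow> t \<in> J \<Longrightarrow> ((\<lambda>s. G s t) has_real_derivative Gs s t) (at s within I)"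
    and Gt: "\<And>s t. s \<in> I \<Longrightarrow> t \<in> J \<Longrightarrow> ((\<lambda>t. G s t) has_real_derivative Gt s t) (at t within J)"
    and Gst: "\<And>s t. s \<in> I \<Longrightarrow> t \<in> J \<Longrightarrow> ((\<lambda>t. Gs s t) has_real_derivative Gst s t) (at t within J)"
    and Gts: "\<And>s t. s \<in> I \<Longrightarrow> t \<in> J \<Longrightarrow> ((\<lambda>s. Gt s t) has_real_derivative Gts s t) (at s within I)"
    and c1: "continuous_on (I \<times> J) (\<lambda>(s, t). Gst s t)"
    and c2: "continuous_on (I \<times> J) (\<lambda>(s, t). Gts s t)"
  shows "Gst s0 t0 = Gts s0 t0"
proof (rule ccontr)
  assume "Gst s0 t0 \<noteq> Gts s0 t0"
  \<comment> \<open>Half the gap: two values, each within \<open>e\<close> of its own limit, can no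
    longer be equal.\<close>
  define e where "e = \<bar>Gst s0 t0 - Gts s0 t0\<bar> / 2"
  have e: "e > 0" using \<open>Gst s0 t0 \<noteq> Gts s0 t0\<close> by (simp add: e_def)
  have st: "(s0, t0) \<in> I \<times> J" using I J by simp
  obtain d1 where d1: "d1 > 0" "\<And>z. z \<in> I \<times> J \<Longrightarrow> dist z (s0, t0) < d1 \<Longrightarrow> \<bar>(\<lambda>(s,t). Gst s t) z - Gst s0 t0\<bar> < e"
    using c1[unfolded continuous_on_iff, rule_format, OF st e] by (auto simp: dist_real_def)
  obtain d2 where d2: "d2 > 0" "\<And>z. z \<in> I \<times> J \<Longrightarrow> dist z (s0, t0) < d2 \<Longrightarrow> \<bar>(\<lambda>(s,t). Gts s t) z - Gts s0 t0\<bar> < e"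
    using c2[unfolded continuous_on_iff, rule_format, OF st e] by (auto simp: dist_real_def)
  define d where "d = min d1 d2 / 2"
  have d: "d > 0" using d1 d2 by (simp add: d_def)
  obtain s where s: "s \<in> I" "s \<noteq> s0" "dist s s0 < d" using I(3) d by (meson islimpt_approachable)
  obtain t where t: "t \<in> J" "t \<noteq> t0" "dist t t0 < d" using J(3) d by (meson islimpt_approachable)
  have near: "dist (x, y) (s0, t0) < min d1 d2"
    if "x \<in> closed_segment s0 s" "y \<in> closed_segment t0 t" for x y
  proof -
    have "dist x s0 < d" "dist y t0 < d"
      using that s t by (auto simp: closed_segment_eq_real_ivl dist_real_def split: if_splits)
    moreover have "dist (x, y) (s0, t0) \<le> dist x s0 + dist y t0"
      by (simp add: dist_Pair_Pair sqrt_sum_squares_le_sum)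
    ultimately show ?thesis by (simp add: d_def)
  qed
  define D where "D = (G s t - G s t0) - (G s0 t - G s0 t0)"
  obtain x where x: "x \<in> I" "x \<in> closed_segment s0 s" "D = (s - s0) * (Gs x t - Gs x t0)"
    unfolding D_def using t J s I
    by (rule_tac mvt_within[of I s0 s "\<lambda>s. G s t - G s t0" "\<lambda>s. Gs s t - Gs s t0"])
      (auto intro!: derivative_intros Gs)
  obtain y where y: "y \<in> J" "y \<in> closed_segment t0 t" "Gs x t - Gs x t0 = (t - t0) * Gst x y"
    using mvt_within[OF J(1,2) t(1) Gst[OF x(1)]] by metis
  obtain y' where y': "y' \<in> J" "y' \<in> closed_segment t0 t" "D = (t - t0) * (Gt s y' - Gt s0 y')"
    unfolding D_def using t J s I
    by (rule_tac mvt_within[of J t0 t "\<lambda>t. G s t - G s0 t" "\<lambda>t. Gt s t - Gt s0 t"])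
      (auto intro!: derivative_intros Gt)
  obtain x' where x': "x' \<in> I" "x' \<in> closed_segment s0 s" "Gt s y' - Gt s0 y' = (s - s0) * Gts x' y'"
    using mvt_within[OF I(1,2) s(1) Gts[OF _ y'(1)]] by metis
  have "(s - s0) * (t - t0) * Gst x y = (s - s0) * (t - t0) * Gts x' y'"
    using x(3) y(3) x'(3) y'(3) by (metis mult.assoc mult.commute)
  then have "Gst x y = Gts x' y'" using s t by simp
  moreover have "\<bar>Gst x y - Gst s0 t0\<bar> < e" using d1(2)[of "(x,y)"] x y near[of x y] by auto
  moreover have "\<bar>Gts x' y' - Gts s0 t0\<bar> < e" using d2(2)[of "(x',y')"] x' y' near[of x' y'] by auto
  ultimately show False unfolding e_def by (simp add: abs_if split: if_splits)
qed

section \<open>Rank-one updates of determinants\<close>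

definition outer :: "real^'n \<Rightarrow> real^'n \<Rightarrow> real^'n^'n" where
  "outer a c = (\<chi> i j. a $ i * c $ j)"

lemma inner_matrix_vector_right: "x \<bullet> (A *v y) = (transpose A *v x) \<bullet> (y :: real^'n)"
  by (simp add: dot_lmul_matrix)

lemma outer_mult_vec [simp]: "outer a c *v x = (c \<bullet> x) *\<^sub>R a"
  by (simp add: outer_def vec_eq_iff matrix_vector_mult_def inner_vec_def sum_distrib_left sum_distrib_right mult_ac)

lemma det_scaleR: "det (q *\<^sub>R (A :: real^'n^'n)) = q ^ CARD('n) * det A"
proof -
  have "q *\<^sub>R A = (\<chi> i. q *s A $ i)" by (simp add: vec_eq_iff)
  then show ?thesis using det_rows_mul[of "\<lambda>_. q" "\<lambda>i. A $ i"] by simp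
qed

text \<open>The matrix is the identity with column \<open>k\<close> replaced by
  \<open>x + axis k 1\<close>, which is the situation of Cramer's rule.\<close>

lemma det_id_plus_outer_axis: "det (mat 1 + outer x (axis k 1)) = 1 + x $ k"
proof -
  have "mat 1 + outer x (axis k 1) =
      (\<chi> i j. if j = k then (mat 1 *v (x + axis k 1)) $ i else mat 1 $ i $ j)"
    by (simp add: vec_eq_iff outer_def) (auto simp: mat_def axis_def)
  then show ?thesis using cramer_lemma[of k "mat 1" "x + axis k 1"] by simp
qed

text \<open>Conjugation by an orthogonal matrix that carries a coordinate axis to the direction of
  \<open>y\<close> reduces the claim to the axis case.\<close>

lemma det_id_plus_outer:
  fixes x y :: "real^'n"
  shows "det (mat 1 + outer x y) = 1 + x \<bullet> y"
proof (cases "y = 0")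
  case True
  then have "outer x y = 0" by (simp add: outer_def vec_eq_iff)
  then show ?thesis using True by simp
next
  case False
  fix k :: 'n
  obtain Q where Q: "orthogonal_matrix Q" "Q *v axis k 1 = y /\<^sub>R norm y"
    using orthogonal_matrix_exists_basis[of "y /\<^sub>R norm y" k] False by auto
  then have QQ: "transpose Q ** Q = mat 1" "Q ** transpose Q = mat 1" by (auto simp: orthogonal_matrix_def)
  then have QQv: "transpose Q *v (Q *v v) = v" for v by (simp add: matrix_vector_mul_assoc)
  define z where "z = norm y *\<^sub>R (transpose Q *v x)"
  have "transpose Q ** (mat 1 + outer x y) ** Q = mat 1 + outer z (axis k 1)"
  proof (subst matrix_eq, rule allI)
    fix v
    have "y \<bullet> (Q *v v) = norm y * ((Q *v axis k 1) \<bullet> (Q *v v))"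
      using Q(2) False by simp
    also have "(Q *v axis k 1) \<bullet> (Q *v v) = axis k 1 \<bullet> v"
      using QQ(1) by (simp add: inner_matrix_vector_right matrix_vector_mul_assoc)
    finally show "(transpose Q ** (mat 1 + outer x y) ** Q) *v v = (mat 1 + outer z (axis k 1)) *v v"
      using QQv by (simp add: z_def matrix_vector_mult_add_rdistrib matrix_vector_right_distrib
          matrix_vector_mul_assoc[symmetric] matrix_vector_mult_scaleR)
  qed
  then have "det (transpose Q) * det (mat 1 + outer x y) * det Q = 1 + z $ k"
    by (metis det_id_plus_outer_axis det_mul)
  moreover have "det (transpose Q) * det Q = 1" using QQ(1) by (metis det_I det_mul)
  moreover have "z $ k = x \<bullet> y"
  proof -
    have "z $ k = norm y * ((transpose Q *v x) \<bullet> axis k 1)" by (simp add: z_def inner_axis)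
    also have "(transpose Q *v x) \<bullet> axis k 1 = x \<bullet> (Q *v axis k 1)"
      by (simp add: inner_matrix_vector_right)
    finally show ?thesis using Q(2) False by simp
  qed
  ultimately show ?thesis by (metis mult.commute mult.assoc mult_1)
qed

text \<open>As \<open>u\<close> spans left and right null vectors of \<open>S\<close>, the matrix
  \<open>S + outer a c\<close> factors into \<open>S + outer u u\<close> between two rank-one
  perturbations of the identity. The determinant of \<open>S + outer u u\<close> is that of
  \<open>S\<close> on the hyperplane orthogonal to \<open>u\<close>, so only the normal components
  of \<open>a\<close> and \<open>c\<close> survive.\<close>

lemma det_rank_one_update:
  fixes S :: "real^'n^'n"
  assumes "S *v u = 0" "transpose S *v u = 0" "norm u = 1"
  shows "det (S + outer a c) = (a \<bullet> u) * (c \<bullet> u) * det (S + outer u u)"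
proof -
  have uu: "u \<bullet> u = 1" using assms(3) by (simp add: norm_eq_1)
  have uS: "u \<bullet> (S *v x) = 0" for x
    using assms(2) by (metis dot_lmul_matrix inner_zero_left vector_transpose_matrix transpose_transpose)
  have "(mat 1 + outer (a - u) u) ** (S + outer u u) ** (mat 1 + outer u (c - u)) = S + outer a c"
    using assms(1) by (subst matrix_eq)
      (simp add: matrix_vector_mul_assoc[symmetric] matrix_vector_mult_add_rdistrib
        matrix_vector_right_distrib matrix_vector_mult_scaleR uu uS inner_add_right inner_diff_left algebra_simps)
  then have "det (S + outer a c) = (1 + (a - u) \<bullet> u) * det (S + outer u u) * (1 + u \<bullet> (c - u))"
    by (metis det_id_plus_outer det_mul)
  then show ?thesis by (simp add: inner_diff_left inner_diff_right uu inner_commute mult_ac)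
qed

text \<open>The natural power is \<open>n - 1\<close>, the dimension of the tangent space; the extra
  factor \<open>q\<close> on the left avoids subtraction in the exponent.\<close>

lemma det_scaleR_rank_one_update:
  fixes S :: "real^'n^'n"
  assumes "S *v u = 0" "transpose S *v u = 0" "norm u = 1"
  shows "q * det (q *\<^sub>R S + outer a c) = q ^ CARD('n) * ((a \<bullet> u) * (c \<bullet> u) * det (S + outer u u))"
proof (cases "q = 0")
  case False
  have "q *\<^sub>R S + outer a c = q *\<^sub>R (S + outer (a /\<^sub>R q) c)"
    using False by (simp add: vec_eq_iff outer_def field_simps)
  then show ?thesis using False det_rank_one_update[OF assms, of "a /\<^sub>R q" c]
    by (simp add: det_scaleR)
qed simp

section \<open>Change of variables for an unordered index type\<close>

text \<open>The library has the change of variables formula only for \<open>real^'n\<close> with \<open>'n\<close> well-ordered.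
  The type below is a well-ordered copy of an arbitrary finite type.\<close>

typedef 'a ordered_copy = "UNIV :: 'a set" by simp

instance ordered_copy :: (finite) finite
proof
  have "UNIV = range (Abs_ordered_copy :: 'a \<Rightarrow> _)" by (metis Rep_ordered_copy_inverse surjI)
  then show "finite (UNIV :: 'a ordered_copy set)" by (metis finite finite_imageI)
qed

instantiation ordered_copy :: (finite) wellorder
begin
definition "x \<le> y \<longleftrightarrow> to_nat (Rep_ordered_copy x) \<le> to_nat (Rep_ordered_copy y)"
definition "x < y \<longleftrightarrow> to_nat (Rep_ordered_copy x) < to_nat (Rep_ordered_copy y)"
instance
proof
  fix P :: "'a ordered_copy \<Rightarrow> bool" and a
  assume *: "\<And>x. (\<And>y. y < x \<Longrightarrow> P y) \<Longrightarrow> P x"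
  show "P a"
    by (induction a rule: measure_induct_rule[of "\<lambda>x. to_nat (Rep_ordered_copy x)"])
      (auto intro: * simp: less_ordered_copy_def)
qed (auto simp: less_eq_ordered_copy_def less_ordered_copy_def Rep_ordered_copy_inject)
end

lemma bij_Rep_ordered_copy: "bij Rep_ordered_copy"
  by (metis Abs_ordered_copy_inverse Rep_ordered_copy_inverse UNIV_I bij_iff)

definition reindex :: "('m \<Rightarrow> 'n) \<Rightarrow> real^'n \<Rightarrow> real^'m" where
  "reindex s x = (\<chi> i. x $ s i)"

lemma reindex_bounded_linear: "bounded_linear (reindex s :: real^'n \<Rightarrow> real^'m)"
  by (simp add: linear_conv_bounded_linear[symmetric] linear_iff reindex_def vec_eq_iff)

lemma reindex_measurable [measurable]: "reindex s \<in> borel_measurable borel"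
  by (intro borel_measurable_continuous_onI linear_continuous_on reindex_bounded_linear)

lemma reindex_inverse:
  assumes "bij s"
  shows "reindex s (reindex (inv s) x) = x" "reindex (inv s) (reindex s y) = y"
  using assms by (auto simp: reindex_def vec_eq_iff bij_is_inj bij_is_surj surj_f_inv_f)

text \<open>Lebesgue measure is determined by the volumes of boxes, and relabelling coordinates only
  permutes the side lengths.\<close>

lemma distr_lborel_reindex:
  assumes "bij (s :: 'm::finite \<Rightarrow> 'n::finite)"
  shows "distr lborel borel (reindex s) = lborel"
proof (rule sym, rule lborel_eqI)
  fix l u :: "real^'m" assume le: "\<And>b. b \<in> Basis \<Longrightarrow> l \<bullet> b \<le> u \<bullet> b"
  have "reindex s -` box l u = box (reindex (inv s) l) (reindex (inv s) u)"
    using assms by (auto simp: reindex_def mem_box_cart bij_is_inj bij_is_surj surj_f_inv_f)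
      (metis bij_is_inj inv_f_f bij_inv_eq_iff)+
  moreover have "l $ i \<le> u $ i" for i using le[of "axis i 1"] by (simp add: inner_axis axis_in_Basis_iff)
  ultimately have "emeasure (distr lborel borel (reindex s)) (box l u) =
      (\<Prod>b\<in>Basis. (reindex (inv s) u - reindex (inv s) l) \<bullet> b)"
    by (simp add: emeasure_distr) (subst emeasure_lborel_box, auto simp: Basis_vec_def inner_axis reindex_def)
  also have "(\<Prod>b\<in>Basis. (reindex (inv s) u - reindex (inv s) l) \<bullet> b) = (\<Prod>i\<in>UNIV. u $ inv s i - l $ inv s i)"
    unfolding Basis_vec_def by (simp add: inner_axis reindex_def prod.UNION_disjoint axis_eq_axis)
  also have "\<dots> = (\<Prod>i\<in>UNIV. u $ i - l $ i)"
    using assms by (intro prod.reindex_bij_betw bij_imp_bij_inv)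
  also have "\<dots> = (\<Prod>b\<in>Basis. (u - l) \<bullet> b)"
    unfolding Basis_vec_def by (simp add: inner_axis prod.UNION_disjoint axis_eq_axis)
  finally show "emeasure (distr lborel borel (reindex s)) (box l u) = (\<Prod>b\<in>Basis. (u - l) \<bullet> b)" .
qed simp

lemma
  assumes "bij (s :: 'm::finite \<Rightarrow> 'n::finite)"
  shows reindex_measurable_lebesgue: "reindex s \<in> lebesgue \<rightarrow>\<^sub>M lebesgue"
    and distr_lebesgue_reindex: "distr lebesgue lebesgue (reindex s) = lebesgue"
proof -
  have m: "reindex s \<in> lborel \<rightarrow>\<^sub>M lborel" by simp
  have d: "distr lebesgue lborel (reindex s) = lborel"
    using distr_lborel_reindex[OF assms] distr_completion[OF m] by (simp cong: distr_cong)
  have m': "reindex s \<in> lebesgue \<rightarrow>\<^sub>M lborel" using m by (rule measurable_completion)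
  show "reindex s \<in> lebesgue \<rightarrow>\<^sub>M lebesgue"
    by (rule completion.measurable_completion2[OF m']) (simp add: d)
  show "distr lebesgue lebesgue (reindex s) = lebesgue"
    using completion.completion_distr_eq[OF m'] by (simp add: d)
qed

text \<open>The two matrices have different index types, so this is not a similarity of square
  matrices. In the Leibniz formula \<open>map_permutation\<close> matches the permutations of both
  types, preserving signs and products.\<close>

lemma det_matrix_reindex:
  assumes s: "bij (s :: 'm::finite \<Rightarrow> 'n::finite)"
  shows "det (matrix (reindex s \<circ> f \<circ> reindex (inv s))) = det (matrix f)"
proof -
  have ax: "reindex (inv s) (axis j 1) = axis (s j) 1" for j
  proof -
    have "inv s i = j \<longleftrightarrow> i = s j" for i using bij_inv_eq_iff[OF s] by metis
    then show ?thesis by (simp add: reindex_def axis_def vec_eq_iff)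
  qed
  have m: "matrix (reindex s \<circ> f \<circ> reindex (inv s)) $ i $ j = matrix f $ s i $ s j" for i j
    by (simp add: matrix_def ax) (simp add: reindex_def)
  have "det (matrix f) = (\<Sum>p | p permutes UNIV. of_int (sign p) * (\<Prod>i\<in>UNIV. matrix f $ i $ p i))"
    by (simp add: det_def)
  also have "\<dots> = (\<Sum>p | p permutes (UNIV :: 'm set). of_int (sign (map_permutation UNIV s p)) *
      (\<Prod>i\<in>UNIV. matrix f $ i $ map_permutation UNIV s p i))"
  proof (rule sum.reindex_bij_betw[symmetric])
    show "bij_betw (map_permutation UNIV s) {p. p permutes (UNIV :: 'm set)} {p. p permutes (UNIV :: 'n set)}"
    proof (rule bij_betw_byWitness[where f'="map_permutation UNIV (inv s)"])
      have s': "bij_betw (inv s) UNIV UNIV" using s by (rule bij_imp_bij_inv)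
      show "\<forall>p\<in>{p. p permutes UNIV}. map_permutation UNIV (inv s) (map_permutation UNIV s p) = p"
        using map_permutation_compose_inv[OF s] s by (simp add: bij_is_inj)
      show "\<forall>p\<in>{p. p permutes UNIV}. map_permutation UNIV s (map_permutation UNIV (inv s) p) = p"
        using map_permutation_compose_inv[OF s'] s by (simp add: bij_is_surj surj_f_inv_f)
      show "map_permutation UNIV s ` {p. p permutes UNIV} \<subseteq> {p. p permutes UNIV}"
        using map_permutation_permutes[OF s] by blast
      show "map_permutation UNIV (inv s) ` {p. p permutes UNIV} \<subseteq> {p. p permutes UNIV}"
        using map_permutation_permutes[OF s'] by blast
    qed
  qed
  also have "\<dots> = (\<Sum>p | p permutes (UNIV :: 'm set). of_int (sign p) *
      (\<Prod>i\<in>UNIV. matrix f $ s i $ s (p i)))"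
  proof (rule sum.cong[OF refl])
    fix p assume "p \<in> {p. p permutes (UNIV :: 'm set)}"
    then have p: "p permutes UNIV" by simp
    have "(\<Prod>i\<in>UNIV. matrix f $ i $ map_permutation UNIV s p i) =
      (\<Prod>i\<in>UNIV. matrix f $ s i $ map_permutation UNIV s p (s i))"
      using s by (intro prod.reindex_bij_betw[symmetric])
    also have "\<dots> = (\<Prod>i\<in>UNIV. matrix f $ s i $ s (p i))"
      using s by (simp add: map_permutation_apply bij_is_inj)
    finally show "of_int (sign (map_permutation UNIV s p)) * (\<Prod>i\<in>UNIV. matrix f $ i $ map_permutation UNIV s p i)
       = of_int (sign p) * (\<Prod>i\<in>UNIV. matrix f $ s i $ s (p i))"
      using sign_map_permutation[OF bij_is_inj[OF s] p] by simp
  qed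
  also have "\<dots> = det (matrix (reindex s \<circ> f \<circ> reindex (inv s)))"
    by (simp add: det_def m)
  finally show ?thesis ..
qed

text \<open>The map is conjugated by the relabelling \<open>R\<close> and its inverse
  \<open>R'\<close>, which preserve Lebesgue measure and the Jacobian determinant; the results for
  the well-ordered copy are then transported back.\<close>

lemma
  fixes f :: "real^'n \<Rightarrow> real^'n"
  assumes S: "S \<in> sets lebesgue"
    and der: "\<And>x. x \<in> S \<Longrightarrow> (f has_derivative f' x) (at x within S)"
    and int: "set_integrable lebesgue S (\<lambda>x. \<bar>det (matrix (f' x))\<bar>)"
  shows image_lmeasurable: "f ` S \<in> lmeasurable"
    and measure_image_le_set_integral:
      "measure lebesgue (f ` S) \<le> (LINT x:S|lebesgue. \<bar>det (matrix (f' x))\<bar>)"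
    and measure_image_eq_set_integral:
      "inj_on f S \<Longrightarrow> measure lebesgue (f ` S) = (LINT x:S|lebesgue. \<bar>det (matrix (f' x))\<bar>)"
proof -
  define s :: "'n ordered_copy \<Rightarrow> 'n" where "s = Rep_ordered_copy"
  have s: "bij s" unfolding s_def by (rule bij_Rep_ordered_copy)
  define R where "R = reindex (inv s)"
  define R' where "R' = reindex s"
  have RR: "R (R' x) = x" "R' (R y) = y" for x y
    unfolding R_def R'_def by (simp_all add: reindex_inverse s)
  have mR: "R \<in> lebesgue \<rightarrow>\<^sub>M lebesgue" "distr lebesgue lebesgue R = lebesgue"
    unfolding R_def using s by (simp_all add: reindex_measurable_lebesgue distr_lebesgue_reindex bij_imp_bij_inv)
  have mR': "R' \<in> lebesgue \<rightarrow>\<^sub>M lebesgue" "distr lebesgue lebesgue R' = lebesgue"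
    unfolding R'_def using s by (simp_all add: reindex_measurable_lebesgue distr_lebesgue_reindex)
  have bl: "bounded_linear R" "bounded_linear R'"
    by (simp_all add: R_def R'_def reindex_bounded_linear)
  define S1 where "S1 = R -` S"
  define f1 where "f1 = R' \<circ> f \<circ> R"
  define f1' where "f1' = (\<lambda>x. R' \<circ> f' (R x) \<circ> R)"
  define J where "J = (\<lambda>x. \<bar>det (matrix (f' x))\<bar>)"
  have S1: "S1 \<in> sets lebesgue" using measurable_sets[OF mR(1) S] by (simp add: S1_def)
  have RS1: "R ` S1 = S" unfolding S1_def using RR by (metis surjI surj_image_vimage_eq)
  have der1: "(f1 has_derivative f1' x) (at x within S1)" if "x \<in> S1" for x
    unfolding f1_def f1'_def
    using that der[of "R x"] RS1 bl
    by (intro diff_chain_within bounded_linear_imp_has_derivative) (auto simp: S1_def)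
  have det1: "\<bar>det (matrix (f1' x))\<bar> = J (R x)" for x
    unfolding f1'_def R_def R'_def J_def by (simp add: det_matrix_reindex[OF s, unfolded o_def] o_def)
  have int': "integrable lebesgue (\<lambda>y. indicat_real S y * J y)"
    using int by (simp add: set_integrable_def J_def)
  then have int1: "integrable lebesgue (\<lambda>x. indicat_real S (R x) * J (R x))"
    using integrable_distr[OF mR(1), of "\<lambda>y. indicat_real S y * J y"] by (simp add: mR(2))
  have eq1: "(LINT x|lebesgue. indicat_real S (R x) * J (R x)) = (LINT y|lebesgue. indicat_real S y * J y)"
    using integral_distr[OF mR(1), of "\<lambda>y. indicat_real S y * J y"] int' by (simp add: mR(2))
  have ind: "indicat_real S1 x = indicat_real S (R x)" for x by (simp add: S1_def indicator_def)
  have si: "set_integrable lebesgue S1 (\<lambda>x. \<bar>det (matrix (f1' x))\<bar>)"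
    using int1 by (simp add: set_integrable_def det1 ind)
  have I1: "((\<lambda>x. \<bar>det (matrix (f1' x))\<bar>) has_integral (LINT y:S|lebesgue. J y)) S1"
    using has_integral_set_lebesgue[OF si] eq1 by (simp add: set_lebesgue_integral_def det1 ind)
  have img: "f1 ` S1 = R' ` (f ` S)" unfolding f1_def by (simp only: image_comp[symmetric] RS1)
  have vimg: "f ` S = R' -` (f1 ` S1)" unfolding img using RR by (metis (no_types) inj_vimage_image_eq inj_on_inverseI)
  have lm1: "f1 ` S1 \<in> lmeasurable"
    using I1 by (intro measurable_differentiable_image[OF S1 der1]) auto
  then have em: "emeasure lebesgue (f ` S) = emeasure lebesgue (f1 ` S1)"
    using emeasure_distr[OF mR'(1), of "f1 ` S1"] by (simp add: vimg mR'(2) fmeasurableD)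
  then have m: "measure lebesgue (f1 ` S1) = measure lebesgue (f ` S)" by (simp add: measure_def)
  have "f ` S \<in> sets lebesgue" using measurable_sets[OF mR'(1) fmeasurableD[OF lm1]] by (simp add: vimg)
  then show "f ` S \<in> lmeasurable"
    using fmeasurableD2[OF lm1] em by (intro fmeasurableI) (simp_all only: less_top infinity_ennreal_def)
  show "measure lebesgue (f ` S) \<le> (LINT x:S|lebesgue. \<bar>det (matrix (f' x))\<bar>)"
    using measure_differentiable_image[OF S1 der1 has_integral_integrable[OF I1]] I1
    by (simp add: m integral_unique J_def)
  assume inj: "inj_on f S"
  have "inj_on f1 S1"
    unfolding f1_def S1_def using inj RR by (auto simp: inj_on_def) metis
  then show "measure lebesgue (f ` S) = (LINT x:S|lebesgue. \<bar>det (matrix (f' x))\<bar>)"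
    using has_measure_differentiable_image[OF S1 der1, of "LINT y:S|lebesgue. J y"] I1 by (simp add: m J_def)
qed

section \<open>Support functions\<close>

lemma support_fun_upper:
  assumes "bounded K" "y \<in> K"
  shows "y \<bullet> x \<le> support_fun K x"
proof -
  have "bdd_above ((\<lambda>y. y \<bullet> x) ` K)"
    by (intro bounded_imp_bdd_above bounded_linear_image[OF assms(1)] bounded_linear_inner_left)
  then show ?thesis unfolding support_fun_def using assms(2) by (rule cSUP_upper[rotated])
qed

lemma support_fun_attained:
  assumes "compact K" "K \<noteq> {}"
  obtains y where "y \<in> K" "y \<bullet> x = support_fun K x"
proof -
  have "continuous_on K (\<lambda>y. y \<bullet> x)" by (intro continuous_intros)
  then obtain y where y: "y \<in> K" "\<forall>z\<in>K. z \<bullet> x \<le> y \<bullet> x"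
    using continuous_attains_sup[OF assms] by blast
  then have "support_fun K x = y \<bullet> x"
    unfolding support_fun_def by (intro cSup_eq_maximum) auto
  then show thesis using that y(1) by simp
qed

lemma support_fun_scaleR:
  assumes "compact K" "K \<noteq> {}" "c \<ge> 0"
  shows "support_fun K (c *\<^sub>R x) = c * support_fun K x"
proof (rule antisym)
  obtain y where "y \<in> K" "y \<bullet> (c *\<^sub>R x) = support_fun K (c *\<^sub>R x)"
    using support_fun_attained[OF assms(1,2)] .
  then show "support_fun K (c *\<^sub>R x) \<le> c * support_fun K x"
    using support_fun_upper[OF compact_imp_bounded[OF assms(1)], of y x] assms(3)
    by (metis inner_scaleR_right mult_left_mono)
next
  obtain y where "y \<in> K" "y \<bullet> x = support_fun K x" using support_fun_attained[OF assms(1,2)] .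
  then show "c * support_fun K x \<le> support_fun K (c *\<^sub>R x)"
    using support_fun_upper[OF compact_imp_bounded[OF assms(1)], of y "c *\<^sub>R x"] by simp
qed

lemma support_fun_norm_sgn:
  assumes "compact K" "K \<noteq> {}"
  shows "support_fun K x = norm x * support_fun K (sgn x)"
  using support_fun_scaleR[OF assms, of "norm x" "sgn x"] by (cases "x = 0") (auto simp: sgn_div_norm)

lemma support_fun_pos:
  assumes "bounded K" "0 \<in> interior K" "x \<noteq> 0"
  shows "support_fun K x > 0"
proof -
  obtain r where r: "r > 0" "cball 0 r \<subseteq> K"
    using assms(2) by (meson interior_subset mem_interior_cball order_trans)
  then have "r *\<^sub>R sgn x \<in> K" using assms(3) by (auto simp: norm_sgn)
  then have "(r *\<^sub>R sgn x) \<bullet> x \<le> support_fun K x" using support_fun_upper assms(1) by blast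
  moreover have "(r *\<^sub>R sgn x) \<bullet> x > 0" using r assms(3) by (simp add: sgn_div_norm dot_square_norm power2_eq_square)
  ultimately show ?thesis by linarith
qed

lemma linear_functional_eq_inner:
  fixes f :: "'a::euclidean_space \<Rightarrow> real"
  assumes "linear f"
  shows "f v = (\<Sum>b\<in>Basis. f b *\<^sub>R b) \<bullet> v"
proof -
  have "f (\<Sum>b\<in>Basis. (v \<bullet> b) *\<^sub>R b) = (\<Sum>b\<in>Basis. (v \<bullet> b) *\<^sub>R f b)"
    using assms by (simp add: linear_sum linear_cmul)
  then have "f v = (\<Sum>b\<in>Basis. (v \<bullet> b) *\<^sub>R f b)" by (simp add: euclidean_representation)
  then show ?thesis by (simp add: inner_sum_left inner_sum_right inner_commute[of _ v] mult.commute)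
qed

text \<open>The reciprocal of the curvature. Unlike the curvature it is polynomial in
  \<open>h\<close> and its second derivatives, so no division enters until positivity is
  known.\<close>

definition hess_det :: "(real^'n \<Rightarrow> real) \<Rightarrow> real^'n \<Rightarrow> real" where
  "hess_det h u = tangent_det u (\<lambda>v w. sphere_hessian h u v w + h u * (v \<bullet> w))"

lemma curvature_of_support_eq: "curvature_of_support h u = 1 / hess_det h u"
  by (simp add: curvature_of_support_def hess_det_def)

text \<open>Exactly what is asked of the second body in the volume inequality. Smoothness is imposed
  on the support function in the form in which \<open>p_flow\<close> supplies it.\<close>

locale smooth_support =
  fixes K :: "(real^'n) set"
  assumes compact: "compact K" and convex: "convex K" and zero_interior: "0 \<in> interior K"
    and smooth: "smooth_on (-{0}) (\<lambda>x. support_fun K (sgn x))"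
begin

abbreviation "H \<equiv> support_fun K"

lemma bounded: "bounded K" using compact by (rule compact_imp_bounded)
lemma nonempty: "K \<noteq> {}" using zero_interior interior_subset by blast
lemmas H_upper = support_fun_upper[OF bounded]
lemmas H_pos = support_fun_pos[OF bounded zero_interior]
lemmas H_scaleR = support_fun_scaleR[OF compact nonempty]

lemma smooth_H: "smooth_on (-{0}) H"
  by (rule smooth_on_cong[OF _ smooth_on_mult[OF smooth_on_norm smooth]])
    (rule support_fun_norm_sgn[OF compact nonempty, symmetric])

definition X :: "real^'n \<Rightarrow> real^'n" where
  "X x = (\<Sum>b\<in>Basis. frechet_derivative H (at x) b *\<^sub>R b)"

lemma at_within_punctured: "x \<noteq> 0 \<Longrightarrow> at x within -{0} = at (x :: real^'n)"
  by (rule at_within_open) auto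

lemma H_derivative:
  assumes "x \<noteq> 0"
  shows "(H has_derivative (\<lambda>v. X x \<bullet> v)) (at x)"
proof -
  have d: "(H has_derivative frechet_derivative H (at x)) (at x)"
    using smooth_on_has_derivative[OF smooth_H, of x] assms by (simp add: at_within_punctured)
  have "frechet_derivative H (at x) v = X x \<bullet> v" for v
    unfolding X_def by (rule linear_functional_eq_inner[OF has_derivative_linear[OF d]])
  then have "frechet_derivative H (at x) = (\<lambda>v. X x \<bullet> v)" by auto
  then show ?thesis using d by simp
qed

lemma smooth_X: "smooth_on (-{0}) X"
proof (rule smooth_on_cong)
  show "smooth_on (-{0}) (\<lambda>x. \<Sum>b\<in>Basis. frechet_derivative H (at x within -{0}) b *\<^sub>R b)"
    by (intro smooth_on_sum smooth_on_scaleR smooth_on_frechet_derivative smooth_H thick_open smooth_on_const) auto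
qed (simp add: X_def at_within_punctured)

text \<open>The function \<open>H z - y \<bullet> z\<close> is nonnegative and vanishes at
  \<open>x\<close>, so its gradient \<open>X x - y\<close> is zero there. Applied to a point where
  the maximum is attained, this shows that \<open>X x\<close> lies in \<open>K\<close>, and it makes
  \<open>X\<close> an inverse of the Gauss map.\<close>

lemma support_point_unique:
  assumes "x \<noteq> 0" "y \<in> K" "y \<bullet> x = H x"
  shows "y = X x"
proof -
  have "((\<lambda>z. H z - y \<bullet> z) has_derivative (\<lambda>v. X x \<bullet> v - y \<bullet> v)) (at x)"
    by (intro derivative_intros H_derivative assms(1))
  moreover have "\<forall>z. H x - y \<bullet> x \<le> H z - y \<bullet> z"
    using H_upper[OF assms(2)] assms(3) by simp
  ultimately have "(\<lambda>v. X x \<bullet> v - y \<bullet> v) = (\<lambda>v. 0)"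
    by (intro differential_zero_maxmin[of x UNIV]) auto
  then have "(X x - y) \<bullet> v = 0" for v by (metis inner_diff_left)
  then show ?thesis by (metis eq_iff_diff_eq_0 inner_eq_zero_iff)
qed

lemma X_mem: "x \<noteq> 0 \<Longrightarrow> X x \<in> K" and X_inner: "x \<noteq> 0 \<Longrightarrow> X x \<bullet> x = H x"
  using support_fun_attained[OF compact nonempty, of x] support_point_unique by metis+

lemma X_scaleR: "c > 0 \<Longrightarrow> x \<noteq> 0 \<Longrightarrow> X (c *\<^sub>R x) = X x"
  using support_point_unique[of "c *\<^sub>R x" "X x"] X_mem[of x] X_inner[of x] H_scaleR[of c x] by simp

lemma X_sgn: "x \<noteq> 0 \<Longrightarrow> X (sgn x) = X x"
  by (simp add: sgn_div_norm X_scaleR)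

lemma inner_less_support:
  assumes "z \<in> interior K" "x \<noteq> 0"
  shows "z \<bullet> x < H x"
proof -
  obtain e where e: "e > 0" "cball z e \<subseteq> K" using assms(1) mem_interior_cball by blast
  then have "z + e *\<^sub>R sgn x \<in> K" using assms(2) by (auto simp: dist_norm norm_sgn)
  then have "(z + e *\<^sub>R sgn x) \<bullet> x \<le> H x" by (rule H_upper)
  moreover have "(e *\<^sub>R sgn x) \<bullet> x > 0" using e assms(2) by (simp add: sgn_div_norm dot_square_norm power2_eq_square)
  ultimately show ?thesis by (simp add: inner_add_left)
qed

lemma X_frontier: "x \<noteq> 0 \<Longrightarrow> X x \<in> frontier K"
  using X_mem[of x] X_inner[of x] inner_less_support[of "X x" x] closure_subset
  by (auto simp: frontier_def)

definition DX :: "real^'n \<Rightarrow> real^'n^'n" where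
  "DX x = matrix (frechet_derivative X (at x))"

lemma X_derivative:
  assumes "x \<noteq> 0"
  shows "(X has_derivative (\<lambda>v. DX x *v v)) (at x)"
proof -
  have d: "(X has_derivative frechet_derivative X (at x)) (at x)"
    using smooth_on_has_derivative[OF smooth_X, of x] assms by (simp add: at_within_punctured)
  then show ?thesis using has_derivative_linear[OF d] by (simp add: DX_def)
qed

lemma DX_kernel:
  assumes "x \<noteq> 0" shows "DX x *v x = 0"
proof -
  have "((\<lambda>c. X (c *\<^sub>R x)) has_derivative (\<lambda>c. DX x *v (c *\<^sub>R x))) (at 1)"
    by (rule has_derivative_compose[OF bounded_linear_imp_has_derivative[OF bounded_linear_scaleR_left]])
      (simp add: X_derivative assms)
  moreover have "((\<lambda>c. X (c *\<^sub>R x)) has_derivative (\<lambda>c. 0)) (at (1::real))"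
    by (rule has_derivative_transform_within_open[of "\<lambda>_. X x" _ _ UNIV "{0<..}"])
      (auto simp: X_scaleR assms)
  ultimately have "(\<lambda>c::real. DX x *v (c *\<^sub>R x)) = (\<lambda>c. 0)" by (rule has_derivative_unique)
  then show ?thesis by (metis scaleR_one)
qed

lemma DX_scaleR:
  assumes "c > 0" "x \<noteq> 0" shows "DX (c *\<^sub>R x) = (1 / c) *\<^sub>R DX x"
proof -
  have "((\<lambda>y. X (c *\<^sub>R y)) has_derivative (\<lambda>v. DX (c *\<^sub>R x) *v (c *\<^sub>R v))) (at x)"
    by (rule has_derivative_compose[OF bounded_linear_imp_has_derivative[OF bounded_linear_scaleR_right]])
      (use X_derivative[of "c *\<^sub>R x"] assms in simp)
  moreover have "((\<lambda>y. X (c *\<^sub>R y)) has_derivative (\<lambda>v. DX x *v v)) (at x)"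
    by (rule has_derivative_transform_within_open[OF X_derivative[OF assms(2)], of "-{0}"])
      (use assms in \<open>auto simp: X_scaleR\<close>)
  ultimately have "(\<lambda>v. DX (c *\<^sub>R x) *v (c *\<^sub>R v)) = (\<lambda>v. DX x *v v)" by (rule has_derivative_unique)
  then have "c *\<^sub>R (DX (c *\<^sub>R x) *v v) = DX x *v v" for v by (metis matrix_vector_mult_scaleR)
  then have "DX (c *\<^sub>R x) *v v = ((1 / c) *\<^sub>R DX x) *v v" for v
    using assms(1) by (simp flip: scaleR_matrix_vector_assoc \<open>\<And>v. c *\<^sub>R (DX (c *\<^sub>R x) *v v) = DX x *v v\<close>)
  then show ?thesis by (simp add: matrix_eq)
qed

text \<open>Differentiating Euler's identity \<open>X y \<bullet> y = H y\<close> gives the claim,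
  since the right-hand side already has derivative \<open>X x\<close>. It also yields the null
  vector of the transpose, so the symmetry of the Hessian need not be invoked.\<close>

lemma DX_orthogonal:
  assumes "x \<noteq> 0" shows "(DX x *v v) \<bullet> x = 0"
proof -
  have "((\<lambda>y. X y \<bullet> y) has_derivative (\<lambda>v. X x \<bullet> v + (DX x *v v) \<bullet> x)) (at x)"
    by (intro derivative_intros X_derivative assms)
  moreover have "((\<lambda>y. X y \<bullet> y) has_derivative (\<lambda>v. X x \<bullet> v)) (at x)"
    by (rule has_derivative_transform_within_open[OF H_derivative[OF assms], of "-{0}"])
      (use assms in \<open>auto simp: X_inner\<close>)
  ultimately have "(\<lambda>v. X x \<bullet> v + (DX x *v v) \<bullet> x) = (\<lambda>v. X x \<bullet> v)" by (rule has_derivative_unique)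
  then show ?thesis by (metis add_cancel_right_right)
qed

lemma DX_transpose_kernel:
  assumes "x \<noteq> 0" shows "transpose (DX x) *v x = 0"
proof -
  have "(transpose (DX x) *v x) \<bullet> v = 0" for v
    using DX_orthogonal[OF assms, of v] by (metis inner_matrix_vector_right inner_commute)
  then show ?thesis by (metis inner_eq_zero_iff)
qed

text \<open>Away from the origin \<open>H \<circ> sgn\<close> equals \<open>H x / norm x\<close>. Of
  its second derivative at a unit vector only two terms remain on tangent vectors; \<open>D\<close>
  below is the first derivative by the quotient rule.\<close>

lemma sphere_hessian_H:
  assumes u: "norm u = 1" and vu: "v \<bullet> u = 0" and wu: "w \<bullet> u = 0"
  shows "sphere_hessian H u v w = (DX u *v v) \<bullet> w - H u * (v \<bullet> w)"
proof -
  have u0: "u \<noteq> 0" using u by auto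
  define D where "D = (\<lambda>x w. (X x \<bullet> w) / norm x - H x * (x \<bullet> w) / norm x ^ 3)"
  have D: "frechet_derivative (H \<circ> sgn) (at x) w = D x w" if "x \<noteq> 0" for x
  proof -
    have "((\<lambda>x. H x / norm x) has_derivative D x) (at x)"
    proof (rule has_derivative_eq_rhs)
      show "((\<lambda>x. H x / norm x) has_derivative
          (\<lambda>h. ((X x \<bullet> h) * norm x - H x * (h \<bullet> sgn x)) / (norm x * norm x))) (at x)"
        using that by (intro has_derivative_divide' H_derivative has_derivative_norm) auto
      show "(\<lambda>h. ((X x \<bullet> h) * norm x - H x * (h \<bullet> sgn x)) / (norm x * norm x)) = D x"
        using that by (auto simp: D_def sgn_div_norm field_simps power3_eq_cube inner_commute)
    qed
    then have "((H \<circ> sgn) has_derivative D x) (at x)"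
      by (rule has_derivative_transform_within_open[of _ _ _ _ "-{0}"])
        (use that in \<open>auto simp: support_fun_norm_sgn[OF compact nonempty, symmetric] sgn_div_norm H_scaleR field_simps\<close>)
    then show ?thesis by (simp add: frechet_derivative_at[symmetric])
  qed
  have "((\<lambda>x. (X x \<bullet> w) / norm x - H x * (x \<bullet> w) / norm x ^ 3) has_derivative (\<lambda>v.
      ((DX u *v v) \<bullet> w * norm u - (X u \<bullet> w) * (v \<bullet> sgn u)) / (norm u * norm u)
      - ((H u * (v \<bullet> w) + (X u \<bullet> v) * (u \<bullet> w)) * norm u ^ 3
          - (H u * (u \<bullet> w)) * (of_nat 3 * (v \<bullet> sgn u) * norm u ^ (3 - 1))) / (norm u ^ 3 * norm u ^ 3))) (at u)"
    using u0 by (intro has_derivative_diff has_derivative_divide' has_derivative_power has_derivative_mult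
        H_derivative X_derivative has_derivative_norm has_derivative_inner_left has_derivative_ident) auto
  then have "((\<lambda>x. D x w) has_derivative (\<lambda>v.
      (DX u *v v) \<bullet> w - (X u \<bullet> w) * (v \<bullet> u) - (H u * (v \<bullet> w) + (X u \<bullet> v) * (u \<bullet> w)
        - 3 * H u * (u \<bullet> w) * (v \<bullet> u)))) (at u)"
    unfolding D_def by (rule has_derivative_eq_rhs) (auto simp: u sgn_div_norm)
  then have "((\<lambda>x. frechet_derivative (H \<circ> sgn) (at x) w) has_derivative (\<lambda>v.
      (DX u *v v) \<bullet> w - (X u \<bullet> w) * (v \<bullet> u) - (H u * (v \<bullet> w) + (X u \<bullet> v) * (u \<bullet> w)
        - 3 * H u * (u \<bullet> w) * (v \<bullet> u)))) (at u)"
    by (rule has_derivative_transform_within_open[of _ _ _ _ "-{0}"]) (use u0 D in auto)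
  then show ?thesis unfolding sphere_hessian_def
    using vu wu by (simp add: frechet_derivative_at[symmetric] inner_commute)
qed

text \<open>The summand \<open>h\<close> times the identity cancels the correction in the spherical
  Hessian, leaving the Euclidean Hessian \<open>DX u\<close> on the tangent space. The projection
  may be dropped because \<open>DX u\<close> kills \<open>u\<close> and maps into its orthogonal
  complement.\<close>

lemma hess_det_eq:
  assumes u: "norm u = 1"
  shows "hess_det H u = det (DX u + outer u u)"
proof -
  have u0: "u \<noteq> 0" and uu: "u \<bullet> u = 1" using u by (auto simp: norm_eq_1)
  define P where "P = (\<lambda>v. v - (v \<bullet> u) *\<^sub>R u)"
  have P: "P v \<bullet> u = 0" for v by (simp add: P_def inner_diff_left uu)
  have "sphere_hessian H u (P v) (P w) + H u * (P v \<bullet> P w) = (DX u *v v) \<bullet> w" for v w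
    using sphere_hessian_H[OF u P P, of v w] DX_kernel[OF u0] DX_orthogonal[OF u0, of v]
    by (simp add: P_def matrix_vector_mult_diff_distrib matrix_vector_mult_scaleR inner_diff_right)
  then have "hess_det H u = det (\<chi> i j. (DX u *v axis i 1) \<bullet> axis j 1 + u $ i * u $ j)"
    by (simp add: hess_det_def tangent_det_def Let_def P_def)
  also have "(\<chi> i j. (DX u *v axis i 1) \<bullet> axis j 1 + u $ i * u $ j) = transpose (DX u + outer u u)"
    by (simp add: vec_eq_iff transpose_def outer_def inner_axis matrix_vector_mul_component mult.commute)
  finally show ?thesis by (simp add: det_transpose)
qed

end

section \<open>The Gauss map\<close>

text \<open>A normal \<open>v\<close> is orthogonal to every \<open>z\<close> in the kernel of the gradient \<open>g\<close>: between the points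
  \<open>x + \<tau> (z \<plusminus> \<epsilon> g)\<close> the function \<open>f\<close> changes sign, so the body contains points
  \<open>x + \<tau> (z + \<sigma> g)\<close> with small \<open>\<sigma>\<close>.\<close>

lemma supporting_normal_parallel_gradient:
  fixes f :: "real^'n \<Rightarrow> real"
  assumes U: "open U" "x \<in> U" and cont: "continuous_on U f"
    and level: "frontier K \<inter> U = {y \<in> U. f y = 0}" and x: "x \<in> frontier K" and K: "closed K"
    and der: "(f has_derivative (\<lambda>v. g \<bullet> v)) (at x)" and g: "g \<noteq> 0"
    and v: "\<forall>y\<in>K. (y - x) \<bullet> v \<le> 0"
  shows "\<exists>c. v = c *\<^sub>R g"
proof -
  have fx: "f x = 0" using level x U by blast
  have tangent: "z \<bullet> v \<le> 0" if z: "g \<bullet> z = 0" for z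
  proof (rule ccontr)
    assume "\<not> z \<bullet> v \<le> 0"
    \<comment> \<open>Small enough that adding \<open>s *\<^sub>R g\<close> with
      \<open>\<bar>s\<bar> \<le> e\<close> cannot destroy the positivity of the product with
      \<open>v\<close>; the summand 1 covers \<open>g \<bullet> v = 0\<close>.\<close>
    define e where "e = (z \<bullet> v) / (2 * (\<bar>g \<bullet> v\<bar> + 1))"
    have e: "e > 0" "e * \<bar>g \<bullet> v\<bar> < z \<bullet> v"
      using \<open>\<not> z \<bullet> v \<le> 0\<close> unfolding e_def by (auto simp: field_simps) (smt (verit) mult_nonneg_nonneg abs_ge_zero)
    have D: "((\<lambda>t. f (x + t *\<^sub>R w)) has_real_derivative (g \<bullet> w)) (at 0)" for w
    proof -
      have 1: "((\<lambda>t. x + t *\<^sub>R w) has_derivative (\<lambda>t. t *\<^sub>R w)) (at 0)"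
        by (auto intro!: derivative_eq_intros)
      have "((\<lambda>t. f (x + t *\<^sub>R w)) has_derivative (\<lambda>t. g \<bullet> (t *\<^sub>R w))) (at 0)"
        by (rule has_derivative_compose[OF 1]) (simp add: der)
      then show ?thesis by (rule has_derivative_imp_has_field_derivative) simp
    qed
    have gg: "g \<bullet> g > 0" using g by simp
    obtain d1 where d1: "d1 > 0" "\<And>h. h > 0 \<Longrightarrow> h < d1 \<Longrightarrow> 0 < f (x + h *\<^sub>R (z + e *\<^sub>R g))"
      using DERIV_pos_inc_right[OF D[of "z + e *\<^sub>R g"]] e gg z fx by (auto simp: inner_add_right)
    obtain d2 where d2: "d2 > 0" "\<And>h. h > 0 \<Longrightarrow> h < d2 \<Longrightarrow> f (x + h *\<^sub>R (z - e *\<^sub>R g)) < 0"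
      using DERIV_neg_dec_right[OF D[of "z - e *\<^sub>R g"]] e gg z fx by (auto simp: inner_diff_right)
    obtain r where r: "r > 0" "cball x r \<subseteq> U" using U open_contains_cball by blast
    define M where "M = norm z + e * norm g + 1"
    have M: "M > 0" using e by (simp add: M_def add_nonneg_pos)
    \<comment> \<open>The bounds \<open>d1\<close>, \<open>d2\<close> give opposite signs of
      \<open>f\<close> at the two ends, the bound \<open>r / M\<close> keeps the whole segment
      between them inside \<open>U\<close>.\<close>
    define h where "h = min (min d1 d2 / 2) (r / M)"
    have h: "h > 0" "h < d1" "h < d2" "h * M \<le> r"
    proof -
      have "h \<le> min d1 d2 / 2" "h \<le> r / M" unfolding h_def by (rule min.cobounded1, rule min.cobounded2)
      then show "h < d1" "h < d2" "h * M \<le> r" using d1(1) d2(1) M by (auto simp: pos_le_divide_eq)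
      show "h > 0" using d1(1) d2(1) r(1) M by (simp add: h_def)
    qed
    have inU: "x + h *\<^sub>R (z + s *\<^sub>R g) \<in> U" if "\<bar>s\<bar> \<le> e" for s
    proof -
      have "norm (z + s *\<^sub>R g) \<le> M"
        using norm_triangle_ineq[of z "s *\<^sub>R g"] mult_right_mono[OF that norm_ge_zero[of g]] by (simp add: M_def)
      then have "norm (h *\<^sub>R (z + s *\<^sub>R g)) \<le> r"
        using h order_trans[OF mult_left_mono[of "norm (z + s *\<^sub>R g)" M h] h(4)] by simp
      then show ?thesis using r by (auto simp: dist_norm)
    qed
    have "continuous_on {-e..e} (\<lambda>s. f (x + h *\<^sub>R (z + s *\<^sub>R g)))"
      by (rule continuous_on_compose2[OF cont]) (use inU in \<open>auto intro!: continuous_intros\<close>)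
    then obtain s where s: "-e \<le> s" "s \<le> e" "f (x + h *\<^sub>R (z + s *\<^sub>R g)) = 0"
      using IVT'[of "\<lambda>s. f (x + h *\<^sub>R (z + s *\<^sub>R g))" "-e" 0 e] d1(2)[OF h(1,2)] d2(2)[OF h(1,3)] e
      by (auto simp: less_imp_le)
    then have "x + h *\<^sub>R (z + s *\<^sub>R g) \<in> frontier K" using level inU[of s] by (auto simp: abs_le_iff)
    then have "x + h *\<^sub>R (z + s *\<^sub>R g) \<in> K" using K frontier_subset_closed by blast
    then have "(h *\<^sub>R (z + s *\<^sub>R g)) \<bullet> v \<le> 0" using v by force
    then have "z \<bullet> v + s * (g \<bullet> v) \<le> 0" using h by (simp add: inner_add_left mult_le_0_iff)
    moreover have "- (s * (g \<bullet> v)) \<le> e * \<bar>g \<bullet> v\<bar>"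
    proof -
      have "\<bar>s * (g \<bullet> v)\<bar> \<le> e * \<bar>g \<bullet> v\<bar>"
        unfolding abs_mult using s by (intro mult_right_mono) auto
      then show ?thesis by linarith
    qed
    ultimately show False using e by linarith
  qed
  \<comment> \<open>The part of \<open>v\<close> orthogonal to \<open>g\<close>. The inequality for
    \<open>z\<close> and for \<open>-z\<close> forces \<open>z \<bullet> v = 0\<close>, hence
    \<open>z = 0\<close>.\<close>
  define z where "z = v - ((v \<bullet> g) / (g \<bullet> g)) *\<^sub>R g"
  have gz: "g \<bullet> z = 0" using g by (simp add: z_def inner_diff_right inner_commute)
  have "z \<bullet> v = 0" using tangent[OF gz] tangent[of "-z"] gz by simp
  then have "z \<bullet> z = 0" using gz by (simp add: z_def inner_diff_right inner_commute)
  then show ?thesis unfolding z_def by auto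
qed

locale smooth_body = smooth_support K for K :: "(real^'n) set" +
  assumes boundary: "smooth_boundary K"
begin

lemma chart:
  assumes "x \<in> frontier K"
  obtains U g where "open U" "x \<in> U" "smooth_on U g"
    "\<And>y. y \<in> U \<Longrightarrow> g y \<noteq> 0"
    "\<And>y v. y \<in> U \<Longrightarrow> y \<in> frontier K \<Longrightarrow> \<forall>z\<in>K. (z - y) \<bullet> v \<le> 0 \<Longrightarrow> \<exists>c. v = c *\<^sub>R g y"
proof -
  obtain U and f :: "real^'n \<Rightarrow> real" where U: "open U" "x \<in> U" "smooth_on U f"
     "\<forall>y\<in>U. \<exists>v. frechet_derivative f (at y) v \<noteq> 0" "frontier K \<inter> U = {y \<in> U. f y = 0}"
    using boundary[unfolded smooth_boundary_def, rule_format, OF assms] by (elim exE conjE) (rule that)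
  define g where "g y = (\<Sum>b\<in>Basis. frechet_derivative f (at y) b *\<^sub>R b)" for y
  have at: "at y within U = at y" if "y \<in> U" for y using that U(1) by (rule at_within_open)
  have der: "(f has_derivative (\<lambda>v. g y \<bullet> v)) (at y)" if "y \<in> U" for y
  proof -
    have d: "(f has_derivative frechet_derivative f (at y)) (at y)"
      using smooth_on_has_derivative[OF U(3) that] at[OF that] by simp
    have "frechet_derivative f (at y) v = g y \<bullet> v" for v
      unfolding g_def by (rule linear_functional_eq_inner[OF has_derivative_linear[OF d]])
    then have "frechet_derivative f (at y) = (\<lambda>v. g y \<bullet> v)" by auto
    then show ?thesis using d by simp
  qed
  have g0: "g y \<noteq> 0" if "y \<in> U" for y
    using U(4) that frechet_derivative_at[OF der[OF that]] by (metis inner_zero_left)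
  have "smooth_on U (\<lambda>y. \<Sum>b\<in>Basis. frechet_derivative f (at y within U) b *\<^sub>R b)"
    using U by (intro smooth_on_sum smooth_on_scaleR smooth_on_frechet_derivative thick_open smooth_on_const)
  then have sg: "smooth_on U g" by (rule smooth_on_cong[rotated]) (simp add: g_def at)
  show thesis
  proof (rule that[OF U(1,2) sg g0])
    fix y v assume "y \<in> U" "y \<in> frontier K" "\<forall>z\<in>K. (z - y) \<bullet> v \<le> 0"
    then show "\<exists>c. v = c *\<^sub>R g y"
      using supporting_normal_parallel_gradient[OF U(1) _ smooth_on_continuous[OF U(3)] U(5) _
          compact_imp_closed[OF compact] der g0] by blast
  qed
qed

text \<open>The relation behind \<open>outer_normal\<close>, usable before existence and uniqueness
  of the normal make the definite description meaningful.\<close>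

definition is_normal :: "real^'n \<Rightarrow> real^'n \<Rightarrow> bool" where
  "is_normal x v \<longleftrightarrow> norm v = 1 \<and> (\<forall>y\<in>K. (y - x) \<bullet> v \<le> 0)"

lemma normal_inner_pos:
  assumes "is_normal x v" shows "x \<bullet> v > 0"
proof -
  have v: "v \<noteq> 0" "\<forall>y\<in>K. (y - x) \<bullet> v \<le> 0" using assms by (auto simp: is_normal_def)
  have "(X v - x) \<bullet> v \<le> 0" using v X_mem by blast
  then show ?thesis using X_inner[OF v(1)] H_pos[OF v(1)] by (simp add: inner_diff_left)
qed

text \<open>A defining function may be positive or negative inside the body, so its gradient gives
  the normal only up to sign. Positivity of \<open>x \<bullet> v\<close>, due to the interior
  origin, selects the sign \<open>s\<close>; as a separate parameter it can be kept constant near a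
  boundary point.\<close>

lemma normal_eq_sgn_gradient:
  assumes "is_normal x v" "v = c *\<^sub>R g" "s * (x \<bullet> g) > 0" "\<bar>s\<bar> = 1"
  shows "v = s *\<^sub>R sgn g"
proof -
  have "c * (x \<bullet> g) > 0" using normal_inner_pos[OF assms(1)] assms(2) by simp
  then have "sgn c = s" using assms(3,4) by (auto simp: zero_less_mult_iff sgn_if abs_if split: if_splits)
  moreover have "v = sgn v" using assms(1) by (simp add: is_normal_def sgn_div_norm)
  ultimately show ?thesis using assms(2) by (simp add: sgn_scaleR)
qed

lemma normal_unique:
  assumes "x \<in> frontier K" "is_normal x v" "is_normal x w"
  shows "v = w"
proof -
  obtain U g where U: "x \<in> U" "\<And>y v. y \<in> U \<Longrightarrow> y \<in> frontier K \<Longrightarrow> \<forall>z\<in>K. (z - y) \<bullet> v \<le> 0 \<Longrightarrow> \<exists>c. v = c *\<^sub>R g y"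
    using chart[OF assms(1)] by metis
  then obtain c d where cd: "v = c *\<^sub>R g x" "w = d *\<^sub>R g x" using assms unfolding is_normal_def by metis
  then have "x \<bullet> g x \<noteq> 0" using normal_inner_pos[OF assms(2)] by auto
  then have "sgn (x \<bullet> g x) * (x \<bullet> g x) > 0" "\<bar>sgn (x \<bullet> g x)\<bar> = 1" by (auto simp: sgn_if)
  then show ?thesis using normal_eq_sgn_gradient[OF assms(2) cd(1)] normal_eq_sgn_gradient[OF assms(3) cd(2)] by simp
qed

lemma is_normal_X: "norm u = 1 \<Longrightarrow> is_normal (X u) u"
  unfolding is_normal_def using H_upper[of _ u] X_inner[of u] by (cases "u = 0") (auto simp: inner_diff_left)

lemma outer_normal_eqI: "x \<in> frontier K \<Longrightarrow> is_normal x v \<Longrightarrow> outer_normal K x = v"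
  unfolding outer_normal_def using normal_unique unfolding is_normal_def by (intro the_equality) auto

lemma outer_normal_X: "x \<noteq> 0 \<Longrightarrow> outer_normal K (X x) = sgn x"
  using outer_normal_eqI[OF X_frontier is_normal_X, of "sgn x"] X_sgn[of x] by (simp add: norm_sgn sgn_zero_iff)

text \<open>A supporting hyperplane at \<open>x\<close> provides a direction in which
  \<open>x\<close> is maximal on \<open>K\<close>; the maximal point in a given direction is
  unique.\<close>

lemma frontier_point_is_X:
  assumes "x \<in> frontier K" shows "\<exists>u. norm u = 1 \<and> is_normal x u \<and> x = X u"
proof -
  have xK: "x \<in> K" using assms compact_imp_closed[OF compact] frontier_subset_closed by blast
  have "x \<notin> rel_interior K"
    using assms zero_interior rel_interior_nonempty_interior[of K] by (auto simp: frontier_def)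
  then obtain a where a: "a \<noteq> 0" "\<And>y. y \<in> K \<Longrightarrow> a \<bullet> x \<le> a \<bullet> y"
    using supporting_hyperplane_rel_boundary[OF convex xK] by metis
  define u where "u = - sgn a"
  have u: "norm u = 1" using a(1) by (simp add: u_def norm_sgn)
  have le: "y \<bullet> u \<le> x \<bullet> u" if "y \<in> K" for y
    using a(2)[OF that] a(1) by (simp add: u_def sgn_div_norm inner_commute divide_right_mono field_simps)
  obtain y where "y \<in> K" "y \<bullet> u = H u" using support_fun_attained[OF compact nonempty] .
  then have "x \<bullet> u = H u" using le[of y] H_upper[OF xK, of u] by simp
  then have "x = X u" using support_point_unique[of u x] u xK by fastforce
  then show ?thesis using u le by (auto simp: is_normal_def inner_diff_left)
qed

text \<open>Near \<open>x\<close> on the boundary the outer normal coincides with the normalised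
  gradient of a chart times a sign, which is constant there because \<open>y \<bullet> g y\<close>
  is continuous and nonzero at \<open>x\<close>.\<close>

lemma outer_normal_differentiable:
  assumes x: "x \<in> frontier K"
  shows "outer_normal K differentiable (at x within frontier K)"
proof -
  obtain U g where U: "open U" "x \<in> U" and g: "smooth_on U g" "\<And>y. y \<in> U \<Longrightarrow> g y \<noteq> 0"
    "\<And>y v. y \<in> U \<Longrightarrow> y \<in> frontier K \<Longrightarrow> \<forall>z\<in>K. (z - y) \<bullet> v \<le> 0 \<Longrightarrow> \<exists>c. v = c *\<^sub>R g y"
    using chart[OF x] by metis
  obtain u where u: "is_normal x u" using frontier_point_is_X[OF x] by blast
  then obtain c where "u = c *\<^sub>R g x" using g(3)[OF U(2) x] by (auto simp: is_normal_def)
  then have nz: "x \<bullet> g x \<noteq> 0" using normal_inner_pos[OF u] by auto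
  define s where "s = sgn (x \<bullet> g x)"
  have s: "s * (x \<bullet> g x) > 0" "\<bar>s\<bar> = 1" using nz by (auto simp: s_def sgn_if)
  have "continuous_on U (\<lambda>y. s * (y \<bullet> g y))"
    by (intro continuous_intros smooth_on_continuous[OF g(1)])
  then have "open (U \<inter> (\<lambda>y. s * (y \<bullet> g y)) -` {0<..})"
    by (rule continuous_open_preimage[OF _ U(1) open_greaterThan])
  then obtain d where d: "d > 0" "\<And>y. dist y x < d \<Longrightarrow> y \<in> U \<and> s * (y \<bullet> g y) > 0"
    using U(2) s(1) unfolding open_dist by fastforce
  have "smooth_on U (\<lambda>y. s *\<^sub>R sgn (g y))"
    using g by (intro smooth_on_scaleR smooth_on_const smooth_on_compose[OF smooth_on_sgn]) (auto simp: image_subset_iff)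
  from smooth_on_has_derivative[OF this U(2)] obtain D where
    "((\<lambda>y. s *\<^sub>R sgn (g y)) has_derivative D) (at x)"
    unfolding at_within_open[OF U(2,1)] by blast
  then have "((\<lambda>y. s *\<^sub>R sgn (g y)) has_derivative D) (at x within frontier K)"
    by (rule has_derivative_at_withinI)
  then have "(outer_normal K has_derivative D) (at x within frontier K)"
  proof (rule has_derivative_transform_within[OF _ d(1) x])
    fix y assume y: "y \<in> frontier K" "dist y x < d"
    obtain v where v: "is_normal y v" using frontier_point_is_X[OF y(1)] by blast
    then obtain c where "v = c *\<^sub>R g y" using g(3)[OF _ y(1)] d(2)[OF y(2)] by (auto simp: is_normal_def)
    then have "v = s *\<^sub>R sgn (g y)" using normal_eq_sgn_gradient[OF v] d(2)[OF y(2)] s(2) by blast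
    then show "s *\<^sub>R sgn (g y) = outer_normal K y" using outer_normal_eqI[OF y(1) v] by simp
  qed
  then show ?thesis by (rule differentiableI)
qed

lemma sgn_derivative:
  fixes u :: "'a::euclidean_space"
  assumes "norm u = 1"
  shows "(sgn has_derivative (\<lambda>v. v - (v \<bullet> u) *\<^sub>R u)) (at u)"
proof -
  have "u \<noteq> 0" using assms by auto
  then have "((\<lambda>x. inverse (norm x)) has_derivative
     (\<lambda>v. - (inverse (norm u) * (v \<bullet> sgn u) * inverse (norm u)))) (at u)"
    using Deriv.has_derivative_inverse[OF _ has_derivative_norm, of u] by simp
  from has_derivative_scaleR[OF this has_derivative_ident]
  have "((\<lambda>x. inverse (norm x) *\<^sub>R x) has_derivative (\<lambda>v. v - (v \<bullet> u) *\<^sub>R u)) (at u)"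
    using assms by (simp add: sgn_div_norm)
  moreover have "(\<lambda>x. inverse (norm x) *\<^sub>R x) = (sgn :: 'a \<Rightarrow> 'a)" by (auto simp: sgn_div_norm)
  ultimately show ?thesis by simp
qed

text \<open>The chain rule for \<open>outer_normal K (X y) = sgn y\<close> says that the
  differential of the Gauss map and \<open>DX u\<close> are inverse on the tangent space. Adding
  \<open>outer u u\<close> to both makes them inverse matrices on the whole space.\<close>

lemma gauss_curvature_times_hess_det:
  assumes u: "norm u = 1"
  shows "gauss_curvature K (X u) * hess_det H u = 1"
proof -
  have u0: "u \<noteq> 0" and uu: "u \<bullet> u = 1" using u by (auto simp: norm_eq_1)
  define D where "D = frechet_derivative (outer_normal K) (at (X u) within frontier K)"
  have D: "(outer_normal K has_derivative D) (at (X u) within frontier K)"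
    using outer_normal_differentiable[OF X_frontier[OF u0]] by (simp add: D_def frechet_derivative_works)
  define P where "P = (\<lambda>v. v - (v \<bullet> u) *\<^sub>R u)"
  have DX_within: "(X has_derivative (*v) (DX u)) (at u within - {0})"
    using X_derivative[OF u0] by (rule has_derivative_at_withinI)
  have "(outer_normal K has_derivative D) (at (X u) within X ` (- {0}))"
    by (rule has_derivative_subset[OF D]) (use X_frontier in auto)
  from has_derivative_in_compose[OF DX_within this]
  have "((\<lambda>y. outer_normal K (X y)) has_derivative (\<lambda>v. D (DX u *v v))) (at u)"
    using at_within_punctured[OF u0] by simp
  moreover have "((\<lambda>y. outer_normal K (X y)) has_derivative P) (at u)"
    unfolding P_def
    by (rule has_derivative_transform_within_open[OF sgn_derivative[OF u], of "-{0}"])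
      (use u0 in \<open>auto simp: outer_normal_X\<close>)
  ultimately have DP: "(\<lambda>v. D (DX u *v v)) = P" by (rule has_derivative_unique)
  have linD: "linear D" using D by (rule has_derivative_linear)
  have linP: "linear P" unfolding P_def by (auto simp: linear_iff inner_add_left algebra_simps)
  have Pu: "P v \<bullet> u = 0" for v by (simp add: P_def inner_diff_left uu)
  have Psym: "P v \<bullet> w = v \<bullet> P w" for v w by (simp add: P_def inner_diff_left inner_diff_right inner_commute)
  \<comment> \<open>The derivative \<open>D\<close> within the boundary is determined only on
    tangent vectors, so it is compressed to the tangent space on both sides.\<close>
  define A where "A = matrix (\<lambda>v. P (D (P v)))"
  have Av: "A *v v = P (D (P v))" for v
    using linear_compose[OF linear_compose[OF linP linD] linP] by (simp add: A_def o_def)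
  have "gauss_curvature K (X u) = det (\<chi> i j. D (P (axis i 1)) \<bullet> P (axis j 1) + u $ i * u $ j)"
    using outer_normal_X[OF u0] u
    by (simp add: gauss_curvature_def tangent_det_def Let_def D_def P_def sgn_div_norm)
  also have "(\<chi> i j. D (P (axis i 1)) \<bullet> P (axis j 1) + u $ i * u $ j) = transpose (A + outer u u)"
  proof -
    have "D (P (axis i 1)) \<bullet> P (axis j 1) = A $ j $ i" for i j
      by (simp add: Psym[symmetric] Av[symmetric] inner_axis matrix_vector_mul_component)
    then show ?thesis by (simp add: vec_eq_iff transpose_def outer_def mult.commute)
  qed
  also have "det (transpose (A + outer u u)) = det (A + outer u u)" by (rule det_transpose)
  finally have gc: "gauss_curvature K (X u) = det (A + outer u u)" .
  have "(A + outer u u) ** (DX u + outer u u) = mat 1"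
  proof (subst matrix_eq, rule allI)
    fix v
    have 1: "P (DX u *v v) = DX u *v v" using DX_orthogonal[OF u0, of v] by (simp add: P_def)
    have 2: "D (DX u *v v) = P v" using DP by metis
    have 3: "P u = 0" by (simp add: P_def uu)
    have 4: "P (P v) = P v" using Pu[of v] by (simp add: P_def)
    have 5: "D 0 = 0" "P 0 = 0" using linD linP by (simp_all add: linear_0)
    have "A *v (DX u *v v) = P v" by (simp add: Av 1 2 4)
    moreover have "A *v u = 0" by (simp add: Av 3 5)
    moreover have "u \<bullet> (DX u *v v) = 0" using DX_orthogonal[OF u0, of v] by (simp add: inner_commute)
    ultimately show "((A + outer u u) ** (DX u + outer u u)) *v v = mat 1 *v v"
      by (simp add: matrix_vector_mul_assoc[symmetric] matrix_vector_mult_add_rdistrib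
        matrix_vector_right_distrib matrix_vector_mult_scaleR uu inner_add_right P_def inner_commute)
  qed
  then show ?thesis unfolding gc hess_det_eq[OF u] by (metis det_I det_mul)
qed

lemma X_inj: "norm u = 1 \<Longrightarrow> norm v = 1 \<Longrightarrow> X u = X v \<Longrightarrow> u = v"
  using outer_normal_X[of u] outer_normal_X[of v] by (force simp: sgn_div_norm)

lemma normal_curvature_eq:
  assumes u: "norm u = 1"
  shows "normal_curvature K u = gauss_curvature K (X u)"
proof -
  have u0: "u \<noteq> 0" using u by auto
  have "(THE x. x \<in> frontier K \<and> outer_normal K x = u) = X u"
  proof (rule the_equality)
    show "X u \<in> frontier K \<and> outer_normal K (X u) = u"
      using X_frontier[OF u0] outer_normal_X[OF u0] u by (simp add: sgn_div_norm)
    fix x assume "x \<in> frontier K \<and> outer_normal K x = u"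
    moreover from this obtain v where "norm v = 1" "is_normal x v" "x = X v" using frontier_point_is_X by blast
    ultimately show "x = X u" using outer_normal_eqI by metis
  qed
  then show ?thesis by (simp add: normal_curvature_def)
qed

lemma normal_curvature_eq_curvature_of_support:
  "norm u = 1 \<Longrightarrow> normal_curvature K u = curvature_of_support H u"
  using gauss_curvature_times_hess_det[of u]
  by (simp add: normal_curvature_eq curvature_of_support_eq) (metis divide_eq_eq mult_zero_right zero_neq_one nonzero_eq_divide_eq)

text \<open>Lets membership in the class be tested on the support function, both for the bodies of a
  flow and for their linear images.\<close>

lemma K_reg_iff: "K \<in> K_reg \<longleftrightarrow> (\<forall>u. norm u = 1 \<longrightarrow> hess_det H u > 0)"
proof -
  have pos: "gauss_curvature K (X u) > 0 \<longleftrightarrow> hess_det H u > 0" if "norm u = 1" for u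
    using gauss_curvature_times_hess_det[OF that] by (metis zero_less_mult_pos zero_less_mult_pos2 zero_less_one)
  have "(\<forall>x\<in>frontier K. gauss_curvature K x > 0) \<longleftrightarrow> (\<forall>u. norm u = 1 \<longrightarrow> hess_det H u > 0)"
    using frontier_point_is_X X_frontier pos by (metis norm_zero zero_neq_one)
  then show ?thesis using compact convex zero_interior boundary by (simp add: K_reg_def)
qed

end

section \<open>Integration over the sphere and volume\<close>

lemma scale_measure_eq_density:
  "scale_measure (of_nat n) M = density M (\<lambda>_. ennreal (real n))"
proof (rule measure_eqI)
  fix A assume "A \<in> sets (scale_measure (of_nat n) M)"
  then show "emeasure (scale_measure (of_nat n) M) A = emeasure (density M (\<lambda>_. ennreal (real n))) A"
    by (simp add: emeasure_density_const ennreal_of_nat_eq_real_of_nat)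
qed simp

abbreviation "punctured_ball \<equiv> ball 0 1 - {0 :: real^'n}"

text \<open>Unfolds \<open>sphere_measure\<close> as a push-forward under \<open>sgn\<close>.
  Integrability comes from boundedness on the compact sphere and the finite volume of the ball; the
  measurable completion does not change the integral.\<close>

lemma
  fixes f :: "real^'n \<Rightarrow> real"
  assumes f: "continuous_on (sphere 0 1) f"
  shows integrable_sphere_measure: "integrable sphere_measure f"
    and set_integrable_sgn: "set_integrable lebesgue punctured_ball (\<lambda>y. f (sgn y))"
    and integral_sphere_measure: "integral\<^sup>L sphere_measure f =
          real CARD('n) * (LINT y:punctured_ball|lebesgue. f (sgn y))"
    and borel_measurable_sphere_measure: "f \<in> borel_measurable sphere_measure"
proof -
  define S where "S = restrict_space borel (sphere 0 1 :: (real^'n) set)"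
  define B where "B = restrict_space lborel (punctured_ball :: (real^'n) set)"
  have fS: "f \<in> borel_measurable S"
    using borel_measurable_continuous_on_restrict[OF f] by (simp add: S_def)
  have csgn: "continuous_on (-{0}) (sgn :: real^'n \<Rightarrow> _)"
    by (rule smooth_on_continuous[OF smooth_on_sgn])
  have "sgn \<in> borel_measurable B"
    unfolding B_def measurable_cong_sets[OF sets_restrict_space_cong[OF sets_lborel] refl]
    by (rule borel_measurable_continuous_on_restrict[OF continuous_on_subset[OF csgn]]) auto
  then have sgnB: "sgn \<in> B \<rightarrow>\<^sub>M S"
    unfolding S_def B_def by (intro measurable_restrict_space2) (auto simp: norm_sgn space_restrict_space)
  have "compact (f ` sphere 0 1)" by (rule compact_continuous_image[OF f compact_sphere])
  then obtain C where C: "\<And>u. u \<in> sphere 0 1 \<Longrightarrow> \<bar>f u\<bar> \<le> C"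
    by (metis compact_imp_bounded bounded_iff image_eqI real_norm_def)
  have pb: "punctured_ball \<inter> space lborel \<in> sets lborel" by simp
  have mB: "(\<lambda>y. indicat_real punctured_ball y *\<^sub>R f (sgn y)) \<in> borel_measurable lborel"
    using measurable_compose[OF sgnB fS] unfolding B_def by (simp add: borel_measurable_restrict_space_iff[OF pb])
  have fin: "emeasure lborel punctured_ball < \<infinity>"
    by (rule le_less_trans[OF emeasure_mono emeasure_lborel_ball_finite[of 0 1]]) auto
  have iB: "integrable lborel (\<lambda>y. indicat_real punctured_ball y *\<^sub>R f (sgn y))"
  proof (rule Bochner_Integration.integrable_bound[OF _ mB])
    show "integrable lborel (\<lambda>y. indicat_real punctured_ball y *\<^sub>R C)"
      using fin by (intro integrable_scaleR_left integrable_real_indicator) auto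
    show "AE y in lborel. norm (indicat_real punctured_ball y *\<^sub>R f (sgn y)) \<le> norm (indicat_real punctured_ball y *\<^sub>R C)"
      using C by (auto simp: indicator_def norm_sgn intro!: AE_I2 order_trans[OF C])
  qed
  then show si: "set_integrable lebesgue punctured_ball (\<lambda>y. f (sgn y))"
    unfolding set_integrable_def using integrable_completion[OF mB] by simp
  have iB': "integrable B (\<lambda>y. f (sgn y))"
    unfolding B_def by (subst integrable_restrict_space[OF pb]) (rule iB)
  have iD: "integrable (distr B S sgn) f"
    using integrable_distr_eq[OF sgnB fS] iB' by simp
  have sm: "sphere_measure = density (distr B S sgn) (\<lambda>_. ennreal (real CARD('n)))"
    unfolding sphere_measure_def B_def S_def by (rule scale_measure_eq_density)
  have fD: "f \<in> borel_measurable (distr B S sgn)" using fS by simp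
  show "f \<in> borel_measurable sphere_measure" unfolding sm using fS by simp
  show "integrable sphere_measure f"
    unfolding sm using iD by (subst integrable_density[OF fD]) auto
  have "integral\<^sup>L sphere_measure f = real CARD('n) * integral\<^sup>L (distr B S sgn) f"
    unfolding sm by (subst integral_density[OF fD]) auto
  also have "integral\<^sup>L (distr B S sgn) f = integral\<^sup>L B (\<lambda>y. f (sgn y))"
    by (rule integral_distr[OF sgnB fS])
  also have "\<dots> = integral\<^sup>L lborel (\<lambda>y. indicat_real punctured_ball y *\<^sub>R f (sgn y))"
    unfolding B_def by (rule integral_restrict_space[OF pb])
  also have "\<dots> = (LINT y:punctured_ball|lebesgue. f (sgn y))"
    unfolding set_lebesgue_integral_def by (rule integral_completion[OF mB, symmetric])
  finally show "integral\<^sup>L sphere_measure f =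
          real CARD('n) * (LINT y:punctured_ball|lebesgue. f (sgn y))" .
qed

lemma space_sphere_measure: "space (sphere_measure :: (real^'n) measure) = sphere 0 1"
  by (simp add: sphere_measure_def space_scale_measure space_restrict_space)

lemma smooth_on_det:
  assumes "\<And>i j. smooth_on S (\<lambda>x. A x $ i $ j)"
  shows "smooth_on S (\<lambda>x. det (A x :: real^'n^'n))"
  unfolding det_def by (intro smooth_on_sum smooth_on_mult smooth_on_const smooth_on_prod assms)

lemma smooth_on_component: "smooth_on S f \<Longrightarrow> smooth_on S (\<lambda>x. f x $ i :: real)"
  by (rule smooth_on_compose_linear[OF bounded_linear_vec_nth])

context smooth_support
begin

lemma smooth_DX_entry: "smooth_on (-{0}) (\<lambda>x. DX x $ i $ j)"
proof (rule smooth_on_cong)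
  show "smooth_on (-{0}) (\<lambda>x. frechet_derivative X (at x within -{0}) (axis j 1) $ i)"
    by (intro smooth_on_component smooth_on_frechet_derivative smooth_X thick_open) auto
qed (simp add: DX_def matrix_def at_within_punctured)

lemma continuous_hess_det: "continuous_on (sphere 0 1) (hess_det H)"
proof -
  have "smooth_on (-{0}) (\<lambda>x. det (DX x + outer x x))"
    unfolding outer_def
    by (intro smooth_on_det) (auto intro!: smooth_on_add smooth_on_mult smooth_DX_entry smooth_on_component)
  then have "continuous_on (sphere 0 1) (\<lambda>x. det (DX x + outer x x))"
    by (rule continuous_on_subset[OF smooth_on_continuous]) auto
  then show ?thesis by (rule continuous_on_eq) (simp add: hess_det_eq)
qed

lemma continuous_H: "continuous_on (sphere 0 1) H"
  by (rule continuous_on_subset[OF smooth_on_continuous[OF smooth_H]]) auto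

definition radial_map :: "(real^'n \<Rightarrow> real) \<Rightarrow> real^'n \<Rightarrow> real^'n" where
  "radial_map q y = (q y * norm y) *\<^sub>R X y"

text \<open>The derivative of a radially constant factor \<open>q\<close> changes the differential only by a rank-one
  term, which does not contribute to the determinant.\<close>

lemma radial_map_derivative:
  assumes q: "smooth_on (-{0}) q" "\<And>c x. c > 0 \<Longrightarrow> q (c *\<^sub>R x) = q x" and y: "y \<noteq> 0" and pos: "q y > 0"
  obtains D where "(radial_map q has_derivative D) (at y)"
    "det (matrix D) = q y ^ CARD('n) * H (sgn y) * hess_det H (sgn y)"
proof -
  define u where "u = sgn y"
  have u: "norm u = 1" "u \<noteq> 0" using y by (auto simp: u_def norm_sgn sgn_zero_iff)
  have yu: "y = norm y *\<^sub>R u" using y by (simp add: u_def sgn_div_norm)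
  have dq: "(q has_derivative frechet_derivative q (at y)) (at y)"
    using smooth_on_has_derivative[OF q(1), of y] y by (simp add: at_within_punctured)
  define g where "g = (\<Sum>b\<in>Basis. frechet_derivative q (at y) b *\<^sub>R b)"
  have "frechet_derivative q (at y) = (\<lambda>v. g \<bullet> v)"
    unfolding g_def using linear_functional_eq_inner[OF has_derivative_linear[OF dq]] by blast
  with dq have dg: "(q has_derivative (\<lambda>v. g \<bullet> v)) (at y)" by simp
  have "((\<lambda>c. q (c *\<^sub>R y)) has_derivative (\<lambda>c. g \<bullet> (c *\<^sub>R y))) (at 1)"
    by (rule has_derivative_compose[OF bounded_linear_imp_has_derivative[OF bounded_linear_scaleR_left]])
      (simp add: dg)
  moreover have "((\<lambda>c. q (c *\<^sub>R y)) has_derivative (\<lambda>c. 0)) (at (1::real))"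
    by (rule has_derivative_transform_within_open[of "\<lambda>_. q y" _ _ UNIV "{0<..}"]) (auto simp: q(2))
  ultimately have "(\<lambda>c::real. g \<bullet> (c *\<^sub>R y)) = (\<lambda>c. 0)" by (rule has_derivative_unique)
  then have gy: "g \<bullet> y = 0" by (metis scaleR_one)
  then have gu: "g \<bullet> u = 0" by (simp add: u_def sgn_div_norm)
  \<comment> \<open>Collects the derivative of the norm, along \<open>u\<close>, and that of
    \<open>q\<close>, orthogonal to \<open>u\<close>; the differential becomes
    \<open>q y *\<^sub>R DX u + outer (X u) c\<close>, and only the normal part \<open>q y\<close>
    of \<open>c\<close> enters the determinant.\<close>
  define c where "c = norm y *\<^sub>R g + q y *\<^sub>R u"
  have cu: "c \<bullet> u = q y" using gu u(1) by (simp add: c_def inner_add_left norm_eq_1)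
  define D where "D = (\<lambda>v. (q y * norm y) *\<^sub>R (DX y *v v) + (q y * (v \<bullet> sgn y) + (g \<bullet> v) * norm y) *\<^sub>R X y)"
  have der: "(radial_map q has_derivative D) (at y)"
    unfolding radial_map_def[abs_def] D_def
    by (rule has_derivative_scaleR[OF has_derivative_mult[OF dg has_derivative_norm] X_derivative]) (use y in auto)
  have DXy: "norm y *\<^sub>R DX y = DX u" using DX_scaleR[of "norm y" u] yu y u by simp
  have "D v = (q y *\<^sub>R DX u + outer (X u) c) *v v" for v
    using X_sgn[OF y] unfolding D_def DXy[symmetric]
    by (simp add: matrix_vector_mult_add_rdistrib c_def inner_add_left inner_add_right u_def inner_commute mult.commute
        flip: scaleR_matrix_vector_assoc)
  then have "D = (*v) (q y *\<^sub>R DX u + outer (X u) c)" by blast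
  then have mD: "matrix D = q y *\<^sub>R DX u + outer (X u) c" by simp
  have "q y * det (matrix D) = q y ^ CARD('n) * ((X u \<bullet> u) * (c \<bullet> u) * det (DX u + outer u u))"
    unfolding mD by (rule det_scaleR_rank_one_update[OF DX_kernel[OF u(2)] DX_transpose_kernel[OF u(2)] u(1)])
  then have "det (matrix D) = q y ^ CARD('n) * H u * hess_det H u"
    using pos cu X_inner[OF u(2)] hess_det_eq[OF u(1)] by simp
  then show thesis using that der by (simp add: u_def)
qed

end

section \<open>The volume inequality for two bodies and the volume formula\<close>

locale curved_body = smooth_body K for K :: "(real^'n) set" +
  assumes hess_det_pos: "norm u = 1 \<Longrightarrow> hess_det (support_fun K) u > 0"
begin

lemma radial_map_image:
  assumes q: "smooth_on (-{0}) q" "\<And>c x. c > 0 \<Longrightarrow> q (c *\<^sub>R x) = q x" "\<And>y. y \<noteq> 0 \<Longrightarrow> q y > 0"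
  defines "I \<equiv> (LINT u|sphere_measure. q u ^ CARD('n) * H u * hess_det H u)"
  shows "radial_map q ` punctured_ball \<in> lmeasurable"
    and "real CARD('n) * measure lebesgue (radial_map q ` punctured_ball) \<le> I"
    and "inj_on (radial_map q) punctured_ball \<Longrightarrow>
      real CARD('n) * measure lebesgue (radial_map q ` punctured_ball) = I"
proof -
  define F where "F = (\<lambda>u. q u ^ CARD('n) * H u * hess_det H u)"
  have cF: "continuous_on (sphere 0 1) F"
    unfolding F_def using continuous_H continuous_hess_det continuous_on_subset[OF smooth_on_continuous[OF q(1)], of "sphere 0 1"]
    by (intro continuous_intros) auto
  have "\<exists>D. (radial_map q has_derivative D) (at y) \<and> \<bar>det (matrix D)\<bar> = F (sgn y)" if y0: "y \<noteq> 0" for y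
  proof -
    obtain D where D: "(radial_map q has_derivative D) (at y)"
      "det (matrix D) = q y ^ CARD('n) * H (sgn y) * hess_det H (sgn y)"
      using radial_map_derivative[OF q(1,2) y0 q(3)[OF y0]] .
    have "q (sgn y) = q y" using q(2)[of "inverse (norm y)" y] that by (simp add: sgn_div_norm)
    moreover have "q y ^ CARD('n) * H (sgn y) * hess_det H (sgn y) > 0"
      using q(3)[OF y0] H_pos[of "sgn y"] hess_det_pos[of "sgn y"] y0 by (simp add: norm_sgn sgn_zero_iff)
    ultimately show ?thesis using D by (auto simp: F_def)
  qed
  then obtain D where D: "\<And>y. y \<noteq> 0 \<Longrightarrow> (radial_map q has_derivative D y) (at y)"
    "\<And>y. y \<noteq> 0 \<Longrightarrow> \<bar>det (matrix (D y))\<bar> = F (sgn y)" by metis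
  have S: "punctured_ball \<in> sets lebesgue" by simp
  have der: "(radial_map q has_derivative D y) (at y within punctured_ball)" if "y \<in> punctured_ball" for y
    by (rule has_derivative_at_withinI[OF D(1)]) (use that in auto)
  have eq: "(\<lambda>y. indicat_real punctured_ball y *\<^sub>R \<bar>det (matrix (D y))\<bar>) =
      (\<lambda>y. indicat_real punctured_ball y *\<^sub>R F (sgn y))"
  proof
    fix y show "indicat_real punctured_ball y *\<^sub>R \<bar>det (matrix (D y))\<bar> = indicat_real punctured_ball y *\<^sub>R F (sgn y)"
      by (cases "y = 0") (simp_all add: D(2))
  qed
  then have si: "set_integrable lebesgue punctured_ball (\<lambda>y. \<bar>det (matrix (D y))\<bar>)"
    using set_integrable_sgn[OF cF] by (simp add: set_integrable_def)
  have "(LINT y:punctured_ball|lebesgue. \<bar>det (matrix (D y))\<bar>) = (LINT y:punctured_ball|lebesgue. F (sgn y))"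
    using eq by (simp add: set_lebesgue_integral_def)
  then have I: "I = real CARD('n) * (LINT y:punctured_ball|lebesgue. \<bar>det (matrix (D y))\<bar>)"
    using integral_sphere_measure[OF cF] by (simp add: I_def F_def)
  show "radial_map q ` punctured_ball \<in> lmeasurable" by (rule image_lmeasurable[OF S der si])
  show "real CARD('n) * measure lebesgue (radial_map q ` punctured_ball) \<le> I"
    unfolding I by (intro mult_left_mono measure_image_le_set_integral[OF S der si]) auto
  show "real CARD('n) * measure lebesgue (radial_map q ` punctured_ball) = I"
    if "inj_on (radial_map q) punctured_ball"
    unfolding I by (intro arg_cong2[where f="(*)"] refl measure_image_eq_set_integral[OF S der si that])
qed

text \<open>The ray through \<open>z\<close> leaves \<open>K\<close> at some \<open>X u\<close>. The
  point \<open>q u *\<^sub>R X u\<close> lies on the supporting hyperplane of \<open>L\<close> with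
  normal \<open>u\<close>, so an interior point \<open>z\<close> of \<open>L\<close> comes before it
  on the ray and is covered.\<close>

lemma vol_le_integral:
  assumes "smooth_support L"
  shows "real CARD('n) * vol L \<le>
    (LINT u|sphere_measure. (support_fun L u / H u) ^ CARD('n) * H u * hess_det H u)"
proof -
  interpret L: smooth_support L by (rule assms)
  define q where "q x = L.H x / H x" for x
  have q: "smooth_on (-{0}) q" "\<And>c x. c > 0 \<Longrightarrow> q (c *\<^sub>R x) = q x" "\<And>y. y \<noteq> 0 \<Longrightarrow> q y > 0"
    unfolding q_def using L.H_pos H_pos
    by (auto intro!: smooth_on_divide L.smooth_H smooth_H simp: L.H_scaleR H_scaleR)
  have "interior L - {0} \<subseteq> radial_map q ` punctured_ball"
  proof
    fix z assume "z \<in> interior L - {0}"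
    then have z: "z \<in> interior L" "z \<noteq> 0" by auto
    obtain d where d: "d > 0" "0 + d *\<^sub>R z \<in> frontier K"
      using ray_to_frontier[OF bounded zero_interior z(2)] by metis
    then obtain u where u: "norm u = 1" "d *\<^sub>R z = X u" using frontier_point_is_X by auto
    have u0: "u \<noteq> 0" using u(1) by auto
    have zu: "d * (z \<bullet> u) = H u" using X_inner[OF u0] u(2) by (metis inner_scaleR_left)
    have lt: "z \<bullet> u < L.H u" by (rule L.inner_less_support[OF z(1) u0])
    have zpos: "z \<bullet> u > 0" using zu d(1) H_pos[OF u0] by (metis zero_less_mult_pos)
    \<comment> \<open>The norm of the preimage: the fraction of the way from the origin to the
      supporting hyperplane of \<open>L\<close>.\<close>
    define r where "r = (z \<bullet> u) / L.H u"
    have r: "0 < r" "r < 1" using zpos lt by (auto simp: r_def divide_less_eq)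
    have "radial_map q (r *\<^sub>R u) = (q u * r) *\<^sub>R X u"
      using r u q(2)[of r u] X_scaleR[of r u] u0 by (simp add: radial_map_def)
    also have "q u * r * d = 1" using zu zpos lt H_pos[OF u0] d by (simp add: q_def r_def field_simps)
    then have "(q u * r) *\<^sub>R X u = z" using u(2) by (simp flip: u(2))
    finally have "z = radial_map q (r *\<^sub>R u)" ..
    moreover have "r *\<^sub>R u \<in> punctured_ball" using r u u0 by simp
    ultimately show "z \<in> radial_map q ` punctured_ball" by blast
  qed
  then have "measure lebesgue (interior L - {0}) \<le> measure lebesgue (radial_map q ` punctured_ball)"
    by (intro measure_mono_fmeasurable radial_map_image(1)[OF q]) auto
  moreover have "measure lebesgue (interior L - {0}) = vol L"
    unfolding vol_def using measure_interior[OF L.bounded negligible_convex_frontier[OF L.convex]]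
    by (subst measure_Diff_null_set) auto
  ultimately have "real CARD('n) * vol L \<le> real CARD('n) * measure lebesgue (radial_map q ` punctured_ball)"
    by (simp add: mult_left_mono)
  also have "\<dots> \<le> (LINT u|sphere_measure. q u ^ CARD('n) * H u * hess_det H u)"
    by (rule radial_map_image(2)[OF q])
  finally show ?thesis by (simp add: q_def)
qed

text \<open>One inequality is the case \<open>L = K\<close>. For the other, the radial map with
  factor 1 is injective and, by convexity, stays inside \<open>K\<close>.\<close>

lemma vol_eq_integral:
  "real CARD('n) * vol K = (LINT u|sphere_measure. H u * hess_det H u)"
proof (rule antisym)
  have "smooth_support K" ..
  have eq: "(LINT u|sphere_measure. (H u / H u) ^ CARD('n) * H u * hess_det H u) = (LINT u|sphere_measure. H u * hess_det H u)"
    by (rule Bochner_Integration.integral_cong)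
      (use H_pos in \<open>force simp: space_sphere_measure\<close>)+
  then show "real CARD('n) * vol K \<le> (LINT u|sphere_measure. H u * hess_det H u)"
    using vol_le_integral[OF \<open>smooth_support K\<close>] by simp
  define R where "R = radial_map (\<lambda>_. 1)"
  have R: "R y = norm y *\<^sub>R X y" for y by (simp add: R_def radial_map_def)
  \<comment> \<open>Pairing the common image with \<open>y\<close> and using that \<open>X z\<close>
    lies in \<open>K\<close> bounds one norm by the other; the symmetric argument gives equality,
    and then the normals agree.\<close>
  have le: "norm y \<le> norm z" if "y \<noteq> 0" "z \<noteq> 0" "R y = R z" for y z
  proof -
    have "norm y * H y = (R y) \<bullet> y" unfolding R using X_inner[OF that(1)] by simp
    also have "\<dots> = norm z * (X z \<bullet> y)" using arg_cong[OF that(3), of "\<lambda>w. w \<bullet> y"] by (simp add: R)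
    also have "\<dots> \<le> norm z * H y" using H_upper[OF X_mem[OF that(2)]] by (intro mult_left_mono) auto
    finally show ?thesis using H_pos[OF that(1)] by simp
  qed
  have inj: "inj_on R punctured_ball"
  proof (rule inj_onI)
    fix y z assume yz: "y \<in> punctured_ball" "z \<in> punctured_ball" "R y = R z"
    then have n: "norm y = norm z" using le[of y z] le[of z y] by auto
    then have "X (sgn y) = X (sgn z)" using yz X_sgn by (auto simp: R)
    then have "sgn y = sgn z" using yz X_inj[of "sgn y" "sgn z"] by (auto simp: norm_sgn)
    then show "y = z" using n yz by (auto simp: sgn_div_norm)
  qed
  have "R ` punctured_ball \<subseteq> K"
  proof
    fix z assume "z \<in> R ` punctured_ball"
    then obtain y where "y \<in> punctured_ball" "z = R y" by blast
    then have y: "y \<noteq> 0" "norm y < 1" "z = norm y *\<^sub>R X y + (1 - norm y) *\<^sub>R 0" by (simp_all add: R)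
    then show "z \<in> K" using convexD[OF convex X_mem[OF y(1)], of 0 "norm y" "1 - norm y"] zero_interior interior_subset by auto
  qed
  then have "measure lebesgue (R ` punctured_ball) \<le> vol K"
    unfolding vol_def R_def
    by (intro measure_mono_fmeasurable lmeasurable_compact compact fmeasurableD radial_map_image(1)) auto
  then have "real CARD('n) * measure lebesgue (R ` punctured_ball) \<le> real CARD('n) * vol K" by (simp add: mult_left_mono)
  moreover have "real CARD('n) * measure lebesgue (R ` punctured_ball) = (LINT u|sphere_measure. H u * hess_det H u)"
    using radial_map_image(3)[of "\<lambda>_. 1"] inj by (simp add: R_def)
  ultimately show "(LINT u|sphere_measure. H u * hess_det H u) \<le> real CARD('n) * vol K" by simp
qed

end

section \<open>Differential operators on the sphere and their variation\<close>

text \<open>Nonlinear differential operators acting on functions on the sphere, which enter through their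
  extension that is constant along rays. Real powers are allowed for operators that are positive on
  the class \<open>\<A>\<close>.\<close>

inductive_set diff_op ::
    "(real^'n \<Rightarrow> real) set \<Rightarrow> ((real^'n \<Rightarrow> real) \<Rightarrow> real^'n \<Rightarrow> real) set"
  for \<A> :: "(real^'n \<Rightarrow> real) set" where
  base: "(\<lambda>h x. h (sgn x)) \<in> diff_op \<A>"
| coef: "smooth_on (-{0}) c \<Longrightarrow> (\<lambda>h. c) \<in> diff_op \<A>"
| add: "Q \<in> diff_op \<A> \<Longrightarrow> R \<in> diff_op \<A> \<Longrightarrow> (\<lambda>h x. Q h x + R h x) \<in> diff_op \<A>"
| mult: "Q \<in> diff_op \<A> \<Longrightarrow> R \<in> diff_op \<A> \<Longrightarrow> (\<lambda>h x. Q h x * R h x) \<in> diff_op \<A>"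
| dir: "Q \<in> diff_op \<A> \<Longrightarrow> (\<lambda>h x. frechet_derivative (Q h) (at x) b) \<in> diff_op \<A>"
| on_sphere: "Q \<in> diff_op \<A> \<Longrightarrow> (\<lambda>h x. Q h (sgn x)) \<in> diff_op \<A>"
| powr: "Q \<in> diff_op \<A> \<Longrightarrow> (\<And>h x. h \<in> \<A> \<Longrightarrow> x \<noteq> 0 \<Longrightarrow> Q h x > 0) \<Longrightarrow>
    (\<lambda>h x. Q h x powr a) \<in> diff_op \<A>"

text \<open>The parameter set covers both uses: the half-open time interval of a flow and the open
  interval of a linear perturbation.\<close>

definition smooth_family :: "real set \<Rightarrow> (real \<Rightarrow> real^'n \<Rightarrow> real) \<Rightarrow> bool" where
  "smooth_family J h \<longleftrightarrow> convex J \<and> thick J \<and> smooth_on ((-{0}) \<times> J) (\<lambda>(x, t). h t (sgn x))"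

lemma thick_islimpt: "thick J \<Longrightarrow> t \<in> J \<Longrightarrow> t islimpt (J :: real set)"
  unfolding thick_def islimpt_approachable
proof (intro allI impI)
  fix e :: real assume "\<forall>x\<in>J. \<forall>i\<in>Basis. \<forall>e>0. \<exists>d. 0 < \<bar>d\<bar> \<and> \<bar>d\<bar> < e \<and> x + d *\<^sub>R i \<in> J" "t \<in> J" "0 < e"
  then obtain d where "0 < \<bar>d\<bar>" "\<bar>d\<bar> < e" "t + d *\<^sub>R 1 \<in> J" by (metis Basis_real_def singletonI)
  then show "\<exists>x'\<in>J. x' \<noteq> t \<and> dist x' t < e"
    by (intro bexI[of _ "t + d *\<^sub>R 1"]) (auto simp: dist_real_def)
qed

lemma has_real_derivative_unique_thick:
  assumes "thick J" "t \<in> J" "(f has_real_derivative a) (at t within J)" "(f has_real_derivative b) (at t within J)"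
  shows "a = b"
proof -
  have "(\<lambda>v. a * v) = (\<lambda>v. b * v)"
    using assms by (intro frechet_derivative_unique_within[of f _ t J])
      (auto simp: has_field_derivative_def thick_def)
  then show ?thesis by (metis mult.right_neutral)
qed

section \<open>Partial derivatives of functions of space and time\<close>

context
  fixes J :: "real set" and F :: "(real^'n) \<times> real \<Rightarrow> real"
  assumes F: "smooth_on ((-{0}) \<times> J) F"
begin

abbreviation dF where "dF z \<equiv> frechet_derivative F (at z within (-{0}) \<times> J)"

lemma slice_space:
  assumes "x \<noteq> 0" "t \<in> J"
  shows "((\<lambda>y. F (y, t)) has_derivative (\<lambda>v. dF (x, t) (v, 0))) (at x)"
proof -
  have D: "(F has_derivative dF (x, t)) (at (x, t) within (-{0}) \<times> J)"
    using assms by (intro smooth_on_has_derivative[OF F]) auto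
  have "((\<lambda>y. (y, t)) has_derivative (\<lambda>v. (v, 0))) (at x within -{0})"
    by (intro has_derivative_Pair has_derivative_ident has_derivative_const)
  from has_derivative_in_compose[OF this has_derivative_subset[OF D]]
  have "((\<lambda>y. F (y, t)) has_derivative (\<lambda>v. dF (x, t) (v, 0))) (at x within -{0})"
    using assms by (auto simp: image_subset_iff)
  moreover have "at x within -{0} = at x" using assms by (intro at_within_open) auto
  ultimately show ?thesis by simp
qed

lemma slice_time:
  assumes "x \<noteq> 0" "t \<in> J"
  shows "((\<lambda>s. F (x, s)) has_real_derivative dF (x, t) (0, 1)) (at t within J)"
proof -
  have D: "(F has_derivative dF (x, t)) (at (x, t) within (-{0}) \<times> J)"
    using assms by (intro smooth_on_has_derivative[OF F]) auto
  have "((\<lambda>s. (x, s)) has_derivative (\<lambda>v. (0, v))) (at t within J)"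
    by (intro has_derivative_Pair has_derivative_ident has_derivative_const)
  from has_derivative_in_compose[OF this has_derivative_subset[OF D]]
  have "((\<lambda>s. F (x, s)) has_derivative (\<lambda>v. dF (x, t) (0, v))) (at t within J)"
    using assms by (auto simp: image_subset_iff)
  moreover have "v * dF (x, t) (0, 1) = dF (x, t) (0, v)" for v
    using linear_cmul[OF has_derivative_linear[OF D], of v "(0, 1)"] by simp
  ultimately show ?thesis by (rule has_derivative_imp_has_field_derivative)
qed

lemma slice_line:
  assumes "x + s *\<^sub>R b \<noteq> 0" "t \<in> J"
  shows "((\<lambda>s. F (x + s *\<^sub>R b, t)) has_real_derivative dF (x + s *\<^sub>R b, t) (b, 0)) (at s within I)"
proof -
  have 1: "((\<lambda>s. x + s *\<^sub>R b) has_derivative (\<lambda>s. s *\<^sub>R b)) (at s)"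
    by (auto intro!: derivative_eq_intros)
  note D = slice_space[OF assms]
  have "((\<lambda>s. F (x + s *\<^sub>R b, t)) has_derivative (\<lambda>v. dF (x + s *\<^sub>R b, t) (v *\<^sub>R b, 0))) (at s)"
    by (rule has_derivative_compose[OF 1 D])
  moreover have "v * dF (x + s *\<^sub>R b, t) (b, 0) = dF (x + s *\<^sub>R b, t) (v *\<^sub>R b, 0)" for v
    using linear_cmul[OF has_derivative_linear[OF D], of v b] by simp
  ultimately have "((\<lambda>s. F (x + s *\<^sub>R b, t)) has_real_derivative dF (x + s *\<^sub>R b, t) (b, 0)) (at s)"
    by (rule has_derivative_imp_has_field_derivative)
  then show ?thesis by (rule has_field_derivative_at_within)
qed

end

lemma space_time_derivatives_commute:
  fixes G :: "(real^'n) \<times> real \<Rightarrow> real" and b x :: "real^'n"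
  assumes J: "convex J" "thick J" and G: "smooth_on ((-{0}) \<times> J) G" and xt: "x \<noteq> 0" "t \<in> J"
  defines "W \<equiv> (-{0}) \<times> J"
  defines "A \<equiv> \<lambda>z. frechet_derivative G (at z within W) (b, 0)"
  defines "B \<equiv> \<lambda>z. frechet_derivative G (at z within W) (0, 1)"
  shows "frechet_derivative A (at (x, t) within W) (0, 1) = frechet_derivative B (at (x, t) within W) (b, 0)"
proof -
  have thW: "thick W" unfolding W_def by (rule thick_Times[OF thick_open J(2)]) auto
  have sA: "smooth_on W A" and sB: "smooth_on W B"
    unfolding A_def B_def using G thW by (auto intro: smooth_on_frechet_derivative simp: W_def)
  \<comment> \<open>Keeps the segment \<open>x + s *\<^sub>R b\<close> away from the origin; the
    summand 1 allows \<open>b = 0\<close>.\<close>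
  define e where "e = norm x / (norm b + 1)"
  have e: "e > 0" using xt by (simp add: e_def add_nonneg_pos)
  define I where "I = {-e<..<e}"
  have nz: "x + s *\<^sub>R b \<noteq> 0" if "s \<in> I" for s
  proof
    assume "x + s *\<^sub>R b = 0"
    then have "norm x = \<bar>s\<bar> * norm b" by (metis add_eq_0_iff norm_minus_cancel norm_scaleR)
    also have "\<dots> \<le> e * norm b" using that by (intro mult_right_mono) (auto simp: I_def)
    also have "\<dots> < e * (norm b + 1)" using e by simp
    also have "\<dots> = norm x" by (simp add: e_def add_nonneg_eq_0_iff)
    finally show False by simp
  qed
  have I: "convex I" "0 \<in> I" "0 islimpt I"
    using e by (auto simp: I_def intro: thick_islimpt[OF thick_open])
  have cont: "continuous_on (I \<times> J) (\<lambda>(s, r). f (x + s *\<^sub>R b, r))" if "continuous_on W f" for f :: "(real^'n) \<times> real \<Rightarrow> real"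
    unfolding split_def
    by (rule continuous_on_compose2[OF that]) (use nz in \<open>auto simp: W_def intro!: continuous_intros\<close>)
  have dc: "continuous_on W (\<lambda>z. frechet_derivative f (at z within W) v)" if "smooth_on W f" for f :: "_ \<Rightarrow> real" and v
    by (intro smooth_on_continuous smooth_on_frechet_derivative that thW)
  have "frechet_derivative A (at (x + 0 *\<^sub>R b, t) within W) (0, 1) =
        frechet_derivative B (at (x + 0 *\<^sub>R b, t) within W) (b, 0)"
  proof (rule mixed_partials_commute[OF I J(1) xt(2) thick_islimpt[OF J(2) xt(2)],
        where G="\<lambda>s r. G (x + s *\<^sub>R b, r)" and Gs="\<lambda>s r. A (x + s *\<^sub>R b, r)" and Gt="\<lambda>s r. B (x + s *\<^sub>R b, r)"
        and Gst="\<lambda>s r. frechet_derivative A (at (x + s *\<^sub>R b, r) within W) (0, 1)"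
        and Gts="\<lambda>s r. frechet_derivative B (at (x + s *\<^sub>R b, r) within W) (b, 0)"])
    fix s r assume sr: "s \<in> I" "r \<in> J"
    show "((\<lambda>s. G (x + s *\<^sub>R b, r)) has_real_derivative A (x + s *\<^sub>R b, r)) (at s within I)"
      unfolding A_def W_def by (rule slice_line[OF G nz[OF sr(1)] sr(2)])
    show "((\<lambda>t. G (x + s *\<^sub>R b, t)) has_real_derivative B (x + s *\<^sub>R b, r)) (at r within J)"
      unfolding B_def W_def by (rule slice_time[OF G nz[OF sr(1)] sr(2)])
    show "((\<lambda>t. A (x + s *\<^sub>R b, t)) has_real_derivative
        frechet_derivative A (at (x + s *\<^sub>R b, r) within W) (0, 1)) (at r within J)"
      unfolding W_def by (rule slice_time[OF sA[unfolded W_def] nz[OF sr(1)] sr(2)])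
    show "((\<lambda>s. B (x + s *\<^sub>R b, r)) has_real_derivative
        frechet_derivative B (at (x + s *\<^sub>R b, r) within W) (b, 0)) (at s within I)"
      unfolding W_def by (rule slice_line[OF sB[unfolded W_def] nz[OF sr(1)] sr(2)])
  qed (use cont[OF dc[OF sA]] cont[OF dc[OF sB]] in auto)
  then show ?thesis by simp
qed

text \<open>The velocity is prescribed at one time and on unit vectors only: the linear perturbation
  in \<open>flow_variation\<close> has the velocity of the flow just at parameter 0.\<close>

definition moves ::
    "((real^'n \<Rightarrow> real) \<Rightarrow> real^'n \<Rightarrow> real) \<Rightarrow> real set \<Rightarrow> (real \<Rightarrow> real^'n \<Rightarrow> real) \<Rightarrow> real \<Rightarrow> bool" where
  "moves V J h t \<longleftrightarrow> t \<in> J \<and>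
     (\<forall>u. norm u = 1 \<longrightarrow> ((\<lambda>s. h s u) has_real_derivative V (h t) u) (at t within J))"

text \<open>The operator \<open>Q'\<close> is the same for all families, which is what makes flows
  and linear perturbations interchangeable. Joint smoothness is part of the notion because
  differentiating in a spatial direction needs it.\<close>

definition evolves ::
    "(real^'n \<Rightarrow> real) set \<Rightarrow> ((real^'n \<Rightarrow> real) \<Rightarrow> real^'n \<Rightarrow> real) \<Rightarrow>
     ((real^'n \<Rightarrow> real) \<Rightarrow> real^'n \<Rightarrow> real) \<Rightarrow> ((real^'n \<Rightarrow> real) \<Rightarrow> real^'n \<Rightarrow> real) \<Rightarrow> bool" where
  "evolves \<A> V Q Q' \<longleftrightarrow> (\<forall>J h. smooth_family J h \<longrightarrow> h ` J \<subseteq> \<A> \<longrightarrow>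
     smooth_on ((-{0}) \<times> J) (\<lambda>(x, t). Q (h t) x) \<and>
     (\<forall>t x. moves V J h t \<longrightarrow> x \<noteq> 0 \<longrightarrow> ((\<lambda>s. Q (h s) x) has_real_derivative Q' (h t) x) (at t within J)))"

lemma evolvesI:
  assumes "\<And>J h. smooth_family J h \<Longrightarrow> h ` J \<subseteq> \<A> \<Longrightarrow> smooth_on ((-{0}) \<times> J) (\<lambda>(x, t). Q (h t) x)"
    and "\<And>J h t x. smooth_family J h \<Longrightarrow> h ` J \<subseteq> \<A> \<Longrightarrow> moves V J h t \<Longrightarrow> x \<noteq> 0 \<Longrightarrow>
      ((\<lambda>s. Q (h s) x) has_real_derivative Q' (h t) x) (at t within J)"
  shows "evolves \<A> V Q Q'"
  unfolding evolves_def by (intro allI impI conjI) (rule assms; assumption)+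

lemma
  assumes "evolves \<A> V Q Q'" "smooth_family J h" "h ` J \<subseteq> \<A>"
  shows evolves_smooth: "smooth_on ((-{0}) \<times> J) (\<lambda>(x, t). Q (h t) x)"
    and evolves_deriv: "moves V J h t \<Longrightarrow> x \<noteq> 0 \<Longrightarrow>
      ((\<lambda>s. Q (h s) x) has_real_derivative Q' (h t) x) (at t within J)"
proof -
  note * = assms(1)[unfolded evolves_def, rule_format, OF assms(2,3)]
  show "smooth_on ((-{0}) \<times> J) (\<lambda>(x, t). Q (h t) x)" using * by (rule conjunct1)
  show "moves V J h t \<Longrightarrow> x \<noteq> 0 \<Longrightarrow>
      ((\<lambda>s. Q (h s) x) has_real_derivative Q' (h t) x) (at t within J)"
    by (rule conjunct2[OF *, rule_format])
qed

lemma evolves_add: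
  assumes "evolves \<A> V Q Q'" "evolves \<A> V R R'"
  shows "evolves \<A> V (\<lambda>h x. Q h x + R h x) (\<lambda>h x. Q' h x + R' h x)"
proof (rule evolvesI)
  fix J h assume h: "smooth_family J h" "h ` J \<subseteq> \<A>"
  show "smooth_on ((-{0}) \<times> J) (\<lambda>(x, t). Q (h t) x + R (h t) x)"
    using smooth_on_add[OF evolves_smooth[OF assms(1) h] evolves_smooth[OF assms(2) h]] by (simp add: split_def)
qed (intro DERIV_add evolves_deriv[OF assms(1)] evolves_deriv[OF assms(2)])

lemma evolves_mult:
  assumes "evolves \<A> V Q Q'" "evolves \<A> V R R'"
  shows "evolves \<A> V (\<lambda>h x. Q h x * R h x) (\<lambda>h x. Q' h x * R h x + R' h x * Q h x)"
proof (rule evolvesI)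
  fix J h assume h: "smooth_family J h" "h ` J \<subseteq> \<A>"
  show "smooth_on ((-{0}) \<times> J) (\<lambda>(x, t). Q (h t) x * R (h t) x)"
    using smooth_on_mult[OF evolves_smooth[OF assms(1) h] evolves_smooth[OF assms(2) h]] by (simp add: split_def)
qed (intro DERIV_mult evolves_deriv[OF assms(1)] evolves_deriv[OF assms(2)])

lemma evolves_on_sphere:
  fixes \<A> :: "(real^'n \<Rightarrow> real) set"
  assumes "evolves \<A> V Q Q'"
  shows "evolves \<A> V (\<lambda>h x. Q h (sgn x)) (\<lambda>h x. Q' h (sgn x))"
proof (rule evolvesI)
  fix J h assume h: "smooth_family J h" "h ` J \<subseteq> \<A>"
  have "smooth_on ((-{0}) \<times> J) (\<lambda>z :: (real^'n) \<times> real. (sgn (fst z), snd z))"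
    by (intro smooth_on_Pair smooth_on_compose[OF smooth_on_sgn smooth_on_bounded_linear[OF bounded_linear_fst]]
        smooth_on_bounded_linear[OF bounded_linear_snd]) auto
  from smooth_on_compose[OF evolves_smooth[OF assms h] this]
  show "smooth_on ((-{0}) \<times> J) (\<lambda>(x, t). Q (h t) (sgn x))"
    by (auto simp: split_def sgn_zero_iff image_subset_iff)
next
  fix J h t and x :: "real^'n" assume "smooth_family J h" "h ` J \<subseteq> \<A>" "moves V J h t" "x \<noteq> 0"
  then show "((\<lambda>s. Q (h s) (sgn x)) has_real_derivative Q' (h t) (sgn x)) (at t within J)"
    by (intro evolves_deriv[OF assms]) (auto simp: sgn_zero_iff)
qed

lemma evolves_powr:
  fixes \<A> :: "(real^'n \<Rightarrow> real) set"
  assumes "evolves \<A> V Q Q'" and pos: "\<And>h x. h \<in> \<A> \<Longrightarrow> x \<noteq> 0 \<Longrightarrow> Q h x > 0"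
  shows "evolves \<A> V (\<lambda>h x. Q h x powr a) (\<lambda>h x. (a * Q h x powr (a - 1)) * Q' h x)"
proof (rule evolvesI)
  fix J h assume h: "smooth_family J h" "h ` J \<subseteq> \<A>"
  have "smooth_on ((-{0}) \<times> J) (\<lambda>z. (\<lambda>(x, t). Q (h t) x) z powr a)"
    by (rule smooth_on_powr[OF evolves_smooth[OF assms(1) h]]) (use pos h in auto)
  then show "smooth_on ((-{0}) \<times> J) (\<lambda>(x, t). Q (h t) x powr a)" by (simp add: split_def)
next
  fix J h t and x :: "real^'n" assume h: "smooth_family J h" "h ` J \<subseteq> \<A>" "moves V J h t" "x \<noteq> 0"
  then have "Q (h t) x > 0" using pos by (auto simp: moves_def)
  from DERIV_chain'[OF evolves_deriv[OF assms(1) h] has_real_derivative_powr[OF this, of a]]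
  show "((\<lambda>s. Q (h s) x powr a) has_real_derivative (a * Q (h t) x powr (a - 1)) * Q' (h t) x) (at t within J)"
    by (simp add: mult.commute)
qed

lemma evolves_dir:
  fixes \<A> :: "(real^'n \<Rightarrow> real) set"
  assumes ev: "evolves \<A> V Q Q'"
  shows "evolves \<A> V (\<lambda>h x. frechet_derivative (Q h) (at x) b) (\<lambda>h x. frechet_derivative (Q' h) (at x) b)"
proof (rule evolvesI)
  fix J h assume h: "smooth_family J h" "h ` J \<subseteq> \<A>"
  have J: "convex J" "thick J" using h(1) by (auto simp: smooth_family_def)
  define W where "W = (-{0 :: real^'n}) \<times> J"
  have thW: "thick W" unfolding W_def by (rule thick_Times[OF thick_open J(2)]) auto
  define G where "G = (\<lambda>(x, t). Q (h t) x)"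
  have sG: "smooth_on W G" using evolves_smooth[OF ev h] by (simp add: G_def W_def)
  define A where "A = (\<lambda>z. frechet_derivative G (at z within W) (b, 0))"
  define B where "B = (\<lambda>z. frechet_derivative G (at z within W) (0, 1))"
  have sA: "smooth_on W A" and sB: "smooth_on W B"
    unfolding A_def B_def by (intro smooth_on_frechet_derivative sG thW)+
  have A: "frechet_derivative (Q (h t)) (at x) b = A (x, t)" if "t \<in> J" "x \<noteq> 0" for x t
    using fun_cong[OF frechet_derivative_at[OF slice_space[OF sG[unfolded W_def] that(2,1)]], of b]
    by (simp add: G_def A_def W_def)
  show "smooth_on ((-{0}) \<times> J) (\<lambda>(x, t). frechet_derivative (Q (h t)) (at x) b)"
    unfolding W_def[symmetric] 
  proof (rule smooth_on_cong[OF _ sA])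
    fix z assume "z \<in> W"
    then have "fst z \<noteq> 0" "snd z \<in> J" by (auto simp: W_def)
    then show "A z = (\<lambda>(x, t). frechet_derivative (Q (h t)) (at x) b) z" by (simp add: A split_def)
  qed
  fix t and x :: "real^'n" assume moves: "moves V J h t" and x: "x \<noteq> 0"
  then have t: "t \<in> J" by (simp add: moves_def)
  \<comment> \<open>The velocity is known at the single time \<open>t\<close> but at every point of
    space, so \<open>Q' (h t)\<close> is identified with the time derivative on the whole punctured
    space and may be differentiated in \<open>x\<close>.\<close>
  have B: "Q' (h t) y = B (y, t)" if y: "y \<noteq> 0" for y
    using has_real_derivative_unique_thick[OF J(2) t evolves_deriv[OF ev h moves y]]
      slice_time[OF sG[unfolded W_def] y t] by (simp add: B_def G_def W_def)
  have "((\<lambda>y. B (y, t)) has_derivative (\<lambda>v. frechet_derivative B (at (x, t) within W) (v, 0))) (at x)"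
    using slice_space[OF sB[unfolded W_def] x t] by (simp add: W_def)
  then have "(Q' (h t) has_derivative (\<lambda>v. frechet_derivative B (at (x, t) within W) (v, 0))) (at x)"
    by (rule has_derivative_transform_within_open[of _ _ _ _ "-{0}"]) (use x B in auto)
  from fun_cong[OF frechet_derivative_at[OF this], of b]
  have "frechet_derivative (Q' (h t)) (at x) b = frechet_derivative B (at (x, t) within W) (b, 0)" by simp
  also have "\<dots> = frechet_derivative A (at (x, t) within W) (0, 1)"
    unfolding A_def B_def W_def
    by (rule space_time_derivatives_commute[OF J sG[unfolded W_def] x t, symmetric])
  finally have eq: "frechet_derivative (Q' (h t)) (at x) b = frechet_derivative A (at (x, t) within W) (0, 1)" .
  have "((\<lambda>s. A (x, s)) has_real_derivative frechet_derivative (Q' (h t)) (at x) b) (at t within J)"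
    unfolding eq using slice_time[OF sA[unfolded W_def] x t] by (simp add: W_def)
  then show "((\<lambda>s. frechet_derivative (Q (h s)) (at x) b) has_real_derivative
      frechet_derivative (Q' (h t)) (at x) b) (at t within J)"
    by (rule has_field_derivative_transform_within[OF _ zero_less_one t]) (use A x in auto)
qed

proposition diff_op_evolution:
  assumes V: "V \<in> diff_op \<A>" and Q: "Q \<in> diff_op \<A>"
  shows "\<exists>Q'\<in>diff_op \<A>. evolves \<A> V Q Q'"
  using Q
proof induction
  case base
  \<comment> \<open>The velocity is only prescribed on unit vectors, hence
    \<open>V h (sgn x)\<close> and not \<open>V h x\<close>.\<close>
  have "evolves \<A> V (\<lambda>h x. h (sgn x)) (\<lambda>h x. V h (sgn x))"
    by (rule evolvesI) (simp_all add: smooth_family_def moves_def norm_sgn)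
  then show ?case using diff_op.on_sphere[OF V] by blast
next
  case (coef c)
  have "smooth_on ((-{0}) \<times> J) (\<lambda>(x, t). c x)" for J :: "real set"
    unfolding split_def
    by (rule smooth_on_compose[OF coef smooth_on_bounded_linear[OF bounded_linear_fst]]) auto
  then have "evolves \<A> V (\<lambda>h. c) (\<lambda>h x. 0)" by (intro evolvesI) auto
  then show ?case using diff_op.coef[OF smooth_on_const] by blast
next
  case (add Q R)
  then obtain Q' R' where *: "Q' \<in> diff_op \<A>" "R' \<in> diff_op \<A>" "evolves \<A> V Q Q'" "evolves \<A> V R R'" by blast
  show ?case using evolves_add[OF *(3,4)] diff_op.add[OF *(1,2)] by blast
next
  case (mult Q R)
  then obtain Q' R' where *: "Q' \<in> diff_op \<A>" "R' \<in> diff_op \<A>" "evolves \<A> V Q Q'" "evolves \<A> V R R'" by blast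
  have "(\<lambda>h x. Q' h x * R h x + R' h x * Q h x) \<in> diff_op \<A>"
    by (intro diff_op.add diff_op.mult * mult.hyps)
  then show ?case using evolves_mult[OF *(3,4)] by blast
next
  case (on_sphere Q)
  then obtain Q' where *: "Q' \<in> diff_op \<A>" "evolves \<A> V Q Q'" by blast
  show ?case using evolves_on_sphere[OF *(2)] diff_op.on_sphere[OF *(1)] by blast
next
  case (powr Q a)
  then obtain Q' where *: "Q' \<in> diff_op \<A>" "evolves \<A> V Q Q'" by blast
  have "(\<lambda>h x. (a * Q h x powr (a - 1)) * Q' h x) \<in> diff_op \<A>"
    by (intro diff_op.mult diff_op.coef[of "\<lambda>_. a"] diff_op.powr * powr.hyps smooth_on_const)
  then show ?case using evolves_powr[OF *(2) powr.hyps(2)] by blast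
next
  case (dir Q b)
  then obtain Q' where *: "Q' \<in> diff_op \<A>" "evolves \<A> V Q Q'" by blast
  show ?case using evolves_dir[OF *(2)] diff_op.dir[OF *(1)] by blast
qed

text \<open>The smoothness half of \<open>evolves\<close> does not involve the velocity, so
  \<open>Q\<close> itself is put in that place.\<close>

lemma diff_op_smooth:
  assumes "Q \<in> diff_op \<A>" "smooth_family J h" "h ` J \<subseteq> \<A>"
  shows "smooth_on ((-{0}) \<times> J) (\<lambda>(x, t). Q (h t) x)"
  using diff_op_evolution[OF assms(1,1)] evolves_smooth[OF _ assms(2,3)] by blast

section \<open>The Hessian determinant as a differential operator\<close>

lemma diff_op_const: "(\<lambda>h x. c) \<in> diff_op \<A>"
  by (rule diff_op.coef[OF smooth_on_const])

lemma diff_op_sum: "(\<And>i. i \<in> I \<Longrightarrow> Q i \<in> diff_op \<A>) \<Longrightarrow> (\<lambda>h x. \<Sum>i\<in>I. Q i h x) \<in> diff_op \<A>"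
proof (induction I rule: infinite_finite_induct)
  case (insert i I)
  then have "(\<lambda>h x. Q i h x + (\<Sum>i\<in>I. Q i h x)) \<in> diff_op \<A>" by (intro diff_op.add) auto
  then show ?case using insert by simp
qed (simp_all add: diff_op_const)

lemma diff_op_prod: "(\<And>i. i \<in> I \<Longrightarrow> Q i \<in> diff_op \<A>) \<Longrightarrow> (\<lambda>h x. \<Prod>i\<in>I. Q i h x) \<in> diff_op \<A>"
proof (induction I rule: infinite_finite_induct)
  case (insert i I)
  then have "(\<lambda>h x. Q i h x * (\<Prod>i\<in>I. Q i h x)) \<in> diff_op \<A>" by (intro diff_op.mult) auto
  then show ?case using insert by simp
qed (simp_all add: diff_op_const)

lemma diff_op_power: "Q \<in> diff_op \<A> \<Longrightarrow> (\<lambda>h x. Q h x ^ m) \<in> diff_op \<A>"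
  using diff_op_prod[of "{..<m}" "\<lambda>_. Q"] by simp

lemma diff_op_det:
  assumes "\<And>i j. Q i j \<in> diff_op \<A>"
  shows "(\<lambda>h x. det (\<chi> i j. Q i j h x)) \<in> diff_op \<A>"
proof -
  have "(\<lambda>h x. \<Sum>p | p permutes UNIV. of_int (sign p) * (\<Prod>i\<in>UNIV. Q i (p i) h x)) \<in> diff_op \<A>"
    by (intro diff_op_sum diff_op.mult diff_op_const diff_op_prod assms)
  then show ?thesis by (simp add: det_def)
qed

definition tangent_proj :: "real^'n \<Rightarrow> real^'n \<Rightarrow> real^'n" where
  "tangent_proj x v = v - (v \<bullet> x) *\<^sub>R x"

text \<open>The tangent directions in \<open>hess_det\<close> depend on the point, while
  \<open>diff_op\<close> admits derivatives in constant directions only. The Hessian is therefore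
  expanded in coordinates, with the projections as smooth coefficients.\<close>

definition hess_op :: "(real^'n \<Rightarrow> real) \<Rightarrow> real^'n \<Rightarrow> real" where
  "hess_op h x = det (\<chi> i j.
     (\<Sum>k\<in>UNIV. \<Sum>l\<in>UNIV. (tangent_proj x (axis i 1) $ k * tangent_proj x (axis j 1) $ l) *
        frechet_derivative (\<lambda>y. frechet_derivative (\<lambda>z. h (sgn z)) (at y) (axis l 1)) (at x) (axis k 1))
     + (h (sgn x) * (tangent_proj x (axis i 1) \<bullet> tangent_proj x (axis j 1)) + x $ i * x $ j))"

lemma smooth_on_tangent_proj: "smooth_on S (\<lambda>x. tangent_proj x v)"
  unfolding tangent_proj_def
  by (intro smooth_on_diff smooth_on_scaleR smooth_on_inner smooth_on_const smooth_on_id)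

lemma hess_op_diff_op: "hess_op \<in> diff_op \<A>"
  unfolding hess_op_def[abs_def]
  by (intro diff_op_det diff_op.add diff_op_sum diff_op.mult[OF diff_op.coef diff_op.dir[OF diff_op.dir[OF diff_op.base]]]
      diff_op.mult[OF diff_op.base diff_op.coef] diff_op.coef smooth_on_mult smooth_on_component smooth_on_inner
      smooth_on_tangent_proj smooth_on_id)

lemma linear_cart_expansion:
  fixes f :: "real^'n \<Rightarrow> real"
  assumes "linear f"
  shows "f v = (\<Sum>k\<in>UNIV. v $ k * f (axis k 1))"
proof -
  have "f (\<Sum>k\<in>UNIV. v $ k *\<^sub>R axis k 1) = (\<Sum>k\<in>UNIV. v $ k * f (axis k 1))"
    using assms by (simp add: linear_sum linear_cmul)
  then show ?thesis using basis_expansion[of v] by (simp add: scalar_mult_eq_scaleR)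
qed

lemma sphere_hessian_expansion:
  fixes h :: "real^'n \<Rightarrow> real"
  assumes h: "smooth_on (-{0}) (\<lambda>x. h (sgn x))" and u: "u \<noteq> 0"
  shows "sphere_hessian h u v w = (\<Sum>k\<in>UNIV. \<Sum>l\<in>UNIV. (v $ k * w $ l) *
        frechet_derivative (\<lambda>y. frechet_derivative (\<lambda>z. h (sgn z)) (at y) (axis l 1)) (at u) (axis k 1))"
proof -
  define E where "E = (\<lambda>x. h (sgn x))"
  define A where "A = (\<lambda>l y. frechet_derivative E (at y) (axis l 1))"
  have at: "at y within -{0} = at y" if "y \<noteq> 0" for y :: "real^'n" using that by (intro at_within_open) auto
  have dE: "(E has_derivative frechet_derivative E (at y)) (at y)" if "y \<noteq> 0" for y
    using smooth_on_has_derivative[OF h, of y] that at[OF that] by (simp add: E_def)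
  have sA: "smooth_on (-{0}) (A l)" for l
    by (rule smooth_on_cong[OF _ smooth_on_frechet_derivative[OF h thick_open, of "axis l 1"]])
      (auto simp: A_def E_def at)
  have dA: "(A l has_derivative frechet_derivative (A l) (at u)) (at u)" for l
    using smooth_on_has_derivative[OF sA, of u l] u at[OF u] by simp
  have "((\<lambda>y. \<Sum>l\<in>UNIV. w $ l * A l y) has_derivative
      (\<lambda>v. \<Sum>l\<in>UNIV. w $ l * frechet_derivative (A l) (at u) v)) (at u)"
    by (intro has_derivative_sum has_derivative_mult_right dA)
  then have "((\<lambda>y. frechet_derivative E (at y) w) has_derivative
      (\<lambda>v. \<Sum>l\<in>UNIV. w $ l * frechet_derivative (A l) (at u) v)) (at u)"
  proof (rule has_derivative_transform_within_open[of _ _ _ _ "-{0}"])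
    fix y :: "real^'n" assume "y \<in> -{0}"
    then have "linear (frechet_derivative E (at y))" using has_derivative_linear[OF dE] by simp
    then show "(\<Sum>l\<in>UNIV. w $ l * A l y) = frechet_derivative E (at y) w"
      unfolding A_def by (rule linear_cart_expansion[symmetric])
  qed (use u in auto)
  from fun_cong[OF frechet_derivative_at[OF this], of v]
  have "sphere_hessian h u v w = (\<Sum>l\<in>UNIV. w $ l * frechet_derivative (A l) (at u) v)"
    by (simp add: sphere_hessian_def E_def o_def)
  also have "\<dots> = (\<Sum>l\<in>UNIV. w $ l * (\<Sum>k\<in>UNIV. v $ k * frechet_derivative (A l) (at u) (axis k 1)))"
    by (intro sum.cong refl arg_cong2[where f="(*)"] linear_cart_expansion[OF has_derivative_linear[OF dA]])
  also have "\<dots> = (\<Sum>l\<in>UNIV. \<Sum>k\<in>UNIV. (v $ k * w $ l) * frechet_derivative (A l) (at u) (axis k 1))"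
    by (simp add: sum_distrib_left mult_ac)
  also have "\<dots> = (\<Sum>k\<in>UNIV. \<Sum>l\<in>UNIV. (v $ k * w $ l) * frechet_derivative (A l) (at u) (axis k 1))"
    by (rule sum.swap)
  finally show ?thesis by (simp add: A_def E_def)
qed

lemma hess_op_eq:
  assumes "smooth_on (-{0}) (\<lambda>x. h (sgn x))" and u: "norm u = 1"
  shows "hess_op h u = hess_det h u"
proof -
  have "u \<noteq> 0" "sgn u = u" using u by (auto simp: sgn_div_norm)
  then show ?thesis
    by (simp add: hess_op_def hess_det_def tangent_det_def Let_def tangent_proj_def[symmetric]
        sphere_hessian_expansion[OF assms(1)] add.assoc)
qed

section \<open>Iterated variations along the flow\<close>

text \<open>Positivity of both quantities is what the real powers in speed and density require. No
  body is mentioned, since perturbed support functions are treated as plain functions.\<close>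

definition admissible :: "(real^'n \<Rightarrow> real) set" where
  "admissible = {h. smooth_on (-{0}) (\<lambda>x. h (sgn x)) \<and> (\<forall>u. norm u = 1 \<longrightarrow> h u > 0 \<and> hess_det h u > 0)}"

lemma norm_sgn_eq_1: "x \<noteq> 0 \<Longrightarrow> norm (sgn x) = 1"
  by (simp add: norm_sgn)

lemma admissibleD:
  assumes "h \<in> admissible"
  shows "smooth_on (-{0}) (\<lambda>x. h (sgn x))" "norm u = 1 \<Longrightarrow> h u > 0" "norm u = 1 \<Longrightarrow> hess_det h u > 0"
    "norm u = 1 \<Longrightarrow> hess_op h u = hess_det h u"
  using assms hess_op_eq by (auto simp: admissible_def)

definition flow_speed :: "real \<Rightarrow> (real^'n \<Rightarrow> real) \<Rightarrow> real^'n \<Rightarrow> real" where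
  "flow_speed p h u = p_speed CARD('n) p (h u) (curvature_of_support h u)"

text \<open>\<open>flow_speed\<close> rewritten inside \<open>diff_op\<close>: the curvature is the
  reciprocal of \<open>hess_op\<close>, so its power becomes one with the opposite exponent and no
  division remains.\<close>

definition speed_op :: "real \<Rightarrow> (real^'n \<Rightarrow> real) \<Rightarrow> real^'n \<Rightarrow> real" where
  "speed_op p h x = - sgn (p / (real CARD('n) + p)) *
     (h (sgn x) powr (- (real CARD('n) * (p - 1) / (real CARD('n) + p))) * hess_op h (sgn x) powr (- (p / (real CARD('n) + p))))"

definition density_op :: "real \<Rightarrow> (real^'n \<Rightarrow> real) \<Rightarrow> real^'n \<Rightarrow> real" where
  "density_op p h x = sgn (p / (real CARD('n) + p)) *
     ((hess_op h (sgn x) * h (sgn x) ^ (CARD('n) + 1)) powr (- (p / (real CARD('n) + p))) * (h (sgn x) * hess_op h (sgn x)))"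

lemma hess_op_on_sphere: "(\<lambda>h x. hess_op h (sgn x)) \<in> diff_op \<A>"
  by (rule diff_op.on_sphere[OF hess_op_diff_op])

lemma admissible_pos:
  assumes "h \<in> admissible" "x \<noteq> 0"
  shows "h (sgn x) > 0" "hess_op h (sgn x) > 0"
  using admissibleD(2-4)[OF assms(1) norm_sgn_eq_1[OF assms(2)]] by auto

lemma speed_op_diff_op: "speed_op p \<in> diff_op admissible"
proof -
  have 1: "(\<lambda>h x. h (sgn x) powr a) \<in> diff_op admissible" for a
    by (rule diff_op.powr[OF diff_op.base]) (rule admissible_pos)
  have 2: "(\<lambda>h x. hess_op h (sgn x) powr a) \<in> diff_op admissible" for a
    by (rule diff_op.powr[OF hess_op_on_sphere]) (rule admissible_pos)
  show ?thesis
    unfolding speed_op_def[abs_def] by (rule diff_op.mult[OF diff_op_const diff_op.mult[OF 1 2]])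
qed

lemma density_op_diff_op: "density_op p \<in> diff_op admissible"
proof -
  have 1: "(\<lambda>h x. hess_op h (sgn x) * h (sgn x) ^ m) \<in> diff_op admissible" for m
    by (rule diff_op.mult[OF hess_op_on_sphere diff_op_power[OF diff_op.base]])
  have 2: "(\<lambda>h x. (hess_op h (sgn x) * h (sgn x) ^ m) powr a) \<in> diff_op admissible" for m a
    by (rule diff_op.powr[OF 1]) (simp add: admissible_pos)
  show ?thesis
    unfolding density_op_def[abs_def]
    by (rule diff_op.mult[OF diff_op_const diff_op.mult[OF 2 diff_op.mult[OF diff_op.base hess_op_on_sphere]]])
qed

lemma inverse_powr: "(1 / t) powr b = t powr (- b)" if "t > 0" for t b :: real
  using that by (simp add: powr_divide powr_minus_divide)

lemma speed_op_sgn: "speed_op p h (sgn x) = speed_op p h x"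
proof -
  have "sgn (sgn x) = sgn x" by (cases "x = 0") (simp_all add: sgn_div_norm)
  then show ?thesis by (simp add: speed_op_def)
qed

lemma speed_op_eq:
  fixes h :: "real^'n \<Rightarrow> real"
  assumes h: "h \<in> admissible" and u: "norm u = 1"
  shows "speed_op p h u = flow_speed p h u"
proof -
  have "sgn u = u" using u by (simp add: sgn_div_norm)
  then show ?thesis
    using admissibleD(3,4)[OF h u]
    by (simp add: speed_op_def flow_speed_def p_speed_def curvature_of_support_eq inverse_powr)
qed

lemma density_op_eq:
  fixes h :: "real^'n \<Rightarrow> real"
  assumes h: "h \<in> admissible" and u: "norm u = 1"
  shows "density_op p h u = affine_density p h u"
proof -
  have su: "sgn u = u" using u by (simp add: sgn_div_norm)
  have pos: "h u > 0" "hess_det h u > 0" using admissibleD[OF h] u by auto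
  then have "(1 / (hess_det h u * h u ^ (CARD('n) + 1))) powr (p / (real CARD('n) + p)) =
      (hess_det h u * h u ^ (CARD('n) + 1)) powr (- (p / (real CARD('n) + p)))"
    by (intro inverse_powr) simp
  then show ?thesis
    using admissibleD(4)[OF h u] pos su
    by (simp add: density_op_def affine_density_def p_integrand_def curvature_of_support_eq)
qed

text \<open>The minimum of the slice at 0 is positive by compactness and serves as the tolerance for
  uniform continuity on a compact neighbourhood of the slice.\<close>

lemma positive_near_compact_slice:
  fixes F :: "'a::metric_space \<times> real \<Rightarrow> real"
  assumes S: "compact S" and F: "continuous_on (S \<times> UNIV) F" and pos: "\<And>u. u \<in> S \<Longrightarrow> F (u, 0) > 0"
  obtains e where "e > 0" "\<And>u s. u \<in> S \<Longrightarrow> \<bar>s\<bar> < e \<Longrightarrow> F (u, s) > 0"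
proof (cases "S = {}")
  case True
  then show thesis using that[of 1] by simp
next
  case False
  have "continuous_on S (\<lambda>u. F (u, 0))"
    by (rule continuous_on_compose2[OF F]) (auto intro!: continuous_intros)
  then obtain u0 where u0: "u0 \<in> S" "\<And>u. u \<in> S \<Longrightarrow> F (u0, 0) \<le> F (u, 0)"
    using continuous_attains_inf[OF S False] by blast
  have "uniformly_continuous_on (S \<times> {-1..1}) F"
    by (intro compact_uniformly_continuous continuous_on_subset[OF F] compact_Times S) auto
  then obtain d where d: "d > 0"
    "\<And>z z'. z \<in> S \<times> {-1..1} \<Longrightarrow> z' \<in> S \<times> {-1..1} \<Longrightarrow> dist z' z < d \<Longrightarrow> dist (F z') (F z) < F (u0, 0)"
    using pos[OF u0(1)] unfolding uniformly_continuous_on_def by blast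
  show thesis
  proof (rule that[of "min d 1"])
    show "min d 1 > 0" using d by simp
    fix u s assume u: "u \<in> S" and s: "\<bar>s\<bar> < min d 1"
    then have "(u, s) \<in> S \<times> {-1..1}" "(u, 0 :: real) \<in> S \<times> {-1..1}" "dist (u, s) (u, 0 :: real) < d"
      by (auto simp: dist_Pair_Pair dist_real_def)
    then have "dist (F (u, s)) (F (u, 0)) < F (u0, 0)" using d(2) by blast
    then show "F (u, s) > 0" using u0(2)[OF u] by (simp add: dist_real_def)
  qed
qed

lemma admissible_perturbation:
  fixes h :: "real^'n \<Rightarrow> real" and p :: real
  assumes h: "h \<in> admissible"
  defines "g \<equiv> \<lambda>s v. h v + s * flow_speed p h v"
  obtains e where "e > 0" "smooth_family {-e<..<e} g" "g ` {-e<..<e} \<subseteq> admissible"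
    "moves (flow_speed p) {-e<..<e} g 0"
proof -
  have sm: "smooth_on ((-{0}) \<times> (UNIV :: real set)) (\<lambda>z. f (fst z))" if "smooth_on (-{0}) f"
    for f :: "real^'n \<Rightarrow> real"
    by (rule smooth_on_compose[OF that smooth_on_bounded_linear[OF bounded_linear_fst]]) auto
  have thick_UNIV: "thick (UNIV :: real set)" by (rule thick_open) simp
  have "smooth_family UNIV (\<lambda>t. h)"
    unfolding smooth_family_def using sm[OF admissibleD(1)[OF h]] thick_UNIV by (simp add: split_def)
  from diff_op_smooth[OF speed_op_diff_op this]
  have "smooth_on ((-{0}) \<times> (UNIV :: real set)) (\<lambda>(x, t). speed_op p h x)" using h by auto
  then have "smooth_on ((-{0}) \<times> (UNIV :: real set)) (\<lambda>z. flow_speed p h (sgn (fst z)))"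
  proof (rule smooth_on_cong[rotated])
    fix z :: "(real^'n) \<times> real" assume "z \<in> (-{0}) \<times> UNIV"
    then have "norm (sgn (fst z)) = 1" by (intro norm_sgn_eq_1) auto
    from speed_op_eq[OF h this, of p]
    show "(\<lambda>(x, t). speed_op p h x) z = flow_speed p h (sgn (fst z))"
      by (simp add: split_def speed_op_sgn)
  qed
  then have "smooth_on ((-{0}) \<times> UNIV) (\<lambda>z. h (sgn (fst z)) + snd z * flow_speed p h (sgn (fst z)))"
    by (intro smooth_on_add smooth_on_mult sm[OF admissibleD(1)[OF h]]
        smooth_on_bounded_linear[OF bounded_linear_snd])
  then have gU: "smooth_on ((-{0}) \<times> UNIV) (\<lambda>(x, t). g t (sgn x))" by (simp add: g_def split_def)
  have fam: "smooth_family J g" if "convex J" "thick J" for J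
    unfolding smooth_family_def using that smooth_on_subset[OF gU, of "(-{0}) \<times> J"] by auto
  have sg: "smooth_on (-{0}) (\<lambda>x. g s (sgn x))" for s
    using smooth_on_compose[OF gU smooth_on_Pair[OF smooth_on_id smooth_on_const[of _ s]], of "-{0}"]
    by (simp add: image_subset_iff)
  \<comment> \<open>\<open>hess_op\<close> is polynomial in the derivatives, so it is an operator
    for the class of all functions; the family need not be admissible for this step.\<close>
  have "smooth_on ((-{0}) \<times> UNIV) (\<lambda>(x, t). hess_op (g t) x)"
    by (rule diff_op_smooth[OF hess_op_diff_op[of UNIV]]) (use fam[OF convex_UNIV thick_UNIV] in auto)
  then have c1: "continuous_on (sphere 0 1 \<times> UNIV) (\<lambda>(x, t). hess_op (g t) x)"
    by (intro continuous_on_subset[OF smooth_on_continuous]) auto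
  have c2: "continuous_on (sphere 0 1 \<times> UNIV) (\<lambda>(x, t). g t (sgn x))"
    by (intro continuous_on_subset[OF smooth_on_continuous[OF gU]]) auto
  have sgn1: "sgn u = u" if "norm u = 1" for u :: "real^'n" using that by (simp add: sgn_div_norm)
  have g0: "g 0 = h" by (simp add: g_def)
  obtain e1 where e1: "e1 > 0" "\<And>u s. norm u = 1 \<Longrightarrow> \<bar>s\<bar> < e1 \<Longrightarrow> hess_op (g s) u > 0"
    using positive_near_compact_slice[OF compact_sphere c1] admissibleD[OF h] by (auto simp: g0)
  obtain e2 where e2: "e2 > 0" "\<And>u s. norm u = 1 \<Longrightarrow> \<bar>s\<bar> < e2 \<Longrightarrow> g s u > 0"
    using positive_near_compact_slice[OF compact_sphere c2] admissibleD[OF h] by (auto simp: g0 sgn1)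
  define e where "e = min e1 e2"
  show thesis
  proof (rule that)
    show "e > 0" using e1 e2 by (simp add: e_def)
    show "smooth_family {-e<..<e} g" by (intro fam thick_open) auto
    show "g ` {-e<..<e} \<subseteq> admissible"
      using e1(2) e2(2) sg hess_op_eq[OF sg] by (auto simp: admissible_def e_def abs_less_iff)
    show "moves (flow_speed p) {-e<..<e} g 0"
      using \<open>e > 0\<close> unfolding moves_def g0 by (auto simp: g_def intro!: derivative_eq_intros)
  qed
qed

lemma moves_cong:
  assumes "moves V J h t" "\<And>u. norm u = 1 \<Longrightarrow> V (h t) u = V' (h t) u"
  shows "moves V' J h t"
  using assms by (simp add: moves_def)

text \<open>\<open>flow_variation\<close> differentiates along the linear family \<open>h + s V h\<close>, which has the same velocity at
  \<open>s = 0\<close> as the flow.\<close>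

proposition flow_variation_operators:
  obtains Q :: "nat \<Rightarrow> (real^'n \<Rightarrow> real) \<Rightarrow> real^'n \<Rightarrow> real" where
    "\<And>j. evolves admissible (speed_op p) (Q j) (Q (Suc j))"
    "\<And>j h u. h \<in> admissible \<Longrightarrow> norm u = 1 \<Longrightarrow> (flow_variation p ^^ j) (affine_density p) h u = Q j h u"
proof -
  have "\<forall>Q\<in>diff_op (admissible :: (real^'n \<Rightarrow> real) set). \<exists>Q'. Q' \<in> diff_op admissible \<and> evolves admissible (speed_op p) Q Q'"
    using diff_op_evolution[OF speed_op_diff_op] by blast
  \<comment> \<open>The derived operator is chosen as a function of the operator alone, so the
    choice can be iterated.\<close>
  from bchoice[OF this] obtain f where
    "\<forall>Q\<in>diff_op (admissible :: (real^'n \<Rightarrow> real) set). f Q \<in> diff_op admissible \<and> evolves admissible (speed_op p) Q (f Q)" ..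
  then have f: "\<And>Q. Q \<in> diff_op (admissible :: (real^'n \<Rightarrow> real) set) \<Longrightarrow> f Q \<in> diff_op admissible"
    "\<And>Q. Q \<in> diff_op (admissible :: (real^'n \<Rightarrow> real) set) \<Longrightarrow> evolves admissible (speed_op p) Q (f Q)" by blast+
  define Q :: "nat \<Rightarrow> (real^'n \<Rightarrow> real) \<Rightarrow> real^'n \<Rightarrow> real" where "Q j = (f ^^ j) (density_op p)" for j
  have Q: "Q j \<in> diff_op admissible" for j
    by (induction j) (simp_all add: Q_def density_op_diff_op f)
  then have ev: "evolves admissible (speed_op p) (Q j) (Q (Suc j))" for j
    using f(2)[OF Q[of j]] by (simp add: Q_def)
  have "(flow_variation p ^^ j) (affine_density p) h u = Q j h u" if "h \<in> admissible" "norm u = 1"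
    for j and h :: "real^'n \<Rightarrow> real" and u
    using that
  proof (induction j arbitrary: h u)
    case 0
    then show ?case by (simp add: Q_def density_op_eq)
  next
    case (Suc j)
    define g where "g = (\<lambda>s v. h v + s * flow_speed p h v)"
    obtain e where e: "e > 0" "smooth_family {-e<..<e} g" "g ` {-e<..<e} \<subseteq> admissible"
      "moves (flow_speed p) {-e<..<e} g 0"
      by (rule admissible_perturbation[OF Suc.prems(1), of p, folded g_def]) (rule that)
    have g0: "g 0 = h" by (simp add: g_def)
    have "moves (speed_op p) {-e<..<e} g 0"
      by (rule moves_cong[OF e(4)]) (simp add: g0 speed_op_eq[OF Suc.prems(1)])
    moreover have "u \<noteq> 0" using Suc.prems(2) by auto
    ultimately have "((\<lambda>s. Q j (g s) u) has_real_derivative Q (Suc j) (g 0) u) (at 0 within {-e<..<e})"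
      by (rule evolves_deriv[OF ev e(2,3)])
    then have "((\<lambda>s. Q j (g s) u) has_real_derivative Q (Suc j) h u) (at 0)"
      using e(1) at_within_open[of 0 "{-e<..<e}"] by (simp add: g0)
    \<comment> \<open>The induction hypothesis is needed at every \<open>g s\<close> with small
      \<open>s\<close>, not just at \<open>h\<close>; all of them are admissible.\<close>
    then have "((\<lambda>s. (flow_variation p ^^ j) (affine_density p) (g s) u) has_real_derivative Q (Suc j) h u) (at 0)"
      by (rule has_field_derivative_transform_within_open[of _ _ _ "{-e<..<e}"])
        (use e(1,3) Suc in \<open>auto simp: image_subset_iff\<close>)
    moreover have "(flow_variation p ^^ Suc j) (affine_density p) h u =
        deriv (\<lambda>s. (flow_variation p ^^ j) (affine_density p) (g s) u) 0"
      by (simp add: flow_variation_def[of p _ h u] g_def flow_speed_def)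
    ultimately show ?case by (simp only: DERIV_imp_deriv)
  qed
  with ev that show thesis by blast
qed

section \<open>The volume along the flow\<close>

text \<open>Dominated convergence along sequences of times. By the mean value theorem the difference
  quotients are bounded by the maximum of the time derivative over the sphere times a compact
  interval.\<close>

lemma integral_sphere_has_derivative:
  fixes g :: "real \<Rightarrow> real^'n \<Rightarrow> real"
  assumes g: "smooth_on ((-{0}) \<times> {0..<T}) (\<lambda>(x, t). g t x)" and t0: "t0 \<in> {0..<T}"
    and D: "\<And>u. norm u = 1 \<Longrightarrow> ((\<lambda>t. g t u) has_real_derivative D u) (at t0 within {0..<T})"
  shows "((\<lambda>t. integral\<^sup>L sphere_measure (g t)) has_real_derivative integral\<^sup>L sphere_measure D)
      (at t0 within {0..<T})"
proof -
  define J where "J = {0..<T}"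
  define W where "W = (-{0 :: real^'n}) \<times> J"
  have J: "convex J" "thick J" by (auto simp: J_def thick_atLeastLessThan)
  define B where "B = (\<lambda>z. frechet_derivative (\<lambda>(x, t). g t x) (at z within W) (0, 1))"
  have "thick W" unfolding W_def by (rule thick_Times[OF thick_open J(2)]) auto
  then have "smooth_on W B" unfolding B_def using g by (intro smooth_on_frechet_derivative) (auto simp: W_def J_def)
  then have cB: "continuous_on W B" by (rule smooth_on_continuous)
  have dB: "((\<lambda>s. g s u) has_real_derivative B (u, t)) (at t within J)" if "norm u = 1" "t \<in> J" for u t
    using slice_time[of J "\<lambda>(x, t). g t x" u t] g that by (force simp: B_def W_def J_def)
  have DB: "D u = B (u, t0)" if "norm u = 1" for u
    using has_real_derivative_unique_thick[OF J(2) _ D[OF that, folded J_def] dB[OF that]] t0 by (simp add: J_def)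
  have cg: "continuous_on (sphere 0 1) (g t)" if "t \<in> J" for t
    by (rule continuous_on_compose2[OF smooth_on_continuous[OF g], of _ "\<lambda>x. (x, t)", simplified])
      (use that in \<open>auto intro!: continuous_intros simp: J_def\<close>)
  have cD: "continuous_on (sphere 0 1) D"
  proof (rule continuous_on_eq)
    show "continuous_on (sphere 0 1) (\<lambda>u. B (u, t0))"
      by (rule continuous_on_compose2[OF cB]) (use t0 in \<open>auto intro!: continuous_intros simp: J_def W_def\<close>)
  qed (simp add: DB)
  \<comment> \<open>A compact interval that contains \<open>t0\<close> and, relative to the flow
    interval, a neighbourhood of it.\<close>
  define b where "b = (t0 + T) / 2"
  have b: "t0 < b" "b < T" using t0 by (auto simp: b_def field_simps)
  have bJ: "{0..b} \<subseteq> J" using b by (auto simp: J_def)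
  have "compact (B ` (sphere 0 1 \<times> {0..b}))"
    by (intro compact_continuous_image continuous_on_subset[OF cB] compact_Times compact_sphere)
      (use bJ in \<open>auto simp: W_def\<close>)
  then obtain M where M: "\<And>z. z \<in> sphere 0 1 \<times> {0..b} \<Longrightarrow> \<bar>B z\<bar> \<le> M"
    by (metis compact_imp_bounded bounded_iff image_eqI real_norm_def)
  have lip: "\<bar>(g t u - g t0 u) / (t - t0)\<bar> \<le> M" if u: "norm u = 1" and t: "t \<in> {0..b}" "t \<noteq> t0" for t u
  proof -
    obtain c where c: "c \<in> closed_segment t0 t" "g t u - g t0 u = (t - t0) * B (u, c)"
    proof -
      have "t0 \<in> J" "t \<in> J" using t(1) t0 bJ by (auto simp: J_def)
      from mvt_within[OF J(1) this dB[OF u]] that show thesis by metis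
    qed
    have "c \<in> {0..b}" using c(1) t t0 b by (auto simp: closed_segment_eq_real_ivl split: if_splits)
    then show ?thesis using M[of "(u, c)"] c(2) u t(2) by simp
  qed
  have within: "at t0 within {0..<T} = at t0 within {0..b}"
    by (rule at_within_nhd[of t0 "{..<b}"]) (use b in auto)
  have "((\<lambda>t. (integral\<^sup>L sphere_measure (g t) - integral\<^sup>L sphere_measure (g t0)) / (t - t0))
      \<longlongrightarrow> integral\<^sup>L sphere_measure D) (at t0 within {0..b})"
    unfolding tendsto_at_iff_sequentially
  proof (intro allI impI)
    fix s :: "nat \<Rightarrow> real" assume s: "\<forall>i. s i \<in> {0..b} - {t0}" "s \<longlonglongrightarrow> t0"
    have sJ: "s i \<in> J" "t0 \<in> J" for i
      using subsetD[OF bJ, of "s i"] s(1) t0 by (auto simp: J_def)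
    have "(\<lambda>i. integral\<^sup>L sphere_measure (\<lambda>u. (g (s i) u - g t0 u) / (s i - t0))) \<longlonglongrightarrow> integral\<^sup>L sphere_measure D"
    proof (rule integral_dominated_convergence[where w="\<lambda>_. M"])
      show "D \<in> borel_measurable sphere_measure" by (rule borel_measurable_sphere_measure[OF cD])
      show "(\<lambda>u. (g (s i) u - g t0 u) / (s i - t0)) \<in> borel_measurable sphere_measure" for i
        using s(1) by (intro borel_measurable_sphere_measure continuous_intros cg sJ) auto
      show "integrable sphere_measure (\<lambda>_. M)"
        by (intro integrable_sphere_measure continuous_intros)
      show "AE u in sphere_measure. (\<lambda>i. (g (s i) u - g t0 u) / (s i - t0)) \<longlonglongrightarrow> D u"
      proof (rule AE_I2)
        fix u :: "real^'n" assume "u \<in> space sphere_measure"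
        then have u: "norm u = 1" by (simp add: space_sphere_measure)
        have "((\<lambda>t. (g t u - g t0 u) / (t - t0)) \<longlongrightarrow> D u) (at t0 within {0..b})"
          using D[OF u] by (simp add: has_field_derivative_iff within)
        then show "(\<lambda>i. (g (s i) u - g t0 u) / (s i - t0)) \<longlonglongrightarrow> D u"
          using s unfolding tendsto_at_iff_sequentially o_def by blast
      qed
      show "AE u in sphere_measure. norm ((g (s i) u - g t0 u) / (s i - t0)) \<le> M" for i
        using s(1) lip by (intro AE_I2) (simp add: space_sphere_measure)
    qed
    moreover have "integral\<^sup>L sphere_measure (\<lambda>u. (g (s i) u - g t0 u) / (s i - t0)) =
        (integral\<^sup>L sphere_measure (g (s i)) - integral\<^sup>L sphere_measure (g t0)) / (s i - t0)" for i
      using integrable_sphere_measure[OF cg[OF sJ(1)]] integrable_sphere_measure[OF cg[OF sJ(2)]] by simp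
    ultimately show "((\<lambda>t. (integral\<^sup>L sphere_measure (g t) - integral\<^sup>L sphere_measure (g t0)) / (t - t0)) \<circ> s)
        \<longlonglongrightarrow> integral\<^sup>L sphere_measure D" unfolding o_def by (simp only:)
  qed
  then show ?thesis by (simp add: has_field_derivative_iff within)
qed

lemma has_real_derivative_sandwich:
  fixes f l u :: "real \<Rightarrow> real"
  assumes l: "(l has_real_derivative c) (at x within S)" and u: "(u has_real_derivative c) (at x within S)"
    and "l x = 0" "u x = 0"
    and bounds: "\<And>y. y \<in> S \<Longrightarrow> l y \<le> f y - f x" "\<And>y. y \<in> S \<Longrightarrow> f y - f x \<le> u y"
  shows "(f has_real_derivative c) (at x within S)"
  unfolding has_field_derivative_def has_derivative_within_alt
proof (intro conjI allI impI)
  show "bounded_linear ((*) c)" by (rule bounded_linear_mult_right)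
  fix e :: real assume e: "e > 0"
  obtain d1 where d1: "d1 > 0" "\<And>y. y \<in> S \<Longrightarrow> norm (y - x) < d1 \<Longrightarrow> norm (l y - l x - c * (y - x)) \<le> e * norm (y - x)"
    using l e unfolding has_field_derivative_def has_derivative_within_alt by blast
  obtain d2 where d2: "d2 > 0" "\<And>y. y \<in> S \<Longrightarrow> norm (y - x) < d2 \<Longrightarrow> norm (u y - u x - c * (y - x)) \<le> e * norm (y - x)"
    using u e unfolding has_field_derivative_def has_derivative_within_alt by blast
  show "\<exists>d>0. \<forall>y\<in>S. norm (y - x) < d \<longrightarrow> norm (f y - f x - c * (y - x)) \<le> e * norm (y - x)"
  proof (intro exI[of _ "min d1 d2"] conjI ballI impI)
    fix y assume "y \<in> S" "norm (y - x) < min d1 d2"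
    then show "norm (f y - f x - c * (y - x)) \<le> e * norm (y - x)"
      using d1(2)[of y] d2(2)[of y] bounds[of y] assms(3,4) by (auto simp: abs_le_iff)
  qed (use d1 d2 in auto)
qed

text \<open>Comparing exponents of \<open>h\<close>: \<open>1 - (n + 1) p / (n + p) = - n (p - 1) / (n + p)\<close>.\<close>

lemma p_speed_eq_p_integrand:
  assumes "h > 0" "\<kappa> > 0" "real n + p \<noteq> 0"
  shows "p_speed n p h \<kappa> = - (sgn (p / (real n + p)) * p_integrand n p h \<kappa>) * \<kappa>"
proof -
  define b where "b = p / (real n + p)"
  have e: "- (real n * (p - 1) / (real n + p)) = 1 + real (n + 1) * (- b)"
    using assms(3) by (simp add: b_def field_simps)
  have "h powr (1 + real (n + 1) * (- b)) = h * (h ^ (n + 1)) powr (- b)"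
  proof -
    have "(h ^ (n + 1)) powr (- b) = h powr (real (n + 1) * (- b))"
      using powr_realpow[OF assms(1), of "n + 1"] by (metis powr_powr)
    then show ?thesis using assms(1) by (simp only: powr_add powr_one)
  qed
  moreover have "(\<kappa> / h ^ (n + 1)) powr b = \<kappa> powr b * (h ^ (n + 1)) powr (- b)"
    using assms(1,2) by (simp add: powr_divide powr_minus_divide)
  ultimately show ?thesis
    using assms(2) unfolding p_speed_def p_integrand_def e b_def[symmetric] by simp
qed

locale p_flow_solution =
  fixes p T :: real and Kt :: "real \<Rightarrow> (real^'n) set"
  assumes flow: "p_flow p T Kt" and p_ne: "p \<noteq> - real CARD('n)"
begin

abbreviation "J \<equiv> {0..<T}"
abbreviation "h t \<equiv> support_fun (Kt t)"

lemma T_pos: "T > 0" and K_reg: "t \<in> J \<Longrightarrow> Kt t \<in> K_reg"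
  and smooth_h: "smooth_on ((-{0}) \<times> J) (\<lambda>(x, t). h t (sgn x))"
  using flow by (auto simp: p_flow_def)

lemma family: "smooth_family J h"
  unfolding smooth_family_def using smooth_h thick_atLeastLessThan by auto

lemma curved_body: "t \<in> J \<Longrightarrow> curved_body (Kt t)"
proof -
  assume t: "t \<in> J"
  have "smooth_on (-{0}) (\<lambda>x. h t (sgn x))"
    using smooth_on_compose[OF smooth_h smooth_on_Pair[OF smooth_on_id smooth_on_const[of _ t]], of "-{0}"] t
    by (simp add: image_subset_iff)
  then interpret smooth_body "Kt t"
    using K_reg[OF t] by unfold_locales (auto simp: K_reg_def)
  show ?thesis
    by unfold_locales (use K_reg_iff K_reg[OF t] in blast)
qed

lemma admissible_h: "t \<in> J \<Longrightarrow> h t \<in> admissible"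
proof -
  assume "t \<in> J"
  then interpret curved_body "Kt t" by (rule curved_body)
  have "u \<noteq> 0" if "norm u = 1" for u :: "real^'n" using that by auto
  then show ?thesis using smooth H_pos hess_det_pos by (auto simp: admissible_def)
qed

lemma admissible_image: "h ` J \<subseteq> admissible"
  using admissible_h by blast

lemma normal_curvature_Kt: "t \<in> J \<Longrightarrow> norm u = 1 \<Longrightarrow> normal_curvature (Kt t) u = curvature_of_support (h t) u"
  using smooth_body.normal_curvature_eq_curvature_of_support curved_body curved_body.axioms(1) by blast

lemma h_derivative:
  assumes "t \<in> J" "norm u = 1"
  shows "((\<lambda>s. h s u) has_real_derivative flow_speed p (h t) u) (at t within J)"
  using flow assms by (simp add: p_flow_def flow_speed_def normal_curvature_Kt[symmetric])

lemma moves_h: "t \<in> J \<Longrightarrow> moves (speed_op p) J h t"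
  using h_derivative admissible_h by (simp add: moves_def speed_op_eq)

lemma smooth_hess: "smooth_on ((-{0}) \<times> J) (\<lambda>(x, t). hess_op (h t) (sgn x))"
  using diff_op_smooth[OF hess_op_on_sphere family admissible_image] by simp

lemma flow_speed_eq_density:
  assumes "t \<in> J" "norm u = 1"
  shows "flow_speed p (h t) u * hess_det (h t) u = - affine_density p (h t) u"
proof -
  have pos: "h t u > 0" "hess_det (h t) u > 0" using admissibleD[OF admissible_h[OF assms(1)]] assms(2) by auto
  have "real CARD('n) + p \<noteq> 0" using p_ne by linarith
  from p_speed_eq_p_integrand[OF pos(1) _ this, of "curvature_of_support (h t) u"] pos(2)
  show ?thesis by (simp add: flow_speed_def affine_density_def curvature_of_support_eq)
qed

text \<open>Bounds for \<open>n\<close> times the volume suffice: the integral of \<open>G\<close>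
  lies above it, that of \<open>L\<close> below its increment from \<open>t0\<close>, with equality
  at \<open>t0\<close>. Both integrands have time derivative \<open>n\<close> times speed times
  Hessian determinant there.\<close>

lemma vol_derivative:
  assumes t0: "t0 \<in> J"
  shows "((\<lambda>t. vol (Kt t)) has_real_derivative
    - integral\<^sup>L sphere_measure (affine_density p (h t0))) (at t0 within J)"
proof -
  define n where "n = CARD('n)"
  have n: "n > 0" by (simp add: n_def)
  define \<tau> where "\<tau> t x = hess_op (h t) (sgn x)" for t x
  define c where "c = (LINT u|sphere_measure. flow_speed p (h t0) u * hess_det (h t0) u)"
  \<comment> \<open>Upper bound: the reference body is the one at \<open>t0\<close>, so only the
    support function moves.\<close>
  define G where "G t x = (h t (sgn x) / h t0 (sgn x)) ^ n * (h t0 (sgn x) * \<tau> t0 x)" for t x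
  \<comment> \<open>Lower bound: the volume formula at \<open>t\<close> minus the inequality with
    reference body at \<open>t\<close>, combined into one integrand.\<close>
  define L where "L t x = (1 - (h t0 (sgn x) / h t (sgn x)) ^ n) * (h t (sgn x) * \<tau> t x)" for t x
  have hpos: "h t (sgn x) > 0" if "t \<in> J" "x \<noteq> 0" for t x
    using admissible_pos(1)[OF admissible_h] that by blast
  have hposz: "h (snd z) (sgn (fst z)) > 0" "h t0 (sgn (fst z)) > 0" if "z \<in> (-{0}) \<times> J" for z
    using hpos[of "snd z" "fst z"] hpos[OF t0, of "fst z"] that by (simp_all add: mem_Times_iff)
  have fst0: "smooth_on ((-{0}) \<times> J) (\<lambda>z. f (fst z, t0))" if "smooth_on ((-{0}) \<times> J) f"
    for f :: "(real^'n) \<times> real \<Rightarrow> real"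
    by (rule smooth_on_compose[OF that smooth_on_Pair[OF smooth_on_bounded_linear[OF bounded_linear_fst] smooth_on_const]])
      (use t0 in auto)
  have s1: "smooth_on ((-{0}) \<times> J) (\<lambda>z. h (snd z) (sgn (fst z)))"
    and s2: "smooth_on ((-{0}) \<times> J) (\<lambda>z. \<tau> (snd z) (fst z))"
    and s3: "smooth_on ((-{0}) \<times> J) (\<lambda>z. h t0 (sgn (fst z)))"
    and s4: "smooth_on ((-{0}) \<times> J) (\<lambda>z. \<tau> t0 (fst z))"
    using smooth_h smooth_hess fst0[OF smooth_h] fst0[OF smooth_hess] by (simp_all add: split_def \<tau>_def)
  have sG: "smooth_on ((-{0}) \<times> J) (\<lambda>(x, t). G t x)"
    unfolding G_def split_def by (intro smooth_on_mult smooth_on_power smooth_on_divide s1 s3 s4 hposz)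
  have sL: "smooth_on ((-{0}) \<times> J) (\<lambda>(x, t). L t x)"
    unfolding L_def split_def
    by (intro smooth_on_mult smooth_on_diff smooth_on_const smooth_on_power smooth_on_divide s1 s2 s3 hposz)
  have sgn1: "sgn u = u" if "norm u = 1" for u :: "real^'n" using that by (simp add: sgn_div_norm)
  have \<tau>: "\<tau> t u = hess_det (h t) u" if "t \<in> J" "norm u = 1" for t u
    using admissibleD(4)[OF admissible_h] that by (simp add: \<tau>_def sgn1)
  have hp: "h t u > 0" if "t \<in> J" "norm u = 1" for t u
    using admissibleD(2)[OF admissible_h] that by blast
  have dG: "((\<lambda>t. G t u) has_real_derivative real n * (flow_speed p (h t0) u * hess_det (h t0) u)) (at t0 within J)"
    if u: "norm u = 1" for u
  proof -
    have "((\<lambda>t. (h t u / h t0 u) ^ n * (h t0 u * \<tau> t0 u)) has_real_derivative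
        (real n * (flow_speed p (h t0) u / h t0 u * (h t0 u / h t0 u) ^ (n - Suc 0))) * (h t0 u * \<tau> t0 u)) (at t0 within J)"
      by (intro DERIV_cmult_right DERIV_power DERIV_cdivide h_derivative[OF t0 u])
    then show ?thesis using hp[OF t0 u] by (simp add: G_def sgn1[OF u] \<tau>[OF t0 u])
  qed
  have dL: "((\<lambda>t. L t u) has_real_derivative real n * (flow_speed p (h t0) u * hess_det (h t0) u)) (at t0 within J)"
    if u: "norm u = 1" for u
  proof -
    \<comment> \<open>The value of \<open>d\<close> contains the unknown derivative of the
      determinant; in the product rule it is multiplied by a factor that is 0 at
      \<open>t0\<close>.\<close>
    have "\<exists>d. ((\<lambda>t. h t u * \<tau> t u) has_real_derivative d) (at t0 within J)"
      using slice_time[OF smooth_on_mult[OF s1 s2], of u t0] u t0 by (force simp: sgn1)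
    then obtain d where d: "((\<lambda>t. h t u * \<tau> t u) has_real_derivative d) (at t0 within J)" ..
    have "((\<lambda>t. h t0 u / h t u) has_real_derivative - (flow_speed p (h t0) u / h t0 u)) (at t0 within J)"
      using DERIV_divide[OF DERIV_const h_derivative[OF t0 u], of "h t0 u"] hp[OF t0 u] by simp
    from DERIV_mult[OF DERIV_diff[OF DERIV_const DERIV_power[OF this, of n]] d, of 1]
    show ?thesis using hp[OF t0 u] by (simp add: L_def sgn1[OF u] \<tau>[OF t0 u])
  qed
  have IG: "((\<lambda>t. integral\<^sup>L sphere_measure (G t)) has_real_derivative real n * c) (at t0 within J)"
    using integral_sphere_has_derivative[OF sG t0 dG] by (simp add: c_def)
  have IL: "((\<lambda>t. integral\<^sup>L sphere_measure (L t)) has_real_derivative real n * c) (at t0 within J)"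
    using integral_sphere_has_derivative[OF sL t0 dL] by (simp add: c_def)
  have vol: "real n * vol (Kt t) = (LINT u|sphere_measure. h t u * hess_det (h t) u)" if "t \<in> J" for t
    unfolding n_def by (rule curved_body.vol_eq_integral[OF curved_body[OF that]])
  have vol_le: "real n * vol (Kt s) \<le> (LINT u|sphere_measure. (h s u / h t u) ^ n * (h t u * hess_det (h t) u))"
    if "s \<in> J" "t \<in> J" for s t
    using curved_body.vol_le_integral[OF curved_body[OF that(2)], of "Kt s"]
      curved_body[OF that(1)] unfolding curved_body_def smooth_body_def n_def by (simp add: mult.assoc)
  have volG: "real n * vol (Kt t) \<le> integral\<^sup>L sphere_measure (G t)" if t: "t \<in> J" for t
  proof -
    have "integral\<^sup>L sphere_measure (G t) = (LINT u|sphere_measure. (h t u / h t0 u) ^ n * (h t0 u * hess_det (h t0) u))"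
      by (rule Bochner_Integration.integral_cong) (simp_all add: space_sphere_measure G_def sgn1 \<tau>[OF t0])
    then show ?thesis using vol_le[OF t t0] by simp
  qed
  have volL: "integral\<^sup>L sphere_measure (L t) \<le> real n * vol (Kt t) - real n * vol (Kt t0)" if t: "t \<in> J" for t
  proof -
    interpret t: curved_body "Kt t" by (rule curved_body[OF t])
    interpret t0: curved_body "Kt t0" by (rule curved_body[OF t0])
    have i1: "integrable sphere_measure (\<lambda>u. h t u * hess_det (h t) u)"
      by (intro integrable_sphere_measure continuous_intros t.continuous_H t.continuous_hess_det)
    have i2: "integrable sphere_measure (\<lambda>u. (h t0 u / h t u) ^ n * (h t u * hess_det (h t) u))"
      by (intro integrable_sphere_measure continuous_intros t.continuous_H t.continuous_hess_det t0.continuous_H)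
        (use hp[OF t] in force)
    have "integral\<^sup>L sphere_measure (L t) = (LINT u|sphere_measure. h t u * hess_det (h t) u
        - (h t0 u / h t u) ^ n * (h t u * hess_det (h t) u))"
      by (rule Bochner_Integration.integral_cong) (simp_all add: space_sphere_measure L_def sgn1 \<tau>[OF t] left_diff_distrib)
    also have "\<dots> = real n * vol (Kt t) - (LINT u|sphere_measure. (h t0 u / h t u) ^ n * (h t u * hess_det (h t) u))"
      using i1 i2 vol[OF t] by simp
    finally show ?thesis using vol_le[OF t0 t] by simp
  qed
  have G0: "integral\<^sup>L sphere_measure (G t0) = real n * vol (Kt t0)"
    unfolding vol[OF t0]
    by (rule Bochner_Integration.integral_cong)
      (use hp[OF t0] in \<open>force simp: space_sphere_measure G_def sgn1 \<tau>[OF t0]\<close>)+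
  have L0: "integral\<^sup>L sphere_measure (L t0) = 0"
  proof -
    have "integral\<^sup>L sphere_measure (L t0) = (LINT u|(sphere_measure :: (real^'n) measure). 0)"
      by (rule Bochner_Integration.integral_cong)
        (use hp[OF t0] in \<open>force simp: space_sphere_measure L_def sgn1\<close>)+
    then show ?thesis by simp
  qed
  have "((\<lambda>t. real n * vol (Kt t)) has_real_derivative real n * c) (at t0 within J)"
  proof (rule has_real_derivative_sandwich)
    show "((\<lambda>t. integral\<^sup>L sphere_measure (L t)) has_real_derivative real n * c) (at t0 within J)" by (rule IL)
    show "((\<lambda>t. integral\<^sup>L sphere_measure (G t) - real n * vol (Kt t0)) has_real_derivative real n * c) (at t0 within J)"
      using DERIV_diff[OF IG DERIV_const] by simp
  qed (use G0 L0 volG volL in auto)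
  from DERIV_cdivide[OF this, of "real n"] have "((\<lambda>t. vol (Kt t)) has_real_derivative c) (at t0 within J)"
    using n by simp
  moreover have "c = - integral\<^sup>L sphere_measure (affine_density p (h t0))"
  proof -
    have "c = (LINT u|sphere_measure. - affine_density p (h t0) u)"
      unfolding c_def by (rule Bochner_Integration.integral_cong) (simp_all add: space_sphere_measure flow_speed_eq_density[OF t0])
    then show ?thesis by simp
  qed
  ultimately show ?thesis by simp
qed

end

section \<open>Iterated time derivatives and the Taylor remainder\<close>

lemma time_deriv_iterate:
  fixes f :: "nat \<Rightarrow> real \<Rightarrow> real"
  assumes f: "\<And>k t. t \<in> {0..<T} \<Longrightarrow> (f k has_real_derivative f (Suc k) t) (at t within {0..<T})"
    and g: "\<And>t. t \<in> {0..<T} \<Longrightarrow> g t = f 0 t" and t: "t \<in> {0..<T}"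
  shows "(time_deriv ^^ k) g t = f k t"
  using t
proof (induction k arbitrary: t)
  case 0
  then show ?case by (simp add: g)
next
  case (Suc k)
  \<comment> \<open>Before \<open>T\<close> the half-line and the interval of existence have the
    same germ, one-sided at 0 in either case.\<close>
  have within: "at t within {0..} = at t within {0..<T}"
    by (rule at_within_nhd[of t "{..<T}"]) (use Suc.prems in auto)
  have "((time_deriv ^^ k) g has_real_derivative f (Suc k) t) (at t within {0..<T})"
    by (rule has_field_derivative_transform_within[OF f[OF Suc.prems] zero_less_one Suc.prems]) (simp add: Suc.IH)
  then have v: "((time_deriv ^^ k) g has_vector_derivative f (Suc k) t) (at t within {0..})"
    by (simp add: within has_real_derivative_iff_has_vector_derivative)
  have nb: "at t within {0..} \<noteq> bot"
    unfolding within using thick_islimpt[OF thick_atLeastLessThan Suc.prems]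
    by (simp add: trivial_limit_within)
  have "(time_deriv ^^ Suc k) g t = vector_derivative ((time_deriv ^^ k) g) (at t within {0..})"
    by (simp add: time_deriv_def[of "(time_deriv ^^ k) g" t])
  also have "\<dots> = f (Suc k) t" by (rule vector_derivative_within[OF nb v])
  finally show ?case .
qed

lemma taylor_remainder_bound:
  fixes f :: "nat \<Rightarrow> real \<Rightarrow> real"
  assumes f: "\<And>k t. t \<in> {0..<T} \<Longrightarrow> (f k has_real_derivative f (Suc k) t) (at t within {0..<T})" and T: "T > 0"
  obtains B where "B > 0" "\<And>t. t \<in> {0..T/2} \<Longrightarrow> \<bar>f 0 t - (\<Sum>i\<le>M. f i 0 * t ^ i / fact i)\<bar> \<le> B * t ^ Suc M"
proof -
  have sub: "{0..T/2} \<subseteq> {0..<T}" using T by auto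
  have f': "(f i has_field_derivative f (Suc i) x) (at x within {0..T/2})" if "x \<in> {0..T/2}" for i x
    using DERIV_subset[OF f sub] that sub by blast
  have "compact (f (Suc M) ` {0..T/2})"
    by (intro compact_continuous_image DERIV_continuous_on[OF f']) auto
  then obtain C where C: "\<And>t. t \<in> {0..T/2} \<Longrightarrow> norm (f (Suc M) t) \<le> C"
    by (metis compact_imp_bounded bounded_iff image_eqI)
  define B where "B = \<bar>C\<bar> / fact M + 1"
  have B: "B > 0" unfolding B_def by (intro add_nonneg_pos divide_nonneg_pos) auto
  show thesis
  proof (rule that[OF B])
    fix t assume t: "t \<in> {0..T/2}"
    have "norm (f 0 t - (\<Sum>i\<le>M. f i 0 * (t - 0) ^ i / fact i)) \<le> C * norm (t - 0) ^ Suc M / fact M"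
      by (rule field_Taylor[where S="{0..T/2}"]) (use f' C t T in auto)
    also have "\<dots> \<le> B * t ^ Suc M"
    proof -
      have "C / fact M \<le> \<bar>C\<bar> / fact M" by (rule divide_right_mono) auto
      then have "C / fact M \<le> B" unfolding B_def by linarith
      then have "C / fact M * t ^ Suc M \<le> B * t ^ Suc M" using t by (intro mult_right_mono) auto
      then show ?thesis using t by simp
    qed
    finally show "\<bar>f 0 t - (\<Sum>i\<le>M. f i 0 * t ^ i / fact i)\<bar> \<le> B * t ^ Suc M" by simp
  qed
qed

lemma smallo_power_at_right:
  fixes g :: "real \<Rightarrow> real"
  assumes "T > 0" "B > 0" "N \<le> M" "\<And>t. t \<in> {0..T/2} \<Longrightarrow> \<bar>g t\<bar> \<le> B * t ^ Suc M"
  shows "g \<in> o[at_right 0](\<lambda>t. t ^ N)"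
proof (rule landau_o.smallI)
  fix c :: real assume c: "c > 0"
  \<comment> \<open>The bound \<open>c / B\<close> absorbs one factor \<open>t\<close> of the
    remainder; the bound 1 allows lowering the exponent from \<open>M\<close> to
    \<open>N\<close>.\<close>
  define d where "d = min (min (T / 2) 1) (c / B)"
  have d: "d > 0" "d \<le> T / 2" "d \<le> 1" "B * d \<le> c"
  proof -
    have "d \<le> c / B" unfolding d_def by (rule min.cobounded2)
    then show "B * d \<le> c" using assms(2) by (simp add: pos_le_divide_eq mult.commute)
    have "d \<le> min (T / 2) 1" unfolding d_def by (rule min.cobounded1)
    then show "d \<le> T / 2" "d \<le> 1" by simp_all
    show "d > 0" using assms(1,2) c by (simp add: d_def)
  qed
  have "norm (g t) \<le> c * norm (t ^ N)" if t: "0 < t" "t < d" for t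
  proof -
    have "\<bar>g t\<bar> \<le> B * t ^ Suc M" using assms(4)[of t] t d by auto
    also have "\<dots> = (B * t) * t ^ M" by simp
    also have "\<dots> \<le> c * t ^ N"
    proof (rule mult_mono)
      have "B * t \<le> B * d" using t assms(2) by simp
      then show "B * t \<le> c" using d by linarith
      show "t ^ M \<le> t ^ N" using t d assms(3) by (intro power_decreasing) auto
    qed (use t c in auto)
    finally show ?thesis using t by simp
  qed
  then show "eventually (\<lambda>t. norm (g t) \<le> c * norm (t ^ N)) (at_right 0)"
    unfolding eventually_at_right_field using d(1) by (auto simp: intro!: exI[of _ d])
qed

section \<open>All time derivatives of the volume as integrals over the sphere\<close>

context p_flow_solution
begin

text \<open>The first derivative already is minus the integral of the density, so order
  \<open>k\<close> involves \<open>k - 1\<close> variations. The sign does not alternate because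
  each variation follows the flow's own velocity.\<close>

definition vol_deriv :: "nat \<Rightarrow> real \<Rightarrow> real" where
  "vol_deriv k t = (case k of 0 \<Rightarrow> vol (Kt t)
     | Suc j \<Rightarrow> - integral\<^sup>L sphere_measure ((flow_variation p ^^ j) (affine_density p) (h t)))"

lemma
  assumes t: "t \<in> J"
  shows integrable_flow_variation: "integrable sphere_measure ((flow_variation p ^^ j) (affine_density p) (h t))"
    and vol_deriv_derivative: "(vol_deriv k has_real_derivative vol_deriv (Suc k) t) (at t within J)"
proof -
  obtain Q :: "nat \<Rightarrow> (real^'n \<Rightarrow> real) \<Rightarrow> real^'n \<Rightarrow> real" where
    ev: "\<And>j. evolves admissible (speed_op p) (Q j) (Q (Suc j))"
    and Q: "\<And>j h u. h \<in> admissible \<Longrightarrow> norm u = 1 \<Longrightarrow> (flow_variation p ^^ j) (affine_density p) h u = Q j h u"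
    by (rule flow_variation_operators[of p]) blast
  have sm: "smooth_on ((-{0}) \<times> J) (\<lambda>(x, t). Q j (h t) x)" for j
    by (rule evolves_smooth[OF ev family admissible_image])
  have "continuous_on (sphere 0 1) (\<lambda>x. (\<lambda>(x, t). Q j (h t) x) (x, t))"
    by (rule continuous_on_compose2[OF smooth_on_continuous[OF sm]]) (use t in \<open>auto intro!: continuous_intros\<close>)
  then have "continuous_on (sphere 0 1) ((flow_variation p ^^ j) (affine_density p) (h t))"
    by (rule continuous_on_eq) (simp add: Q[OF admissible_h[OF t]])
  then show "integrable sphere_measure ((flow_variation p ^^ j) (affine_density p) (h t))"
    by (rule integrable_sphere_measure)
  have eq: "integral\<^sup>L sphere_measure ((flow_variation p ^^ j) (affine_density p) (h s)) = integral\<^sup>L sphere_measure (Q j (h s))"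
    if "s \<in> J" for s j
    by (rule Bochner_Integration.integral_cong) (simp_all add: space_sphere_measure Q[OF admissible_h[OF that]])
  show "(vol_deriv k has_real_derivative vol_deriv (Suc k) t) (at t within J)"
  proof (cases k)
    case 0
    then show ?thesis using vol_derivative[OF t] by (simp add: vol_deriv_def[abs_def])
  next
    case (Suc j)
    have "((\<lambda>s. integral\<^sup>L sphere_measure (Q j (h s))) has_real_derivative integral\<^sup>L sphere_measure (Q (Suc j) (h t))) (at t within J)"
      by (rule integral_sphere_has_derivative[OF sm t])
        (rule evolves_deriv[OF ev family admissible_image moves_h[OF t]], auto)
    from DERIV_minus[OF this]
    have "((\<lambda>s. - integral\<^sup>L sphere_measure (Q j (h s))) has_real_derivative vol_deriv (Suc k) t) (at t within J)"
      using eq[OF t, of "Suc j"] by (simp add: vol_deriv_def Suc)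
    then show ?thesis
      by (rule has_field_derivative_transform_within[OF _ zero_less_one t]) (simp add: vol_deriv_def Suc eq)
  qed
qed

lemma zero_mem: "0 \<in> J" using T_pos by simp

lemma time_deriv_eq:
  assumes "\<And>t. t \<in> J \<Longrightarrow> g t = vol (Kt t)"
  shows "(time_deriv ^^ k) g 0 = vol_deriv k 0"
proof (rule time_deriv_iterate[where T=T])
  show "(vol_deriv k has_real_derivative vol_deriv (Suc k) t) (at t within J)" if "t \<in> J" for k t
    using that by (rule vol_deriv_derivative)
qed (use assms zero_mem in \<open>simp_all add: vol_deriv_def\<close>)

lemma smooth_vol: "smooth_on J (\<lambda>t. vol (Kt t))"
proof -
  have "smooth_on J (vol_deriv 0)"
    by (rule smooth_on_of_derivative_sequence[where f=vol_deriv]) (rule vol_deriv_derivative)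
  moreover have "vol_deriv 0 = (\<lambda>t. vol (Kt t))" by (simp add: fun_eq_iff vol_deriv_def)
  ultimately show ?thesis by simp
qed

lemma affine_surface_area_eq:
  assumes "t \<in> J"
  shows "sgn (p / (real CARD('n) + p)) * affine_surface_area p (Kt t) = integral\<^sup>L sphere_measure (affine_density p (h t))"
proof -
  have "affine_surface_area p (Kt t) =
      (LINT u|sphere_measure. p_integrand CARD('n) p (h t u) (curvature_of_support (h t) u))"
    unfolding affine_surface_area_def
    by (rule Bochner_Integration.integral_cong) (simp_all add: space_sphere_measure normal_curvature_Kt[OF assms])
  then show ?thesis by (simp add: affine_density_def[abs_def])
qed

end

text \<open>The derivatives at time 0 only depend on the support function of the initial body, hence the
  solution picked by \<open>volume_variation\<close> does not matter.\<close>

lemma (in p_flow_solution) volume_variation_eq: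
  "volume_variation p k (Kt 0) = vol_deriv k 0"
proof -
  have "Kt 0 = Kt 0 \<and> (\<exists>T. p_flow p T Kt)" using flow by blast
  then have "(SOME K'. K' 0 = Kt 0 \<and> (\<exists>T. p_flow p T K')) 0 = Kt 0 \<and>
      (\<exists>T. p_flow p T (SOME K'. K' 0 = Kt 0 \<and> (\<exists>T. p_flow p T K')))"
    by (rule someI[where P="\<lambda>K'. K' 0 = Kt 0 \<and> (\<exists>T. p_flow p T K')"])
  then obtain K' T' where K': "K' = (SOME K'. K' 0 = Kt 0 \<and> (\<exists>T. p_flow p T K'))" "K' 0 = Kt 0" "p_flow p T' K'"
    by blast
  interpret K': p_flow_solution p T' K' by unfold_locales (use K' p_ne in auto)
  have "volume_variation p k (Kt 0) = (time_deriv ^^ k) (\<lambda>t. vol (K' t)) 0"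
    unfolding volume_variation_def Let_def K'(1) ..
  also have "\<dots> = K'.vol_deriv k 0" by (rule K'.time_deriv_eq) simp
  also have "\<dots> = vol_deriv k 0" using K'(2) by (simp add: K'.vol_deriv_def vol_deriv_def split: nat.split)
  finally show ?thesis .
qed

section \<open>Volume preserving linear maps\<close>

lemma support_fun_linear_image:
  fixes A :: "real^'n^'n"
  shows "support_fun ((*v) A ` K) x = support_fun K (transpose A *v x)"
proof -
  have "(A *v y) \<bullet> x = y \<bullet> (transpose A *v x)" for y
    by (metis inner_commute inner_matrix_vector_right)
  then show ?thesis by (simp add: support_fun_def image_image)
qed

locale unimodular =
  fixes A :: "real^'n^'n"
  assumes det_A: "det A = 1"
begin

lemma inv: "invertible A" using det_A by (simp add: invertible_det_nz)

lemma inj: "inj ((*v) A)" using inv inj_matrix_vector_mult by blast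

lemma det_transpose_A: "det (transpose A) = 1" using det_A by (simp add: det_transpose)

lemma transpose_nz: "x \<noteq> 0 \<Longrightarrow> transpose A *v x \<noteq> 0"
proof -
  have "invertible (transpose A)" by (simp add: invertible_det_nz det_A)
  then have "inj ((*v) (transpose A))" by (rule inj_matrix_vector_mult)
  then show "x \<noteq> 0 \<Longrightarrow> transpose A *v x \<noteq> 0"
    using injD[of "(*v) (transpose A)" x 0] by force
qed

lemma vol_image:
  assumes "compact K" shows "vol ((*v) A ` K) = vol K"
proof -
  have K: "K \<in> lmeasurable" using assms by (rule lmeasurable_compact)
  have der: "((*v) A has_derivative (*v) A) (at x within K)" for x
    by (intro bounded_linear_imp_has_derivative matrix_vector_mul_bounded_linear)
  have 1: "(\<lambda>x. \<bar>det (matrix ((*v) A))\<bar>) = (\<lambda>x::real^'n. 1 :: real)" by (simp add: det_A)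
  have "measure lebesgue ((*v) A ` K) = (LINT x:K|lebesgue. \<bar>det (matrix ((*v) A))\<bar>)"
    by (rule measure_image_eq_set_integral[OF fmeasurableD[OF K] der])
      (use K inj in \<open>auto simp: 1 det_A set_integrable_def fmeasurable_def intro: inj_on_subset\<close>)
  also have "\<dots> = measure lebesgue K"
    using K by (simp add: 1 det_A set_lebesgue_integral_def fmeasurableD fmeasurableD2)
  finally show ?thesis by (simp add: vol_def)
qed

lemma frontier_image: "frontier ((*v) A ` K) = (*v) A ` frontier K"
  by (simp add: frontier_def closure_injective_linear_image interior_injective_linear_image inj image_set_diff)

text \<open>Defining functions are carried over by composition with the inverse matrix
  \<open>B\<close>; surjectivity of \<open>B\<close> keeps their derivatives nonzero.\<close>

lemma smooth_boundary_image:
  fixes K :: "(real^'n) set"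
  assumes K: "smooth_boundary K"
  shows "smooth_boundary ((*v) A ` K)"
  unfolding smooth_boundary_def
proof
  obtain B where "A ** B = mat 1" "B ** A = mat 1" using inv unfolding invertible_def by blast
  then have AB: "A *v (B *v z) = z" "B *v (A *v z) = z" for z by (simp_all add: matrix_vector_mul_assoc)
  fix x assume "x \<in> frontier ((*v) A ` K)"
  then obtain y where y: "y \<in> frontier K" "x = A *v y" by (auto simp: frontier_image)
  obtain U and f :: "real^'n \<Rightarrow> real" where U: "open U" "y \<in> U" "smooth_on U f"
     "\<forall>z\<in>U. \<exists>v. frechet_derivative f (at z) v \<noteq> 0" "frontier K \<inter> U = {z \<in> U. f z = 0}"
    using K[unfolded smooth_boundary_def, rule_format, OF y(1)] by (elim exE conjE) (rule that)
  define g where "g = (\<lambda>z. f (B *v z))"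
  define W where "W = (*v) B -` U"
  have blB: "bounded_linear ((*v) B)" by (rule matrix_vector_mul_bounded_linear)
  have "\<exists>v. frechet_derivative g (at z) v \<noteq> 0" if "z \<in> W" for z
  proof -
    have Bz: "B *v z \<in> U" using that by (simp add: W_def)
    have "(f has_derivative frechet_derivative f (at (B *v z))) (at (B *v z))"
      using smooth_on_has_derivative[OF U(3) Bz] by (simp only: at_within_open[OF Bz U(1)])
    from has_derivative_compose[OF bounded_linear_imp_has_derivative[OF blB] this]
    have "frechet_derivative g (at z) = (\<lambda>v. frechet_derivative f (at (B *v z)) (B *v v))"
      unfolding g_def by (rule frechet_derivative_at[symmetric])
    moreover obtain v where "frechet_derivative f (at (B *v z)) v \<noteq> 0" using U(4) Bz by blast
    ultimately show ?thesis by (intro exI[of _ "A *v v"]) (simp add: AB)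
  qed
  moreover have "open W"
    unfolding W_def by (rule open_vimage[OF U(1) linear_continuous_on[OF blB]])
  moreover have "x \<in> W" using U(2) y(2) by (simp add: W_def AB)
  moreover have "smooth_on W g"
    unfolding g_def by (rule smooth_on_compose[OF U(3) smooth_on_bounded_linear[OF blB]]) (auto simp: W_def)
  moreover have "frontier ((*v) A ` K) \<inter> W = {z \<in> W. g z = 0}"
  proof -
    have "z \<in> (*v) A ` frontier K \<longleftrightarrow> B *v z \<in> frontier K" for z
    proof
      show "B *v z \<in> frontier K" if "z \<in> (*v) A ` frontier K" using that by (auto simp: AB)
      show "z \<in> (*v) A ` frontier K" if "B *v z \<in> frontier K"
        by (rule image_eqI[OF _ that]) (simp add: AB)
    qed
    then show ?thesis using U(5) by (auto simp: frontier_image W_def g_def)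
  qed
  ultimately show "\<exists>U f. open U \<and> x \<in> U \<and> smooth_on U (f :: real^'n \<Rightarrow> real) \<and>
        (\<forall>y\<in>U. \<exists>v. frechet_derivative f (at y) v \<noteq> 0) \<and> frontier ((*v) A ` K) \<inter> U = {y \<in> U. f y = 0}"
    by blast
qed

lemma smooth_support_image:
  assumes "smooth_support K" shows "smooth_support ((*v) A ` K)"
proof -
  interpret smooth_support K by (rule assms)
  show ?thesis
  proof
    show "compact ((*v) A ` K)"
      by (rule compact_continuous_image[OF linear_continuous_on[OF matrix_vector_mul_bounded_linear] compact])
    show "convex ((*v) A ` K)" by (intro convex_linear_image convex matrix_vector_mul_linear)
    have "A *v 0 \<in> (*v) A ` interior K" using zero_interior by (rule imageI)
    then show "0 \<in> interior ((*v) A ` K)" by (simp add: interior_injective_linear_image inj)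
    have s: "smooth_on (- {0}) (\<lambda>x. transpose A *v sgn x)"
      by (rule smooth_on_compose_linear[OF matrix_vector_mul_bounded_linear smooth_on_sgn])
    have "(\<lambda>x. transpose A *v sgn x) ` (- {0}) \<subseteq> - {0}"
    proof (rule image_subsetI)
      fix x :: "real^'n" assume "x \<in> - {0}"
      then have "sgn x \<noteq> 0" by (simp add: sgn_zero_iff)
      from transpose_nz[OF this] show "transpose A *v sgn x \<in> - {0}" by simp
    qed
    from smooth_on_compose[OF smooth_H s this]
    show "smooth_on (- {0}) (\<lambda>x. support_fun ((*v) A ` K) (sgn x))"
      by (simp only: support_fun_linear_image)
  qed
qed

text \<open>The Hessian of the support function transforms by congruence; the power of \<open>|A\<^sup>T u|\<close> comes from
  comparing \<open>u\<close> with the direction of \<open>A\<^sup>T u\<close>.\<close>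

lemma hess_det_image:
  fixes K :: "(real^'n) set"
  assumes "smooth_support K" and u: "norm u = 1"
  defines "w \<equiv> transpose A *v u"
  shows "hess_det (support_fun ((*v) A ` K)) u * norm w ^ (CARD('n) + 1) = hess_det (support_fun K) (sgn w)"
proof -
  interpret K: smooth_support K by (rule assms(1))
  interpret L: smooth_support "(*v) A ` K" by (rule smooth_support_image[OF assms(1)])
  have u0: "u \<noteq> 0" using u by auto
  have w0: "w \<noteq> 0" unfolding w_def by (rule transpose_nz[OF u0])
  have LX: "L.X x = A *v K.X (transpose A *v x)" if "x \<noteq> 0" for x
  proof (rule L.support_point_unique[OF that, symmetric])
    show "A *v K.X (transpose A *v x) \<in> (*v) A ` K" using K.X_mem[OF transpose_nz[OF that]] by blast
    have "(A *v K.X (transpose A *v x)) \<bullet> x = K.X (transpose A *v x) \<bullet> (transpose A *v x)"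
      by (metis inner_commute inner_matrix_vector_right)
    then show "(A *v K.X (transpose A *v x)) \<bullet> x = L.H x"
      by (simp only: K.X_inner[OF transpose_nz[OF that]] support_fun_linear_image)
  qed
  have "((\<lambda>x. A *v K.X (transpose A *v x)) has_derivative (\<lambda>v. A *v (K.DX w *v (transpose A *v v)))) (at u)"
  proof (rule bounded_linear.has_derivative[OF matrix_vector_mul_bounded_linear])
    show "((\<lambda>x. K.X (transpose A *v x)) has_derivative (\<lambda>v. K.DX w *v (transpose A *v v))) (at u)"
      by (rule has_derivative_compose[OF bounded_linear_imp_has_derivative[OF matrix_vector_mul_bounded_linear]])
        (use K.X_derivative[OF w0] in \<open>simp add: w_def\<close>)
  qed
  then have "(L.X has_derivative (\<lambda>v. A *v (K.DX w *v (transpose A *v v)))) (at u)"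
    by (rule has_derivative_transform_within_open[of _ _ _ _ "-{0}"]) (use u0 LX in auto)
  then have "(\<lambda>v. A *v (K.DX w *v (transpose A *v v))) = (\<lambda>v. L.DX u *v v)"
    using L.X_derivative[OF u0] by (rule has_derivative_unique)
  then have LDX: "L.DX u *v v = A *v (K.DX w *v (transpose A *v v))" for v by metis
  obtain B where "A ** B = mat 1" using inv unfolding invertible_def by blast
  \<comment> \<open>With \<open>a\<close> the preimage of \<open>u\<close>, the term
    \<open>outer u u\<close> is also a congruence by \<open>A\<close>, namely of
    \<open>outer a a\<close>.\<close>
  then obtain a where Aa: "A *v a = u" by (metis matrix_vector_mul_assoc matrix_vector_mul_lid)
  have aw: "a \<bullet> w = 1"
    using u Aa by (metis inner_commute inner_matrix_vector_right norm_eq_1 w_def)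
  have "L.DX u + outer u u = A ** (K.DX w + outer a a) ** transpose A"
  proof (subst matrix_eq, rule allI)
    fix v
    have "u \<bullet> v = a \<bullet> (transpose A *v v)"
      using Aa by (metis inner_commute inner_matrix_vector_right)
    then show "(L.DX u + outer u u) *v v = (A ** (K.DX w + outer a a) ** transpose A) *v v"
      using Aa by (simp add: LDX matrix_vector_mul_assoc[symmetric] matrix_vector_mult_add_rdistrib
          matrix_vector_right_distrib matrix_vector_mult_scaleR)
  qed
  then have d1: "hess_det L.H u = det (K.DX w + outer a a)"
    using L.hess_det_eq[OF u] det_A det_transpose_A by (simp add: det_mul)
  \<comment> \<open>The exponent \<open>n + 1\<close> arises as \<open>n - 1\<close> from the
    homogeneity of \<open>DX\<close> on the tangent space plus 2 from the normal components
    \<open>a \<bullet> s = q\<close>.\<close>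
  define q where "q = 1 / norm w"
  define s where "s = sgn w"
  have q: "q > 0" and s: "norm s = 1" "s \<noteq> 0" using w0 by (auto simp: q_def s_def norm_sgn sgn_zero_iff)
  have ws: "w = norm w *\<^sub>R s" using w0 by (simp add: s_def sgn_div_norm)
  have DXw: "K.DX w = q *\<^sub>R K.DX s" using K.DX_scaleR[of "norm w" s] ws w0 s(2) by (simp add: q_def)
  have as: "a \<bullet> s = q" using aw w0 by (simp add: s_def sgn_div_norm q_def inverse_eq_divide)
  have "q * det (K.DX w + outer a a) = q ^ CARD('n) * (q * q * det (K.DX s + outer s s))"
    using det_scaleR_rank_one_update[OF K.DX_kernel[OF s(2)] K.DX_transpose_kernel[OF s(2)] s(1), of q a a]
    by (simp add: DXw as)
  then have "det (K.DX w + outer a a) = q ^ (CARD('n) + 1) * hess_det K.H s"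
    using q K.hess_det_eq[OF s(1)] by simp
  moreover have "q ^ (CARD('n) + 1) * norm w ^ (CARD('n) + 1) = 1"
    using w0 by (simp add: q_def power_divide)
  ultimately show ?thesis unfolding d1 s_def by (simp add: mult_ac)
qed

lemma curved_body_image:
  assumes "curved_body K" shows "curved_body ((*v) A ` K)"
proof -
  interpret K: curved_body K by (rule assms)
  interpret L: smooth_support "(*v) A ` K" by (rule smooth_support_image) unfold_locales
  show ?thesis
  proof
    show "smooth_boundary ((*v) A ` K)" by (rule smooth_boundary_image[OF K.boundary])
    fix u :: "real^'n" assume u: "norm u = 1"
    have "u \<noteq> 0" using u by auto
    then have w: "transpose A *v u \<noteq> 0" by (rule transpose_nz)
    have "hess_det L.H u * norm (transpose A *v u) ^ (CARD('n) + 1) > 0"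
      using hess_det_image[OF K.smooth_support_axioms u] K.hess_det_pos[OF norm_sgn_eq_1[OF w]] by simp
    moreover have "norm (transpose A *v u) ^ (CARD('n) + 1) > 0" using w by (intro zero_less_power) simp
    ultimately show "hess_det L.H u > 0" by (rule zero_less_mult_pos2)
  qed
qed

end

text \<open>The exponents satisfy \<open>- n (p - 1) / (n + p) + (n + 1) p / (n + p) = 1\<close>.
  This is the source of the centro-affine invariance: a unimodular map scales the support function
  by \<open>r\<close> and the curvature by its power \<open>n + 1\<close>.\<close>

lemma p_speed_scale:
  assumes "r > 0" "h > 0" "\<kappa> > 0" "real n + p \<noteq> 0"
  shows "p_speed n p (r * h) (r ^ (n + 1) * \<kappa>) = r * p_speed n p h \<kappa>"
proof -
  define b where "b = p / (real n + p)"
  define a where "a = - (real n * (p - 1) / (real n + p))"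
  have e: "a + real (n + 1) * b = 1"
  proof -
    have "a + real (n + 1) * b = (real (n + 1) * p - real n * (p - 1)) / (real n + p)"
      by (simp add: a_def b_def diff_divide_distrib)
    also have "real (n + 1) * p - real n * (p - 1) = real n + p" by (simp add: algebra_simps)
    finally show ?thesis using assms(4) by simp
  qed
  have "(r ^ (n + 1)) powr b = r powr (real (n + 1) * b)"
    using powr_realpow[OF assms(1), of "n + 1"] by (metis powr_powr)
  then have "r powr a * (r ^ (n + 1)) powr b = r" using assms(1) e by (simp flip: powr_add)
  then have "(r * h) powr a * (r ^ (n + 1) * \<kappa>) powr b = r * (h powr a * \<kappa> powr b)"
    using assms(1-3) by (simp only: powr_mult) (simp add: mult_ac)
  then show ?thesis by (simp add: p_speed_def a_def[symmetric] b_def[symmetric])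
qed

text \<open>At each normal \<open>u\<close> the flow equation of the image is that of the original
  body at the direction of \<open>transpose A *v u\<close>, with both sides multiplied by the norm
  of that vector.\<close>

lemma (in p_flow_solution) p_flow_linear_image:
  fixes A :: "real^'n^'n"
  assumes "det A = 1"
  shows "p_flow p T (\<lambda>t. (*v) A ` Kt t)"
proof -
  interpret A: unimodular A by unfold_locales (rule assms)
  have np: "real CARD('n) + p \<noteq> 0" using p_ne by linarith
  have cb: "curved_body ((*v) A ` Kt t)" if "t \<in> J" for t
    by (rule A.curved_body_image[OF curved_body[OF that]])
  have hA: "support_fun ((*v) A ` Kt t) x = norm (transpose A *v x) * h t (sgn (transpose A *v x))"
    if "t \<in> J" for t x
  proof -
    interpret curved_body "Kt t" by (rule curved_body[OF that])
    show ?thesis unfolding support_fun_linear_image by (rule support_fun_norm_sgn[OF compact nonempty])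
  qed
  show ?thesis
    unfolding p_flow_def
  proof (intro conjI ballI)
    show "0 < T" by (rule T_pos)
    show "(*v) A ` Kt t \<in> K_reg" if "t \<in> J" for t
    proof -
      interpret L: curved_body "(*v) A ` Kt t" by (rule cb[OF that])
      show ?thesis using L.K_reg_iff L.hess_det_pos by blast
    qed
    have s1: "smooth_on ((-{0}) \<times> J) (\<lambda>z :: (real^'n) \<times> real. transpose A *v sgn (fst z))"
      by (rule smooth_on_compose_linear[OF matrix_vector_mul_bounded_linear
          smooth_on_compose[OF smooth_on_sgn smooth_on_bounded_linear[OF bounded_linear_fst]]]) auto
    have nz: "transpose A *v sgn (fst z) \<noteq> 0" if "z \<in> (-{0}) \<times> J" for z :: "(real^'n) \<times> real"
      using that by (intro A.transpose_nz) (auto simp: sgn_zero_iff)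
    have "smooth_on ((-{0}) \<times> J) (\<lambda>z. norm (transpose A *v sgn (fst z)) *
        (\<lambda>(x, t). h t (sgn x)) (transpose A *v sgn (fst z), snd z))"
      by (intro smooth_on_mult smooth_on_compose[OF smooth_on_norm s1] smooth_on_compose[OF smooth_h]
          smooth_on_Pair[OF s1] smooth_on_bounded_linear[OF bounded_linear_snd]) (use nz in force)+
    then show "smooth_on ((-{0}) \<times> J) (\<lambda>(x, t). support_fun ((*v) A ` Kt t) (sgn x))"
      by (rule smooth_on_cong[rotated]) (auto simp: hA)
    fix t and u :: "real^'n" assume t: "t \<in> J" and "u \<in> sphere 0 1"
    then have u: "norm u = 1" by simp
    interpret K: curved_body "Kt t" by (rule curved_body[OF t])
    interpret L: curved_body "(*v) A ` Kt t" by (rule cb[OF t])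
    define w where "w = transpose A *v u"
    have "u \<noteq> 0" using u by auto
    then have w: "w \<noteq> 0" unfolding w_def by (rule A.transpose_nz)
    have sw: "norm (sgn w) = 1" by (rule norm_sgn_eq_1[OF w])
    have hd: "hess_det L.H u * norm w ^ (CARD('n) + 1) = hess_det (h t) (sgn w)"
      using A.hess_det_image[OF K.smooth_support_axioms u] by (simp add: w_def)
    have pos: "hess_det (h t) (sgn w) > 0" "h t (sgn w) > 0"
      using K.hess_det_pos[OF sw] K.H_pos[of "sgn w"] w by (simp_all add: sgn_zero_iff)
    have "curvature_of_support L.H u = norm w ^ (CARD('n) + 1) * curvature_of_support (h t) (sgn w)"
      unfolding curvature_of_support_eq hd[symmetric] using w by simp
    then have "p_speed CARD('n) p (L.H u) (normal_curvature ((*v) A ` Kt t) u) =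
        p_speed CARD('n) p (norm w * h t (sgn w)) (norm w ^ (CARD('n) + 1) * curvature_of_support (h t) (sgn w))"
      by (simp add: L.normal_curvature_eq_curvature_of_support[OF u] hA[OF t] w_def)
    also have "\<dots> = norm w * flow_speed p (h t) (sgn w)"
      unfolding flow_speed_def
      by (rule p_speed_scale) (use w pos np in \<open>simp_all add: curvature_of_support_eq\<close>)
    finally have speed: "p_speed CARD('n) p (L.H u) (normal_curvature ((*v) A ` Kt t) u) =
        norm w * flow_speed p (h t) (sgn w)" .
    have "((\<lambda>s. norm w * h s (sgn w)) has_real_derivative norm w * flow_speed p (h t) (sgn w)) (at t within J)"
      by (intro DERIV_cmult h_derivative[OF t sw])
    then show "((\<lambda>s. support_fun ((*v) A ` Kt s) u) has_real_derivative
        p_speed CARD('n) p (L.H u) (normal_curvature ((*v) A ` Kt t) u)) (at t within J)"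
      unfolding speed
      by (rule has_field_derivative_transform_within[OF _ zero_less_one t]) (simp add: hA w_def)
  qed
qed

lemma (in p_flow_solution) volume_variation_linear_image:
  fixes A :: "real^'n^'n"
  assumes "det A = 1"
  shows "volume_variation p k ((*v) A ` Kt 0) = volume_variation p k (Kt 0)"
proof -
  interpret A: unimodular A by unfold_locales (rule assms)
  interpret L: p_flow_solution p T "\<lambda>t. (*v) A ` Kt t"
    by unfold_locales (rule p_flow_linear_image[OF assms], rule p_ne)
  have "volume_variation p k ((*v) A ` Kt 0) = L.vol_deriv k 0" by (rule L.volume_variation_eq)
  also have "\<dots> = (time_deriv ^^ k) (\<lambda>t. vol ((*v) A ` Kt t)) 0" by (rule L.time_deriv_eq[symmetric]) simp
  also have "\<dots> = vol_deriv k 0"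
  proof (rule time_deriv_eq)
    fix t assume "t \<in> J"
    then have "compact (Kt t)" using K_reg by (simp add: K_reg_def)
    then show "vol ((*v) A ` Kt t) = vol (Kt t)" by (rule A.vol_image)
  qed
  also have "\<dots> = volume_variation p k (Kt 0)" by (rule volume_variation_eq[symmetric])
  finally show ?thesis .
qed

theorem theorem4p1:
  fixes p T :: real and K :: "(real^'n) set" and Kt :: "real \<Rightarrow> (real^'n) set"
  assumes "p \<noteq> - real CARD('n)" and "p \<noteq> 0"
    and "K \<in> K_reg"
    and "p_flow p T Kt" and "Kt 0 = K"
  shows "smooth_on {0..<T} (\<lambda>t. vol (Kt t)) \<and>
    (\<forall>N. (\<lambda>t. vol (Kt t) -
            (vol K - t * Omega 1 p K + (\<Sum>k=2..N. (-1) ^ k * t ^ k / fact k * Omega k p K)))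
          \<in> o[at_right 0](\<lambda>t. t ^ N)) \<and>
    Omega 1 p K = - time_deriv (\<lambda>t. vol (Kt t)) 0 \<and>
    Omega 1 p K = sgn (p / (real CARD('n) + p)) * affine_surface_area p K \<and>
    (\<forall>k\<ge>2.
       (\<forall>A :: real^'n^'n. det A = 1 \<longrightarrow> Omega k p ((*v) A ` K) = Omega k p K) \<and>
       Omega k p K = (-1) ^ k * (time_deriv ^^ k) (\<lambda>t. vol (Kt t)) 0 \<and>
       Omega k p K = (-1) ^ k * volume_variation p k K \<and>
       has_bochner_integral sphere_measure
         (\<lambda>u. (-1) ^ (k - 1) * (flow_variation p ^^ (k - 1)) (affine_density p) (support_fun K) u)
         (Omega k p K))"
proof -
  interpret p_flow_solution p T Kt by unfold_locales (use assms in auto)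
  have K: "Kt 0 = K" by (rule assms(5))
  define V where "V = (\<lambda>t. vol (Kt t))"
  have td: "(time_deriv ^^ k) V 0 = vol_deriv k 0" for k
    by (rule time_deriv_eq) (simp add: V_def)
  have vv: "volume_variation p k K = vol_deriv k 0" for k
    using volume_variation_eq[of k] by (simp add: K)
  have Om: "Omega k p K = (-1) ^ k * vol_deriv k 0" for k by (simp add: Omega_def vv)
  have V0: "vol_deriv 0 = V" "V 0 = vol K" by (auto simp: fun_eq_iff vol_deriv_def V_def K)
  have smooth: "smooth_on {0..<T} V" unfolding V_def by (rule smooth_vol)
  have taylor: "(\<lambda>t. V t - (vol K - t * Omega 1 p K + (\<Sum>k=2..N. (-1) ^ k * t ^ k / fact k * Omega k p K)))
      \<in> o[at_right 0](\<lambda>t. t ^ N)" for N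
  proof -
    \<comment> \<open>For \<open>N = 0\<close> the stated polynomial still contains the linear term,
      so the Taylor sum runs at least up to 1.\<close>
    define M where "M = max N 1"
    have "{..M} = insert 0 (insert 1 {2..N})" by (auto simp: M_def)
    then have "(\<Sum>i\<le>M. vol_deriv i 0 * t ^ i / fact i) =
        vol K - t * Omega 1 p K + (\<Sum>k=2..N. (-1) ^ k * t ^ k / fact k * Omega k p K)" for t
      by (simp add: V0 Om mult_ac flip: power_add)
    with taylor_remainder_bound[of T vol_deriv M, OF vol_deriv_derivative T_pos] obtain B where
      B: "B > 0" "\<And>t. t \<in> {0..T/2} \<Longrightarrow>
        \<bar>V t - (vol K - t * Omega 1 p K + (\<Sum>k=2..N. (-1) ^ k * t ^ k / fact k * Omega k p K))\<bar> \<le> B * t ^ Suc M"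
      unfolding V0(1) by metis
    show ?thesis by (rule smallo_power_at_right[OF T_pos B(1) _ B(2)]) (simp_all add: M_def)
  qed
  have first: "Omega 1 p K = - time_deriv V 0" using td[of 1] by (simp add: Om)
  have area: "Omega 1 p K = sgn (p / (real CARD('n) + p)) * affine_surface_area p K"
    using affine_surface_area_eq[OF zero_mem] by (simp add: Om vol_deriv_def K)
  have higher: "(\<forall>A :: real^'n^'n. det A = 1 \<longrightarrow> Omega k p ((*v) A ` K) = Omega k p K) \<and>
       Omega k p K = (-1) ^ k * (time_deriv ^^ k) V 0 \<and>
       Omega k p K = (-1) ^ k * volume_variation p k K \<and>
       has_bochner_integral sphere_measure
         (\<lambda>u. (-1) ^ (k - 1) * (flow_variation p ^^ (k - 1)) (affine_density p) (support_fun K) u)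
         (Omega k p K)" if k: "k \<ge> 2" for k
  proof (intro conjI allI impI)
    fix A :: "real^'n^'n" assume "det A = 1"
    from volume_variation_linear_image[OF this] show "Omega k p ((*v) A ` K) = Omega k p K"
      by (simp add: Omega_def K)
  next
    \<comment> \<open>With \<open>k = Suc j\<close> the minus sign in \<open>vol_deriv\<close> turns
      \<open>(-1) ^ k\<close> into \<open>(-1) ^ j\<close>.\<close>
    obtain j where j: "k = Suc j" using k by (cases k) auto
    have "integrable sphere_measure ((flow_variation p ^^ j) (affine_density p) (support_fun K))"
      using integrable_flow_variation[OF zero_mem] by (simp add: K)
    from has_bochner_integral_mult_right[OF has_bochner_integral_integrable[OF this], of "(-1) ^ j"]
    show "has_bochner_integral sphere_measure
         (\<lambda>u. (-1) ^ (k - 1) * (flow_variation p ^^ (k - 1)) (affine_density p) (support_fun K) u)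
         (Omega k p K)"
      by (simp add: j Om vol_deriv_def K)
  qed (simp_all add: Om td vv)
  show ?thesis
    using smooth taylor first area higher unfolding V_def by blast
qed

end
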